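(* Let $I$ be an index set, and let $o\ell^1(I)$ denote the Banach space $\ell^1(I)$ equipped with an arbitrary operator space structure (compatible with its norm), regarded as an algebra under pointwise multiplication. Then $$o\ell^1(I)^h=\min\ell^\infty(I).$$
   Context: Here $\otimes^h$ is the Haagerup tensor product of operator spaces. For a completely contractive Banach algebra $A$ (a Banach algebra with an operator space structure whose multiplication is completely contractive on the operator space projective tensor product $A\widehat{\otimes}A$) and a left operator $A$-module $X$, the module Haagerup tensor product is $A\otimes^h_A X:=(A\otimes^h X)/N_X$, where $N_X$ is the closed linear span in $A\otimes^h X$ of $\{ab\otimes x-a\otimes b\cdot x: a,b\in A,\ x\in X\}$. The Haagerup dual of $X$ is $X^h:=(A\otimes^h_A X)^*$ with its dual operator space structure. Here $A=X=o\ell^1(I)$, acting on itself by pointwise multiplication; it is known that for any operator space structure pointwise multiplication is a complete contraction $o\ell^1(I)\otimes^h o\ell^1(I)\to o\ell^1(I)$. $\min E$ denotes the minimal operator space structure on a Banach space $E$. An equality of operator spaces means completely isometric isomorphism. *)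

theory Defs
  imports
    "HOL-Analysis.Infinite_Sum"
    "HOL-Analysis.L2_Norm"
    "HOL-Library.Poly_Mapping"
    "Jordan_Normal_Form.Matrix"
    "HOL-Algebra.AbelCoset"
    "HOL-Algebra.Module"
begin

hide_const (open) Multiset.mult (* \<open>mult\<close> is the record field of HOL-Algebra *)

section \<open>Complex vector spaces with matrix norms\<close>

text \<open>
  The spaces below (completions, quotients, duals) depend on a given operator space structure, so
  they cannot be types. A complex vector space is a \<^locale>\<open>module\<close> of HOL-Algebra over the complex
  numbers; the fields \<^const>\<open>monoid.mult\<close> and \<^const>\<open>one\<close> of the record, which the locale ignores, are
  \<^const>\<open>undefined\<close> where the space carries no product.
\<close>

definition complex_vs :: "(complex, complex) module" where
  "complex_vs = \<lparr>carrier = UNIV, mult = (*), one = 1, zero = 0, add = (+), smult = (*)\<rparr>"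

definition linear_map ::
  "(complex, 'a, 'm) module_scheme \<Rightarrow> (complex, 'b, 'n) module_scheme \<Rightarrow> ('a \<Rightarrow> 'b) \<Rightarrow> bool" where
  "linear_map V W f \<longleftrightarrow>
     f \<in> carrier V \<rightarrow> carrier W \<and>
     (\<forall>x\<in>carrier V. \<forall>y\<in>carrier V. f (x \<oplus>\<^bsub>V\<^esub> y) = f x \<oplus>\<^bsub>W\<^esub> f y) \<and>
     (\<forall>c. \<forall>x\<in>carrier V. f (c \<odot>\<^bsub>V\<^esub> x) = c \<odot>\<^bsub>W\<^esub> f x)"

definition linear_span :: "(complex, 'a, 'm) module_scheme \<Rightarrow> 'a set \<Rightarrow> 'a set" where
  "linear_span V S = \<Inter>{W. submodule W complex_vs V \<and> S \<subseteq> W}"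

definition quotient_vs :: "(complex, 'a, 'm) module_scheme \<Rightarrow> 'a set \<Rightarrow> (complex, 'a set) module" where
  "quotient_vs V N = \<lparr>carrier = a_rcosets\<^bsub>V\<^esub> N, mult = undefined, one = undefined,
     zero = N, add = (\<lambda>S T. S <+>\<^bsub>V\<^esub> T), smult = (\<lambda>c S. \<Union>s\<in>S. N +>\<^bsub>V\<^esub> (c \<odot>\<^bsub>V\<^esub> s))\<rparr>"

text \<open>
  One function \<open>mnorm\<close> comprises the norms of all rectangular matrix spaces \<open>M\<^bsub>m,n\<^esub>(V)\<close>, since a
  matrix knows its dimensions.
\<close>

record 'a opspace = "(complex, 'a) module" +
  mnorm :: "'a mat \<Rightarrow> real"

definition with_mnorm :: "(complex, 'a, 'm) module_scheme \<Rightarrow> ('a mat \<Rightarrow> real) \<Rightarrow> 'a opspace" where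
  "with_mnorm V \<mu> = \<lparr>carrier = carrier V, mult = monoid.mult V, one = one V, zero = zero V, add = add V,
     smult = smult V, mnorm = \<mu>\<rparr>"

definition vnorm :: "'a opspace \<Rightarrow> 'a \<Rightarrow> real" where
  "vnorm V v = mnorm V (mat 1 1 (\<lambda>_. v))"

definition mats :: "(complex, 'a, 'm) module_scheme \<Rightarrow> nat \<Rightarrow> nat \<Rightarrow> 'a mat set" where
  "mats V m n = {x \<in> carrier_mat m n. \<forall>i<m. \<forall>j<n. x $$ (i, j) \<in> carrier V}"

definition mat_zero :: "(complex, 'a, 'm) module_scheme \<Rightarrow> nat \<Rightarrow> nat \<Rightarrow> 'a mat" where
  "mat_zero V m n = mat m n (\<lambda>_. \<zero>\<^bsub>V\<^esub>)"

definition mat_add :: "(complex, 'a, 'm) module_scheme \<Rightarrow> 'a mat \<Rightarrow> 'a mat \<Rightarrow> 'a mat" where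
  "mat_add V x y = mat (dim_row x) (dim_col x) (\<lambda>ij. x $$ ij \<oplus>\<^bsub>V\<^esub> y $$ ij)"

definition mat_smult :: "(complex, 'a, 'm) module_scheme \<Rightarrow> complex \<Rightarrow> 'a mat \<Rightarrow> 'a mat" where
  "mat_smult V c x = map_mat (\<lambda>v. c \<odot>\<^bsub>V\<^esub> v) x"

definition mat_bimult ::
  "(complex, 'a, 'm) module_scheme \<Rightarrow> complex mat \<Rightarrow> 'a mat \<Rightarrow> complex mat \<Rightarrow> 'a mat" where
  "mat_bimult V \<alpha> x \<beta> = mat (dim_row \<alpha>) (dim_col \<beta>) (\<lambda>(i, j).
     finsum V (\<lambda>(k, l). (\<alpha> $$ (i, k) * \<beta> $$ (l, j)) \<odot>\<^bsub>V\<^esub> x $$ (k, l))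
       ({..<dim_row x} \<times> {..<dim_col x}))"

definition mat_dsum :: "(complex, 'a, 'm) module_scheme \<Rightarrow> 'a mat \<Rightarrow> 'a mat \<Rightarrow> 'a mat" where
  "mat_dsum V x y =
     four_block_mat x (mat_zero V (dim_row x) (dim_col y)) (mat_zero V (dim_row y) (dim_col x)) y"

definition op_norm :: "complex mat \<Rightarrow> real" where
  "op_norm A = Sup {L2_set (\<lambda>i. cmod ((A *\<^sub>v v) $ i)) {..<dim_row A} | v.
     v \<in> carrier_vec (dim_col A) \<and> L2_set (\<lambda>j. cmod (v $ j)) {..<dim_col A} \<le> 1}"

text \<open>
  Abstract operator spaces (Ruan). The axioms are stated for rectangular matrices; a family of norms
  on the square matrices satisfying Ruan's axioms extends uniquely to such a family, by padding with
  zeros. Completeness is not included: it is a property of the underlying norm only.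
\<close>

locale operator_space = module complex_vs V for V :: "'a opspace" +
  assumes mnorm_nonneg: "x \<in> mats V m n \<Longrightarrow> 0 \<le> mnorm V x"
    and mnorm_eq_0: "x \<in> mats V m n \<Longrightarrow> mnorm V x = 0 \<longleftrightarrow> x = mat_zero V m n"
    and mnorm_add: "x \<in> mats V m n \<Longrightarrow> y \<in> mats V m n \<Longrightarrow>
      mnorm V (mat_add V x y) \<le> mnorm V x + mnorm V y"
    and mnorm_smult: "x \<in> mats V m n \<Longrightarrow> mnorm V (mat_smult V c x) = cmod c * mnorm V x"
    and mnorm_bimult: "\<alpha> \<in> carrier_mat p m \<Longrightarrow> x \<in> mats V m n \<Longrightarrow> \<beta> \<in> carrier_mat n q \<Longrightarrow>
      mnorm V (mat_bimult V \<alpha> x \<beta>) \<le> op_norm \<alpha> * mnorm V x * op_norm \<beta>"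
    and mnorm_dsum: "x \<in> mats V m n \<Longrightarrow> y \<in> mats V p q \<Longrightarrow>
      mnorm V (mat_dsum V x y) = max (mnorm V x) (mnorm V y)"

definition completely_isometrically_isomorphic :: "'a opspace \<Rightarrow> 'b opspace \<Rightarrow> bool" where
  "completely_isometrically_isomorphic V W \<longleftrightarrow>
     (\<exists>f. linear_map V W f \<and> bij_betw f (carrier V) (carrier W) \<and>
          (\<forall>n. \<forall>x\<in>mats V n n. mnorm W (map_mat f x) = mnorm V x))"


section \<open>Quotient, completion, dual and minimal structures\<close>

text \<open>\<open>M\<^bsub>m,n\<^esub>(V/N)\<close> carries the quotient norm of \<open>M\<^bsub>m,n\<^esub>(V)/M\<^bsub>m,n\<^esub>(N)\<close>.\<close>

definition quotient_op :: "'a opspace \<Rightarrow> 'a set \<Rightarrow> 'a set opspace" where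
  "quotient_op V N = with_mnorm (quotient_vs V N)
     (\<lambda>x. Inf {mnorm V y | y. y \<in> mats V (dim_row x) (dim_col x) \<and>
                 (\<forall>i<dim_row x. \<forall>j<dim_col x. y $$ (i, j) \<in> x $$ (i, j))})"

definition cauchy_seqs :: "'a opspace \<Rightarrow> (nat \<Rightarrow> 'a) opspace" where
  "cauchy_seqs V = \<lparr>
     carrier = {s. (\<forall>k. s k \<in> carrier V) \<and>
                   (\<forall>e>0. \<exists>M. \<forall>k\<ge>M. \<forall>l\<ge>M. vnorm V (s k \<ominus>\<^bsub>V\<^esub> s l) < e)},
     mult = undefined, one = undefined,
     zero = (\<lambda>_. \<zero>\<^bsub>V\<^esub>), add = (\<lambda>s t k. s k \<oplus>\<^bsub>V\<^esub> t k), smult = (\<lambda>c s k. c \<odot>\<^bsub>V\<^esub> s k),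
     mnorm = (\<lambda>x. lim (\<lambda>k. mnorm V (map_mat (\<lambda>s. s k) x)))\<rparr>"

definition null_seqs :: "'a opspace \<Rightarrow> (nat \<Rightarrow> 'a) set" where
  "null_seqs V = {s. (\<forall>k. s k \<in> carrier V) \<and> (\<lambda>k. vnorm V (s k)) \<longlonglongrightarrow> 0}"

definition completion :: "'a opspace \<Rightarrow> (nat \<Rightarrow> 'a) set opspace" where
  "completion V = quotient_op (cauchy_seqs V) (null_seqs V)"

definition completion_embed :: "'a opspace \<Rightarrow> 'a \<Rightarrow> (nat \<Rightarrow> 'a) set" where
  "completion_embed V v = null_seqs V +>\<^bsub>cauchy_seqs V\<^esub> (\<lambda>_. v)"

definition closed_linear_span :: "'a opspace \<Rightarrow> 'a set \<Rightarrow> 'a set" where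
  "closed_linear_span V S =
     {v \<in> carrier V. \<forall>e>0. \<exists>w\<in>linear_span V S. vnorm V (v \<ominus>\<^bsub>V\<^esub> w) < e}"

text \<open>
  For \<open>\<Phi> \<in> M\<^bsub>m,n\<^esub>(V\<^sup>*)\<close> and \<open>x \<in> M\<^bsub>p,q\<^esub>(V)\<close>, \<open>amplify \<Phi> x\<close> is the block matrix
  \<open>[[\<Phi>\<^sub>i\<^sub>j(x\<^sub>k\<^sub>l)]\<^sub>i\<^sub>j]\<^sub>k\<^sub>l\<close>, that is, the \<open>(p,q)\<close>-amplification of the map \<open>v \<mapsto> [\<Phi>\<^sub>i\<^sub>j(v)]\<close> at \<open>x\<close>.
\<close>

definition amplify :: "('a \<Rightarrow> complex) mat \<Rightarrow> 'a mat \<Rightarrow> complex mat" where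
  "amplify \<Phi> x = (let m = dim_row \<Phi>; n = dim_col \<Phi> in
     mat (dim_row x * m) (dim_col x * n)
       (\<lambda>(r, s). (\<Phi> $$ (r mod m, s mod n)) (x $$ (r div m, s div n))))"

text \<open>
  The dual operator space structure is \<open>M\<^bsub>m,n\<^esub>(V\<^sup>*) = CB(V, M\<^bsub>m,n\<^esub>)\<close>. Functionals are normalised to
  vanish outside the carrier, so that distinct elements are distinct functionals.
\<close>

definition dual_op :: "'a opspace \<Rightarrow> ('a \<Rightarrow> complex) opspace" where
  "dual_op V = \<lparr>
     carrier = {f. linear_map V complex_vs f \<and> (\<forall>x. x \<notin> carrier V \<longrightarrow> f x = 0) \<and>
                   (\<exists>B. \<forall>x\<in>carrier V. cmod (f x) \<le> B * vnorm V x)},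
     mult = undefined, one = undefined,
     zero = (\<lambda>_. 0), add = (\<lambda>f g x. f x + g x), smult = (\<lambda>c f x. c * f x),
     mnorm = (\<lambda>\<Phi>. Sup {op_norm (amplify \<Phi> x) | x p. x \<in> mats V p p \<and> mnorm V x \<le> 1})\<rparr>"

text \<open>\<open>min_op V \<nu>\<close> is \<open>min E\<close> for the Banach space \<open>E\<close> with underlying vector space \<open>V\<close> and norm \<open>\<nu>\<close>.\<close>

definition min_op :: "(complex, 'a, 'm) module_scheme \<Rightarrow> ('a \<Rightarrow> real) \<Rightarrow> 'a opspace" where
  "min_op V \<nu> = with_mnorm V
     (\<lambda>x. Sup {op_norm (map_mat f x) | f.
                 linear_map V complex_vs f \<and> (\<forall>v\<in>carrier V. cmod (f v) \<le> \<nu> v)})"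


section \<open>Haagerup tensor products\<close>

text \<open>
  The algebraic tensor product is the free vector space on pairs modulo the bilinearity relations.
\<close>

definition free_vs :: "'b set \<Rightarrow> (complex, 'b \<Rightarrow>\<^sub>0 complex) module" where
  "free_vs S = \<lparr>carrier = {u. Poly_Mapping.keys u \<subseteq> S}, mult = undefined, one = undefined,
     zero = 0, add = (+), smult = (\<lambda>c. Poly_Mapping.map ((*) c))\<rparr>"

definition tensor_rels :: "'a opspace \<Rightarrow> 'b opspace \<Rightarrow> (('a \<times> 'b) \<Rightarrow>\<^sub>0 complex) set" where
  "tensor_rels E F = linear_span (free_vs (carrier E \<times> carrier F))
    ({Poly_Mapping.single (x \<oplus>\<^bsub>E\<^esub> x', y) 1
        - Poly_Mapping.single (x, y) 1 - Poly_Mapping.single (x', y) 1 | x x' y.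
        x \<in> carrier E \<and> x' \<in> carrier E \<and> y \<in> carrier F} \<union>
     {Poly_Mapping.single (x, y \<oplus>\<^bsub>F\<^esub> y') 1
        - Poly_Mapping.single (x, y) 1 - Poly_Mapping.single (x, y') 1 | x y y'.
        x \<in> carrier E \<and> y \<in> carrier F \<and> y' \<in> carrier F} \<union>
     {Poly_Mapping.single (c \<odot>\<^bsub>E\<^esub> x, y) 1 - Poly_Mapping.single (x, y) c | c x y.
        x \<in> carrier E \<and> y \<in> carrier F} \<union>
     {Poly_Mapping.single (x, c \<odot>\<^bsub>F\<^esub> y) 1 - Poly_Mapping.single (x, y) c | c x y.
        x \<in> carrier E \<and> y \<in> carrier F})"

definition alg_tensor ::
  "'a opspace \<Rightarrow> 'b opspace \<Rightarrow> (complex, (('a \<times> 'b) \<Rightarrow>\<^sub>0 complex) set) module" where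
  "alg_tensor E F = quotient_vs (free_vs (carrier E \<times> carrier F)) (tensor_rels E F)"

definition alg_tensor_elem ::
  "'a opspace \<Rightarrow> 'b opspace \<Rightarrow> 'a \<Rightarrow> 'b \<Rightarrow> (('a \<times> 'b) \<Rightarrow>\<^sub>0 complex) set" where
  "alg_tensor_elem E F x y =
     tensor_rels E F +>\<^bsub>free_vs (carrier E \<times> carrier F)\<^esub> Poly_Mapping.single (x, y) 1"

definition tensor_mat_mult ::
  "'a opspace \<Rightarrow> 'b opspace \<Rightarrow> 'a mat \<Rightarrow> 'b mat \<Rightarrow> (('a \<times> 'b) \<Rightarrow>\<^sub>0 complex) set mat" where
  "tensor_mat_mult E F a b = mat (dim_row a) (dim_col b) (\<lambda>(i, j).
     finsum (alg_tensor E F) (\<lambda>k. alg_tensor_elem E F (a $$ (i, k)) (b $$ (k, j))) {..<dim_col a})"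

definition haagerup_alg ::
  "'a opspace \<Rightarrow> 'b opspace \<Rightarrow> (('a \<times> 'b) \<Rightarrow>\<^sub>0 complex) set opspace" where
  "haagerup_alg E F = with_mnorm (alg_tensor E F)
     (\<lambda>u. Inf {mnorm E a * mnorm F b | a b p.
                 a \<in> mats E (dim_row u) p \<and> b \<in> mats F p (dim_col u) \<and>
                 u = tensor_mat_mult E F a b})"

definition haagerup ::
  "'a opspace \<Rightarrow> 'b opspace \<Rightarrow> (nat \<Rightarrow> (('a \<times> 'b) \<Rightarrow>\<^sub>0 complex) set) set opspace" where
  "haagerup E F = completion (haagerup_alg E F)"

definition tensor_elem ::
  "'a opspace \<Rightarrow> 'b opspace \<Rightarrow> 'a \<Rightarrow> 'b \<Rightarrow> (nat \<Rightarrow> (('a \<times> 'b) \<Rightarrow>\<^sub>0 complex) set) set" where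
  "tensor_elem E F x y = completion_embed (haagerup_alg E F) (alg_tensor_elem E F x y)"

text \<open>
  In the following, the product of the algebra \<open>A\<close> is \<open>monoid.mult A\<close>, and \<open>act\<close> is the left action of \<open>A\<close>
  on \<open>X\<close>.
\<close>

definition balanced_subspace ::
  "'a opspace \<Rightarrow> 'x opspace \<Rightarrow> ('a \<Rightarrow> 'x \<Rightarrow> 'x) \<Rightarrow>
     (nat \<Rightarrow> (('a \<times> 'x) \<Rightarrow>\<^sub>0 complex) set) set set" where
  "balanced_subspace A X act = closed_linear_span (haagerup A X)
     {tensor_elem A X (a \<otimes>\<^bsub>A\<^esub> b) x \<ominus>\<^bsub>haagerup A X\<^esub> tensor_elem A X a (act b x) | a b x.
        a \<in> carrier A \<and> b \<in> carrier A \<and> x \<in> carrier X}"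

definition module_haagerup ::
  "'a opspace \<Rightarrow> 'x opspace \<Rightarrow> ('a \<Rightarrow> 'x \<Rightarrow> 'x) \<Rightarrow>
     (nat \<Rightarrow> (('a \<times> 'x) \<Rightarrow>\<^sub>0 complex) set) set set opspace" where
  "module_haagerup A X act = quotient_op (haagerup A X) (balanced_subspace A X act)"

definition haagerup_dual ::
  "'a opspace \<Rightarrow> 'x opspace \<Rightarrow> ('a \<Rightarrow> 'x \<Rightarrow> 'x) \<Rightarrow>
     ((nat \<Rightarrow> (('a \<times> 'x) \<Rightarrow>\<^sub>0 complex) set) set set \<Rightarrow> complex) opspace" where
  "haagerup_dual A X act = dual_op (module_haagerup A X act)"


section \<open>The spaces \<open>\<ell>\<^sup>1(I)\<close> and \<open>\<ell>\<^sup>\<infinity>(I)\<close>\<close>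

text \<open>Functions on \<open>I\<close> are represented by functions on the type that vanish outside \<open>I\<close>.\<close>

definition pointwise_vs :: "('i \<Rightarrow> complex) set \<Rightarrow> (complex, 'i \<Rightarrow> complex) module" where
  "pointwise_vs C = \<lparr>carrier = C, mult = (\<lambda>f g i. f i * g i), one = (\<lambda>_. 1),
     zero = (\<lambda>_. 0), add = (\<lambda>f g i. f i + g i), smult = (\<lambda>c f i. c * f i)\<rparr>"

definition l1 :: "'i set \<Rightarrow> (complex, 'i \<Rightarrow> complex) module" where
  "l1 I = pointwise_vs {f. (\<forall>i. i \<notin> I \<longrightarrow> f i = 0) \<and> (\<lambda>i. cmod (f i)) summable_on I}"

definition l1_norm :: "'i set \<Rightarrow> ('i \<Rightarrow> complex) \<Rightarrow> real" where
  "l1_norm I f = (\<Sum>\<^sub>\<infinity>i\<in>I. cmod (f i))"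

definition linf :: "'i set \<Rightarrow> (complex, 'i \<Rightarrow> complex) module" where
  "linf I = pointwise_vs {f. (\<forall>i. i \<notin> I \<longrightarrow> f i = 0) \<and> bdd_above ((\<lambda>i. cmod (f i)) ` I)}"

text \<open>The value 0 is inserted so that the norm is right for empty \<open>I\<close>.\<close>

definition linf_norm :: "'i set \<Rightarrow> ('i \<Rightarrow> complex) \<Rightarrow> real" where
  "linf_norm I f = Sup (insert 0 ((\<lambda>i. cmod (f i)) ` I))"

text \<open>
  \<open>\<ell>\<^sup>1(I)\<close> with matrix norms \<open>\<mu>\<close>; as for \<^const>\<open>l1\<close>, the product is pointwise multiplication.
\<close>

definition ol1 :: "'i set \<Rightarrow> (('i \<Rightarrow> complex) mat \<Rightarrow> real) \<Rightarrow> ('i \<Rightarrow> complex) opspace" where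
  "ol1 I \<mu> = with_mnorm (l1 I) \<mu>"

definition min_linf :: "'i set \<Rightarrow> ('i \<Rightarrow> complex) opspace" where
  "min_linf I = min_op (linf I) (linf_norm I)"

end

theory Submission
  imports Defs
begin

text \<open>
  Let \<open>A\<close> be \<open>\<ell>\<^sup>1(I)\<close> with the given matrix norms and \<open>\<delta>\<^sub>i\<close> its unit vectors. A functional \<open>f\<close> on the
  module tensor product does not distinguish \<open>ab \<otimes> c\<close> from \<open>a \<otimes> bc\<close>. Moving the idempotents
  \<open>\<delta>\<^sub>i\<close> across the tensor sign shows that \<open>f(a \<otimes> b) = \<Sum>\<^sub>i \<phi>(i) a(i) b(i)\<close>, where
  \<open>\<phi>(i) = f(\<delta>\<^sub>i \<otimes> \<delta>\<^sub>i)\<close> is called the symbol of \<open>f\<close> (lemma \<open>balanced_functional_has_sum\<close>).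
  The isomorphism is \<open>f \<mapsto> \<phi>\<close>.

  In \<open>min \<ell>\<^sup>\<infinity>(I)\<close> a matrix \<open>\<phi>\<close> of functions has norm \<open>K = sup\<^sub>i \<parallel>\<phi>(i)\<parallel>\<close>
  (\<open>mnorm_min_linf\<close>). A matrix of functionals with symbol \<open>\<phi>\<close> has completely bounded norm at least
  \<open>K\<close>, since \<open>\<delta>\<^sub>i \<otimes> \<delta>\<^sub>i\<close> has norm at most 1. That the norm is at most \<open>K\<close> is the heart of the matter
  (\<open>multiplier_bound\<close>). For matrices \<open>a\<close> and \<open>b\<close> over \<open>A\<close>, write \<open>a(i)\<close> and \<open>b(i)\<close> for their complex
  coefficient matrices. The functional \<open>f \<mapsto> \<Sum>\<^sub>i \<epsilon>\<^sub>i f(i)\<close> is contractive on \<open>\<ell>\<^sup>1(I)\<close> for all signs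
  \<open>\<epsilon>\<close>, hence completely contractive for every operator space structure
  (\<open>functional_bilinear_bound\<close>). For suitable signs the parallelogram law gives
  \<open>\<Sum>\<^sub>i \<parallel>b(i) x\<parallel>\<^sup>2 \<le> \<parallel>\<Sum>\<^sub>i \<epsilon>\<^sub>i b(i) x\<parallel>\<^sup>2 \<le> \<parallel>b\<parallel>\<^sup>2 \<parallel>x\<parallel>\<^sup>2\<close>, and likewise for the rows of \<open>a\<close>. The
  Cauchy-Schwarz inequality then bounds \<open>\<Sum>\<^sub>i \<phi>(i) \<otimes> a(i) b(i)\<close> by \<open>K \<parallel>a\<parallel> \<parallel>b\<parallel>\<close>. Only the norm of
  \<open>\<ell>\<^sup>1(I)\<close> enters here, which is why the operator space structure may be arbitrary.

  The same bound also shows that a functional with symbol 0 vanishes, so that symbols are injective, and that every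
  bounded \<open>\<phi>\<close> defines a bounded functional, so that they exhaust \<open>\<ell>\<^sup>\<infinity>(I)\<close>.

  The remaining work is to carry such bounds from the algebraic tensor product to its completion
  and to the quotient by the balanced subspace. The limits and infima that define the norms there behave well
  because the Haagerup norms form a seminorm on each space of matrices and are dominated by the sum over
  the entries (\<open>entrywise_seminormed_H\<close>).
\<close>

section \<open>The operator norm through bilinear forms\<close>

abbreviation l2 :: "nat \<Rightarrow> (nat \<Rightarrow> complex) \<Rightarrow> real" where
  "l2 n x \<equiv> L2_set (\<lambda>i. cmod (x i)) {..<n}"

lemma l2_square: "(l2 n x)\<^sup>2 = (\<Sum>i<n. (cmod (x i))\<^sup>2)"
  by (simp add: L2_set_def sum_nonneg)

lemma l2_scale: "l2 n (\<lambda>i. c * x i) = cmod c * l2 n x"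
  by (simp add: norm_mult L2_set_right_distrib)

lemma cmod_sum_mult_le_l2: "cmod (\<Sum>i<n. x i * y i) \<le> l2 n x * l2 n y"
proof -
  have "cmod (\<Sum>i<n. x i * y i) \<le> (\<Sum>i<n. \<bar>cmod (x i)\<bar> * \<bar>cmod (y i)\<bar>)"
    by (rule order_trans[OF norm_sum]) (simp add: norm_mult)
  also have "\<dots> \<le> l2 n x * l2 n y"
    by (rule L2_set_mult_ineq)
  finally show ?thesis .
qed

text \<open>Testing against the conjugate of \<open>w\<close> itself turns a bound on a linear form into one on \<open>w\<close>.\<close>

lemma l2_le_of_linear_form:
  assumes "0 \<le> C" and "\<And>y. cmod (\<Sum>i<n. y i * w i) \<le> C * l2 n y"
  shows "l2 n w \<le> C"
proof -
  have "(\<Sum>i<n. cnj (w i) * w i) = of_real (\<Sum>i<n. (cmod (w i))\<^sup>2)"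
    unfolding of_real_sum by (intro sum.cong refl) (subst complex_norm_square, simp)
  then have "cmod (\<Sum>i<n. cnj (w i) * w i) = (l2 n w)\<^sup>2"
    by (metis abs_of_nonneg norm_of_real l2_square zero_le_power2)
  then have "(l2 n w)\<^sup>2 \<le> C * l2 n w"
    using assms(2)[of "\<lambda>i. cnj (w i)"] by simp
  then show ?thesis
    using assms(1) by (cases "l2 n w = 0") (auto simp: power2_eq_square less_le)
qed

lemma mult_mat_vec_index:
  assumes "i < dim_row A" "v \<in> carrier_vec (dim_col A)"
  shows "(A *\<^sub>v v) $ i = (\<Sum>j<dim_col A. A $$ (i, j) * v $ j)"
  using assms by (simp add: scalar_prod_def lessThan_atLeast0)

lemma mult_vec_le_entries:
  assumes v: "v \<in> carrier_vec (dim_col A)" and le: "L2_set (\<lambda>j. cmod (v $ j)) {..<dim_col A} \<le> 1"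
  shows "L2_set (\<lambda>i. cmod ((A *\<^sub>v v) $ i)) {..<dim_row A}
    \<le> (\<Sum>i<dim_row A. \<Sum>j<dim_col A. cmod (A $$ (i, j)))"
proof -
  have v1: "cmod (v $ j) \<le> 1" if "j < dim_col A" for j
    using member_le_L2_set[of "{..<dim_col A}" j "\<lambda>j. cmod (v $ j)"] le that by simp
  have "L2_set (\<lambda>i. cmod ((A *\<^sub>v v) $ i)) {..<dim_row A} \<le> (\<Sum>i<dim_row A. cmod ((A *\<^sub>v v) $ i))"
    by (rule L2_set_le_sum) simp
  also have "\<dots> \<le> (\<Sum>i<dim_row A. \<Sum>j<dim_col A. cmod (A $$ (i, j)))"
  proof (rule sum_mono)
    fix i assume "i \<in> {..<dim_row A}"
    then have "cmod ((A *\<^sub>v v) $ i) \<le> (\<Sum>j<dim_col A. cmod (A $$ (i, j)) * cmod (v $ j))"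
      using v by (simp add: mult_mat_vec_index order_trans[OF norm_sum] norm_mult del: index_mult_mat_vec)
    also have "\<dots> \<le> (\<Sum>j<dim_col A. cmod (A $$ (i, j)))"
      by (rule sum_mono) (use v1 in \<open>auto intro: mult_left_le\<close>)
    finally show "cmod ((A *\<^sub>v v) $ i) \<le> (\<Sum>j<dim_col A. cmod (A $$ (i, j)))" .
  qed
  finally show ?thesis .
qed

lemma op_norm_set_bdd:
  "bdd_above {L2_set (\<lambda>i. cmod ((A *\<^sub>v v) $ i)) {..<dim_row A} | v.
     v \<in> carrier_vec (dim_col A) \<and> L2_set (\<lambda>j. cmod (v $ j)) {..<dim_col A} \<le> 1}"
  using mult_vec_le_entries by (intro bdd_aboveI) blast

lemma op_norm_set_nonempty:
  "{L2_set (\<lambda>i. cmod ((A *\<^sub>v v) $ i)) {..<dim_row A} | v.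
     v \<in> carrier_vec (dim_col A) \<and> L2_set (\<lambda>j. cmod (v $ j)) {..<dim_col A} \<le> 1} \<noteq> {}"
  by (auto intro!: exI[of _ "0\<^sub>v (dim_col A)"] simp: L2_set_def)

lemma op_norm_le_entries: "op_norm A \<le> (\<Sum>i<dim_row A. \<Sum>j<dim_col A. cmod (A $$ (i, j)))"
  unfolding op_norm_def using mult_vec_le_entries by (intro cSup_least op_norm_set_nonempty) blast

lemma l2_mult_vec_le_op_norm:
  "l2 (dim_row A) (\<lambda>i. \<Sum>j<dim_col A. A $$ (i, j) * x j) \<le> op_norm A * l2 (dim_col A) x"
proof (cases "l2 (dim_col A) x = 0")
  case True
  then have "x j = 0" if "j < dim_col A" for j
    using that by (simp add: L2_set_eq_0_iff)
  then show ?thesis using True by (simp add: L2_set_def)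
next
  case False
  define L where "L = l2 (dim_col A) x"
  have L: "0 < L" using False by (simp add: L_def less_le)
  define v where "v = vec (dim_col A) (\<lambda>j. of_real (1 / L) * x j)"
  have v: "v \<in> carrier_vec (dim_col A)" by (simp add: v_def)
  have "L2_set (\<lambda>j. cmod (v $ j)) {..<dim_col A} = l2 (dim_col A) (\<lambda>j. of_real (1 / L) * x j)"
    by (rule L2_set_cong) (auto simp: v_def)
  also have "\<dots> = 1"
    using L by (subst l2_scale) (simp add: L_def[symmetric] norm_divide)
  finally have "L2_set (\<lambda>i. cmod ((A *\<^sub>v v) $ i)) {..<dim_row A} \<le> op_norm A"
    unfolding op_norm_def using v by (intro cSup_upper op_norm_set_bdd) auto
  also have "L2_set (\<lambda>i. cmod ((A *\<^sub>v v) $ i)) {..<dim_row A}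
      = l2 (dim_row A) (\<lambda>i. of_real (1 / L) * (\<Sum>j<dim_col A. A $$ (i, j) * x j))"
    using v by (intro L2_set_cong)
      (auto simp: mult_mat_vec_index v_def sum_distrib_left mult_ac simp del: index_mult_mat_vec)
  also have "\<dots> = 1 / L * l2 (dim_row A) (\<lambda>i. \<Sum>j<dim_col A. A $$ (i, j) * x j)"
    using L by (subst l2_scale) (simp add: norm_divide)
  finally show ?thesis
    using L by (simp add: L_def[symmetric] field_simps)
qed

lemma op_norm_nonneg: "0 \<le> op_norm A"
proof -
  have "L2_set (\<lambda>i. cmod ((A *\<^sub>v 0\<^sub>v (dim_col A)) $ i)) {..<dim_row A} \<le> op_norm A"
    unfolding op_norm_def
    by (rule cSup_upper[OF _ op_norm_set_bdd]) (auto intro!: exI[of _ "0\<^sub>v (dim_col A)"] simp: L2_set_def)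
  then show ?thesis using L2_set_nonneg order_trans by blast
qed

lemma op_norm_leI_l2:
  assumes "0 \<le> C"
    and "\<And>x. l2 (dim_row A) (\<lambda>i. \<Sum>j<dim_col A. A $$ (i, j) * x j) \<le> C * l2 (dim_col A) x"
  shows "op_norm A \<le> C"
  unfolding op_norm_def
proof (rule cSup_least[OF op_norm_set_nonempty])
  fix r assume "r \<in> {L2_set (\<lambda>i. cmod ((A *\<^sub>v v) $ i)) {..<dim_row A} | v.
     v \<in> carrier_vec (dim_col A) \<and> L2_set (\<lambda>j. cmod (v $ j)) {..<dim_col A} \<le> 1}"
  then obtain v where r: "r = L2_set (\<lambda>i. cmod ((A *\<^sub>v v) $ i)) {..<dim_row A}"
    and v: "v \<in> carrier_vec (dim_col A)" and v1: "L2_set (\<lambda>j. cmod (v $ j)) {..<dim_col A} \<le> 1"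
    by blast
  have "r = l2 (dim_row A) (\<lambda>i. \<Sum>j<dim_col A. A $$ (i, j) * v $ j)"
    unfolding r using v by (intro L2_set_cong) (auto simp: mult_mat_vec_index simp del: index_mult_mat_vec)
  also have "\<dots> \<le> C * l2 (dim_col A) (\<lambda>j. v $ j)"
    by (rule assms(2))
  also have "\<dots> \<le> C"
    using v1 assms(1) by (simp add: mult_left_le)
  finally show "r \<le> C" .
qed

text \<open>
  Estimates of operator norms are done on bilinear forms: these are linear in the matrix entries, so
  they commute with functionals and with limits, and rows and columns play symmetric roles.
\<close>

definition bilin :: "complex mat \<Rightarrow> (nat \<Rightarrow> complex) \<Rightarrow> (nat \<Rightarrow> complex) \<Rightarrow> complex" where
  "bilin A y x = (\<Sum>i<dim_row A. \<Sum>j<dim_col A. y i * A $$ (i, j) * x j)"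

lemma bilin_alt: "bilin A y x = (\<Sum>i<dim_row A. y i * (\<Sum>j<dim_col A. A $$ (i, j) * x j))"
  by (simp add: bilin_def sum_distrib_left mult.assoc)

lemma bilin_le_op_norm: "cmod (bilin A y x) \<le> op_norm A * l2 (dim_row A) y * l2 (dim_col A) x"
proof -
  have "cmod (bilin A y x)
      \<le> l2 (dim_row A) y * l2 (dim_row A) (\<lambda>i. \<Sum>j<dim_col A. A $$ (i, j) * x j)"
    unfolding bilin_alt by (rule cmod_sum_mult_le_l2)
  also have "\<dots> \<le> l2 (dim_row A) y * (op_norm A * l2 (dim_col A) x)"
    by (intro mult_left_mono l2_mult_vec_le_op_norm L2_set_nonneg)
  finally show ?thesis by (simp add: mult_ac)
qed

lemma op_norm_leI:
  assumes "0 \<le> C" and "\<And>y x. cmod (bilin A y x) \<le> C * l2 (dim_row A) y * l2 (dim_col A) x"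
  shows "op_norm A \<le> C"
proof (rule op_norm_leI_l2[OF assms(1)])
  fix x
  show "l2 (dim_row A) (\<lambda>i. \<Sum>j<dim_col A. A $$ (i, j) * x j) \<le> C * l2 (dim_col A) x"
  proof (rule l2_le_of_linear_form)
    show "0 \<le> C * l2 (dim_col A) x" using assms(1) by (simp add: L2_set_nonneg)
    show "cmod (\<Sum>i<dim_row A. y i * (\<Sum>j<dim_col A. A $$ (i, j) * x j))
        \<le> C * l2 (dim_col A) x * l2 (dim_row A) y" for y
      using assms(2)[of y x] by (simp add: bilin_alt mult_ac)
  qed
qed

lemma op_norm_1x1: "op_norm (mat 1 1 (\<lambda>_. z)) = cmod z"
proof (rule antisym)
  show "op_norm (mat 1 1 (\<lambda>_. z)) \<le> cmod z"
    by (rule op_norm_leI) (auto simp: bilin_def L2_set_def norm_mult)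
  show "cmod z \<le> op_norm (mat 1 1 (\<lambda>_. z))"
    using bilin_le_op_norm[of "mat 1 1 (\<lambda>_. z)" "\<lambda>_. 1" "\<lambda>_. 1"]
    by (simp add: bilin_def L2_set_def)
qed

text \<open>
  This is \<open>[s1, t1]\<close>: by the Cauchy-Schwarz inequality in two dimensions,
  \<open>\<bar>s x\<^sub>i + t x\<^sub>m\<^sub>+\<^sub>i\<bar>\<^sup>2 \<le> (s\<^sup>2 + t\<^sup>2) (\<bar>x\<^sub>i\<bar>\<^sup>2 + \<bar>x\<^sub>m\<^sub>+\<^sub>i\<bar>\<^sup>2)\<close> for every \<open>i < m\<close>.
\<close>

lemma op_norm_row_block:
  "op_norm (mat m (m + m) (\<lambda>(i, k). if k = i then complex_of_real s else if k = m + i then of_real t else 0))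
     \<le> sqrt (s\<^sup>2 + t\<^sup>2)" (is "op_norm ?A \<le> _")
proof (rule op_norm_leI_l2)
  fix x :: "nat \<Rightarrow> complex"
  have entry: "(\<Sum>j<m + m. ?A $$ (i, j) * x j) = of_real s * x i + of_real t * x (m + i)" if "i < m" for i
  proof -
    have "(\<Sum>j<m + m. ?A $$ (i, j) * x j)
        = (\<Sum>j<m + m. (if j = i then of_real s * x j else 0) + (if j = m + i then of_real t * x j else 0))"
      by (rule sum.cong) (use that in auto)
    then show ?thesis using that by (simp add: sum.distrib)
  qed
  have split: "(l2 (m + m) x)\<^sup>2 = (\<Sum>i<m. (cmod (x i))\<^sup>2 + (cmod (x (m + i)))\<^sup>2)"
    by (simp add: L2_set_def sum_nonneg sum.distrib sum.nat_diff_reindex lessThan_atLeast0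
        sum.atLeastLessThan_concat[of 0 m "m + m", symmetric] sum.shift_bounds_nat_ivl[of _ 0 m m, simplified] add.commute)
  have "(l2 m (\<lambda>i. of_real s * x i + of_real t * x (m + i)))\<^sup>2
      = (\<Sum>i<m. (cmod (of_real s * x i + of_real t * x (m + i)))\<^sup>2)"
    by (simp add: L2_set_def sum_nonneg)
  also have "\<dots> \<le> (\<Sum>i<m. (s\<^sup>2 + t\<^sup>2) * ((cmod (x i))\<^sup>2 + (cmod (x (m + i)))\<^sup>2))"
  proof (rule sum_mono)
    fix i
    have "cmod (of_real s * x i + of_real t * x (m + i)) \<le> \<bar>s\<bar> * cmod (x i) + \<bar>t\<bar> * cmod (x (m + i))"
      by (rule order_trans[OF norm_triangle_ineq]) (simp add: norm_mult)
    then have "(cmod (of_real s * x i + of_real t * x (m + i)))\<^sup>2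
        \<le> (\<bar>s\<bar> * cmod (x i) + \<bar>t\<bar> * cmod (x (m + i)))\<^sup>2"
      by (simp add: power_mono)
    also have "\<dots> \<le> (s\<^sup>2 + t\<^sup>2) * ((cmod (x i))\<^sup>2 + (cmod (x (m + i)))\<^sup>2)"
    proof -
      have "0 \<le> (\<bar>s\<bar> * cmod (x (m + i)) - \<bar>t\<bar> * cmod (x i))\<^sup>2" by simp
      moreover have "\<bar>s\<bar> * \<bar>s\<bar> = s\<^sup>2" "\<bar>t\<bar> * \<bar>t\<bar> = t\<^sup>2" by (simp_all add: power2_eq_square)
      ultimately show ?thesis by (simp add: power2_diff power2_sum power_mult_distrib algebra_simps)
    qed
    finally show "(cmod (of_real s * x i + of_real t * x (m + i)))\<^sup>2
        \<le> (s\<^sup>2 + t\<^sup>2) * ((cmod (x i))\<^sup>2 + (cmod (x (m + i)))\<^sup>2)" by simp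
  qed
  also have "\<dots> = (sqrt (s\<^sup>2 + t\<^sup>2) * l2 (m + m) x)\<^sup>2"
    by (simp add: power_mult_distrib split sum_distrib_left)
  finally have "l2 m (\<lambda>i. of_real s * x i + of_real t * x (m + i)) \<le> sqrt (s\<^sup>2 + t\<^sup>2) * l2 (m + m) x"
    by (rule power2_le_imp_le) (simp add: L2_set_nonneg)
  moreover have "l2 m (\<lambda>i. \<Sum>j<m + m. ?A $$ (i, j) * x j)
      = l2 m (\<lambda>i. of_real s * x i + of_real t * x (m + i))"
    using entry by (intro L2_set_cong) auto
  ultimately show "l2 (dim_row ?A) (\<lambda>i. \<Sum>j<dim_col ?A. ?A $$ (i, j) * x j)
      \<le> sqrt (s\<^sup>2 + t\<^sup>2) * l2 (dim_col ?A) x"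
    by simp
qed simp

lemma op_norm_transpose_le: "op_norm (transpose_mat A) \<le> op_norm A"
proof (rule op_norm_leI[OF op_norm_nonneg])
  fix y x
  have "bilin (transpose_mat A) y x = bilin A x y"
    unfolding bilin_def by (subst sum.swap) (auto intro!: sum.cong simp: mult_ac)
  then show "cmod (bilin (transpose_mat A) y x)
      \<le> op_norm A * l2 (dim_row (transpose_mat A)) y * l2 (dim_col (transpose_mat A)) x"
    using bilin_le_op_norm[of A x y] by (simp add: mult_ac)
qed

lemma op_norm_one_le: "op_norm (1\<^sub>m n) \<le> 1"
proof (rule op_norm_leI_l2)
  fix x
  have "(\<Sum>j<n. (1\<^sub>m n :: complex mat) $$ (i, j) * x j) = x i" if "i < n" for i
  proof -
    have "(\<Sum>j<n. (1\<^sub>m n :: complex mat) $$ (i, j) * x j) = (\<Sum>j<n. if j = i then x j else 0)"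
      by (rule sum.cong) (use that in auto)
    then show ?thesis using that by simp
  qed
  then have "l2 n (\<lambda>i. \<Sum>j<n. (1\<^sub>m n :: complex mat) $$ (i, j) * x j) = l2 n x"
    by (intro L2_set_cong) auto
  then show "l2 (dim_row (1\<^sub>m n)) (\<lambda>i. \<Sum>j<dim_col (1\<^sub>m n). 1\<^sub>m n $$ (i, j) * x j) \<le> 1 * l2 (dim_col (1\<^sub>m n)) x"
    by simp
qed simp

lemma op_norm_row_le: "op_norm (mat 1 n (\<lambda>(_, j). x j)) \<le> l2 n x"
proof (rule op_norm_leI_l2)
  fix z
  have "cmod (\<Sum>j<n. x j * z j) \<le> l2 n x * l2 n z" by (rule cmod_sum_mult_le_l2)
  then show "l2 (dim_row (mat 1 n (\<lambda>(_, j). x j)))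
      (\<lambda>i. \<Sum>j<dim_col (mat 1 n (\<lambda>(_, j). x j)). mat 1 n (\<lambda>(_, j). x j) $$ (i, j) * z j)
    \<le> l2 n x * l2 (dim_col (mat 1 n (\<lambda>(_, j). x j))) z"
    by (simp add: L2_set_def)
qed (simp add: L2_set_nonneg)

lemma op_norm_col_le: "op_norm (mat n 1 (\<lambda>(i, _). x i)) \<le> l2 n x"
proof -
  have "mat n 1 (\<lambda>(i, _). x i) = transpose_mat (mat 1 n (\<lambda>(_, j). x j))"
    by (rule eq_matI) auto
  then show ?thesis using op_norm_transpose_le op_norm_row_le order_trans by metis
qed

section \<open>Complex vector spaces, linear functionals and quotients\<close>

lemma complex_vs_simps [simp]:
  "carrier complex_vs = UNIV" "monoid.mult complex_vs = (*)" "one complex_vs = 1"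
  "zero complex_vs = 0" "add complex_vs = (+)" "smult complex_vs = (*)"
  by (simp_all add: complex_vs_def)

lemma cring_complex_vs: "cring complex_vs"
proof (rule cringI)
  show "abelian_group complex_vs"
  proof (rule abelian_groupI)
    show "\<exists>y\<in>carrier complex_vs. y \<oplus>\<^bsub>complex_vs\<^esub> x = \<zero>\<^bsub>complex_vs\<^esub>" for x
      by (rule bexI[of _ "- x"]) auto
  qed auto
  show "comm_monoid complex_vs"
    by (rule comm_monoidI) auto
qed (simp add: distrib_right)

lemma complex_moduleI:
  fixes V (structure)
  assumes "\<zero> \<in> carrier V"
    and "\<And>x y. x \<in> carrier V \<Longrightarrow> y \<in> carrier V \<Longrightarrow> x \<oplus> y \<in> carrier V"
    and "\<And>c x. x \<in> carrier V \<Longrightarrow> c \<odot> x \<in> carrier V"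
    and "\<And>x y z. x \<in> carrier V \<Longrightarrow> y \<in> carrier V \<Longrightarrow> z \<in> carrier V \<Longrightarrow> x \<oplus> y \<oplus> z = x \<oplus> (y \<oplus> z)"
    and comm: "\<And>x y. x \<in> carrier V \<Longrightarrow> y \<in> carrier V \<Longrightarrow> x \<oplus> y = y \<oplus> x"
    and "\<And>x. x \<in> carrier V \<Longrightarrow> \<zero> \<oplus> x = x"
    and inv: "\<And>x. x \<in> carrier V \<Longrightarrow> x \<oplus> (-1) \<odot> x = \<zero>"
    and "\<And>a b x. x \<in> carrier V \<Longrightarrow> (a + b) \<odot> x = a \<odot> x \<oplus> b \<odot> x"
    and "\<And>a x y. x \<in> carrier V \<Longrightarrow> y \<in> carrier V \<Longrightarrow> a \<odot> (x \<oplus> y) = a \<odot> x \<oplus> a \<odot> y"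
    and "\<And>a b x. x \<in> carrier V \<Longrightarrow> (a * b) \<odot> x = a \<odot> (b \<odot> x)"
    and "\<And>x. x \<in> carrier V \<Longrightarrow> 1 \<odot> x = x"
  shows "module complex_vs V"
proof (rule moduleI[OF cring_complex_vs])
  show "abelian_group V"
  proof (rule abelian_groupI)
    show "\<exists>y\<in>carrier V. y \<oplus> x = \<zero>" if "x \<in> carrier V" for x
      using that by (intro bexI[of _ "(-1) \<odot> x"]) (auto simp: inv comm assms(3))
  qed (use assms in auto)
qed (use assms in auto)

text \<open>
  The module rules with the operations of \<^const>\<open>complex_vs\<close> written as those of the complex numbers, which
  is the form that the simplifier leaves.
\<close>

lemma complex_module_rules:
  fixes V (structure)
  assumes "module complex_vs V" "x \<in> carrier V"
  shows "1 \<odot> x = x" and "0 \<odot> x = \<zero>"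
    and "(a + b) \<odot> x = a \<odot> x \<oplus> b \<odot> x"
    and "(a * b) \<odot> x = a \<odot> (b \<odot> x)"
    and "x \<oplus> (-1) \<odot> x = \<zero>"
proof -
  interpret module complex_vs V by fact
  show one: "1 \<odot> x = x" using smult_one[OF assms(2)] by simp
  show null: "0 \<odot> x = \<zero>" using smult_l_null[OF assms(2)] by simp
  show add: "(a + b) \<odot> x = a \<odot> x \<oplus> b \<odot> x" for a b
    using smult_l_distr[of a b x] assms(2) by simp
  show "(a * b) \<odot> x = a \<odot> (b \<odot> x)"
    using smult_assoc1[of a b x] assms(2) by simp
  show "x \<oplus> (-1) \<odot> x = \<zero>"
    using add[of 1 "-1"] one null by simp
qed

lemma complex_module_cong:
  assumes "module complex_vs V" "carrier W = carrier V" "zero W = zero V" "add W = add V" "smult W = smult V"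
  shows "module complex_vs W"
proof -
  interpret module complex_vs V by fact
  show ?thesis
    by (rule complex_moduleI)
      (simp_all add: assms(2-) a_assoc smult_r_distr complex_module_rules[OF assms(1)], simp add: a_comm)
qed

lemma with_mnorm_simps [simp]:
  "carrier (with_mnorm V \<mu>) = carrier V" "monoid.mult (with_mnorm V \<mu>) = monoid.mult V"
  "zero (with_mnorm V \<mu>) = zero V" "add (with_mnorm V \<mu>) = add V"
  "smult (with_mnorm V \<mu>) = smult V" "mnorm (with_mnorm V \<mu>) = \<mu>"
  "mats (with_mnorm V \<mu>) = mats V" "mat_zero (with_mnorm V \<mu>) = mat_zero V"
  "mat_add (with_mnorm V \<mu>) = mat_add V" "mat_smult (with_mnorm V \<mu>) = mat_smult V"
  "linear_map (with_mnorm V \<mu>) W = linear_map V W"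
  "linear_map W' (with_mnorm V \<mu>) = linear_map W' V"
  by (simp_all add: with_mnorm_def mats_def mat_zero_def mat_add_def mat_smult_def linear_map_def fun_eq_iff)

lemma module_with_mnorm [simp]: "module complex_vs (with_mnorm V \<mu>) \<longleftrightarrow> module complex_vs V"
  using complex_module_cong[of V "with_mnorm V \<mu>"] complex_module_cong[of "with_mnorm V \<mu>" V] by auto

lemma minus_complex_module:
  fixes V (structure)
  assumes "module complex_vs V" "x \<in> carrier V" "y \<in> carrier V"
  shows "x \<ominus> y = x \<oplus> (-1) \<odot> y"
proof -
  interpret module complex_vs V by fact
  have "\<ominus>\<^bsub>complex_vs\<^esub> 1 = -1"
    by (rule R.minus_equality) auto
  then show ?thesis
    using smult_l_minus[of 1 y] assms by (simp add: a_minus_def complex_module_rules)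
qed

lemma complex_submoduleI:
  fixes V (structure)
  assumes "module complex_vs V" "N \<subseteq> carrier V" "\<zero> \<in> N"
    and "\<And>x y. x \<in> N \<Longrightarrow> y \<in> N \<Longrightarrow> x \<oplus> y \<in> N" and "\<And>c x. x \<in> N \<Longrightarrow> c \<odot> x \<in> N"
  shows "submodule N complex_vs V"
proof -
  interpret module complex_vs V by fact
  have "\<ominus>\<^bsub>complex_vs\<^esub> 1 = -1"
    by (rule R.minus_equality) auto
  then have "\<ominus> x = (-1) \<odot> x" if "x \<in> carrier V" for x
    using smult_l_minus[of 1 x] that by (simp add: complex_module_rules[OF assms(1)])
  then show ?thesis
    using assms by (intro submoduleI) auto
qed

lemma linear_mapI:
  assumes "\<And>x. x \<in> carrier V \<Longrightarrow> f x \<in> carrier W"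
    and "\<And>x y. x \<in> carrier V \<Longrightarrow> y \<in> carrier V \<Longrightarrow> f (x \<oplus>\<^bsub>V\<^esub> y) = f x \<oplus>\<^bsub>W\<^esub> f y"
    and "\<And>c x. x \<in> carrier V \<Longrightarrow> f (c \<odot>\<^bsub>V\<^esub> x) = c \<odot>\<^bsub>W\<^esub> f x"
  shows "linear_map V W f"
  using assms by (auto simp: linear_map_def)

lemma linear_mapD:
  assumes "linear_map V W f"
  shows "x \<in> carrier V \<Longrightarrow> f x \<in> carrier W"
    and "x \<in> carrier V \<Longrightarrow> y \<in> carrier V \<Longrightarrow> f (x \<oplus>\<^bsub>V\<^esub> y) = f x \<oplus>\<^bsub>W\<^esub> f y"
    and "x \<in> carrier V \<Longrightarrow> f (c \<odot>\<^bsub>V\<^esub> x) = c \<odot>\<^bsub>W\<^esub> f x"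
  using assms by (auto simp: linear_map_def)

lemma linear_map_comp:
  "linear_map V W f \<Longrightarrow> linear_map W U g \<Longrightarrow> linear_map V U (\<lambda>x. g (f x))"
  by (simp add: linear_map_def Pi_iff)

lemma linear_functional_zero:
  fixes V (structure)
  assumes "module complex_vs V" "linear_map V complex_vs f"
  shows "f \<zero> = 0"
proof -
  interpret module complex_vs V by fact
  have "f (0 \<odot> \<zero>) = 0 * f \<zero>"
    using linear_mapD(3)[OF assms(2), of "\<zero>" 0] by simp
  then show ?thesis by (simp add: complex_module_rules[OF assms(1)])
qed

lemma linear_functional_diff:
  fixes V (structure)
  assumes "module complex_vs V" "linear_map V complex_vs f" "x \<in> carrier V" "y \<in> carrier V"
  shows "f (x \<ominus> y) = f x - f y"
proof -
  interpret module complex_vs V by fact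
  show ?thesis
    using assms(3,4)
    by (simp add: minus_complex_module[OF assms(1)] linear_mapD[OF assms(2)])
qed

lemma linear_functional_finsum:
  assumes "module complex_vs V" "linear_map V complex_vs f" "finite A" "g \<in> A \<rightarrow> carrier V"
  shows "f (finsum V g A) = (\<Sum>a\<in>A. f (g a))"
proof -
  interpret module complex_vs V by fact
  show ?thesis
    using assms(3,4)
  proof (induction A)
    case empty
    show ?case by (simp add: linear_functional_zero[OF assms(1,2)])
  next
    case (insert a A)
    then show ?case
      by (simp add: linear_mapD(2)[OF assms(2)] finsum_closed Pi_def)
  qed
qed

lemma kernel_submodule:
  assumes "module complex_vs V" "linear_map V complex_vs f"
  shows "submodule {x \<in> carrier V. f x = 0} complex_vs V"
proof -
  interpret module complex_vs V by fact
  show ?thesis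
    by (rule complex_submoduleI[OF assms(1)])
      (auto simp: linear_functional_zero[OF assms] linear_mapD[OF assms(2)])
qed

lemma linear_span_least: "submodule W complex_vs V \<Longrightarrow> S \<subseteq> W \<Longrightarrow> linear_span V S \<subseteq> W"
  by (auto simp: linear_span_def)

lemma linear_span_superset: "S \<subseteq> linear_span V S"
  by (auto simp: linear_span_def)

lemma linear_span_submodule:
  assumes "module complex_vs V" "S \<subseteq> carrier V"
  shows "submodule (linear_span V S) complex_vs V"
proof -
  interpret module complex_vs V by fact
  have car: "linear_span V S \<subseteq> carrier V"
    by (rule linear_span_least[OF carrier_is_submodule assms(2)])
  show ?thesis
  proof (rule complex_submoduleI[OF assms(1) car])
    show "\<zero>\<^bsub>V\<^esub> \<in> linear_span V S"
      by (auto simp: linear_span_def submodule_def dest: subgroup.one_closed)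
  qed (auto simp: linear_span_def submoduleE(5) submoduleE(4))
qed

lemma linear_functional_zero_on_span:
  assumes "module complex_vs V" "linear_map V complex_vs f" "S \<subseteq> carrier V" "\<And>s. s \<in> S \<Longrightarrow> f s = 0"
    and "x \<in> linear_span V S"
  shows "f x = 0"
  using linear_span_least[OF kernel_submodule[OF assms(1,2)], of S] assms(3-5) by auto

locale complex_subspace = module complex_vs V
  for V :: "(complex, 'a, 'm) module_scheme" (structure) +
  fixes N :: "'a set"
  assumes submodule: "submodule N complex_vs V"
begin

abbreviation \<pi> :: "'a \<Rightarrow> 'a set" where "\<pi> v \<equiv> N +> v"

lemma abelian_subgroup: "abelian_subgroup N V"
proof (rule abelian_subgroupI3)
  show "additive_subgroup N V"
    using submodule by (simp add: additive_subgroup_def submodule_def)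
  show "abelian_group V" ..
qed

lemma a_subgroup: "subgroup N (add_monoid V)"
  using submodule by (simp add: submodule_def)

lemma N_subset: "N \<subseteq> carrier V"
  using subgroup.subset[OF a_subgroup] by simp

lemma N_smult: "x \<in> N \<Longrightarrow> c \<odot> x \<in> N"
  by (rule submoduleE(4)[OF submodule]) simp_all

lemma quotient_carrier: "carrier (quotient_vs V N) = \<pi> ` carrier V"
  by (auto simp: quotient_vs_def A_RCOSETS_def')

lemma coset_in_quotient [simp]: "x \<in> carrier V \<Longrightarrow> \<pi> x \<in> carrier (quotient_vs V N)"
  by (simp add: quotient_carrier)

lemma quotient_zero: "\<zero>\<^bsub>quotient_vs V N\<^esub> = \<pi> \<zero>"
  by (simp add: quotient_vs_def N_subset)

lemma quotient_add:
  "x \<in> carrier V \<Longrightarrow> y \<in> carrier V \<Longrightarrow>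
    \<pi> x \<oplus>\<^bsub>quotient_vs V N\<^esub> \<pi> y = \<pi> (x \<oplus> y)"
  by (simp add: quotient_vs_def abelian_subgroup.a_rcos_sum[OF abelian_subgroup])

lemma mem_coset_eq: "y \<in> \<pi> x \<Longrightarrow> x \<in> carrier V \<Longrightarrow> \<pi> y = \<pi> x"
  by (rule a_repr_independence[symmetric, OF _ _ a_subgroup])

lemma self_mem_coset: "x \<in> carrier V \<Longrightarrow> x \<in> \<pi> x"
  by (rule abelian_subgroup.a_rcos_self[OF abelian_subgroup])

lemma coset_subset_carrier: "x \<in> carrier V \<Longrightarrow> \<pi> x \<subseteq> carrier V"
  by (rule a_r_coset_subset_G[OF N_subset])

lemma coset_eq_iff:
  assumes "x \<in> carrier V" "y \<in> carrier V"
  shows "\<pi> x = \<pi> y \<longleftrightarrow> x \<ominus> y \<in> N"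
proof
  assume "\<pi> x = \<pi> y"
  then have "\<pi> (x \<oplus> \<ominus> y) = N"
    using assms N_subset by (rule a_coset_add_inv2)
  then show "x \<ominus> y \<in> N"
    using a_coset_join1[OF _ _ a_subgroup, of "x \<ominus> y"] assms by (simp add: a_minus_def)
next
  assume "x \<ominus> y \<in> N"
  then have "\<pi> (x \<ominus> y) = N"
    using assms by (intro a_coset_join2[OF _ a_subgroup]) auto
  then show "\<pi> x = \<pi> y"
    using assms N_subset by (intro a_coset_add_inv1) (auto simp: a_minus_def)
qed

lemma quotient_smult:
  assumes "x \<in> carrier V"
  shows "c \<odot>\<^bsub>quotient_vs V N\<^esub> \<pi> x = \<pi> (c \<odot> x)"
proof -
  have "\<pi> (c \<odot> s) = \<pi> (c \<odot> x)" if s: "s \<in> \<pi> x" for s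
  proof -
    have sc: "s \<in> carrier V" using s coset_subset_carrier[OF assms] by blast
    have "s \<ominus> x \<in> N"
      using mem_coset_eq[OF s assms] coset_eq_iff[OF sc assms] by blast
    then have "c \<odot> (s \<ominus> x) \<in> N" by (rule N_smult)
    moreover have "c \<odot> (s \<ominus> x) = c \<odot> s \<ominus> c \<odot> x"
      using sc assms by (simp add: a_minus_def smult_r_distr smult_r_minus)
    ultimately show ?thesis using sc assms by (simp add: coset_eq_iff)
  qed
  then have "(\<Union>s\<in>\<pi> x. \<pi> (c \<odot> s)) = (\<Union>s\<in>\<pi> x. \<pi> (c \<odot> x))"
    by (rule SUP_cong[OF refl])
  also have "\<dots> = \<pi> (c \<odot> x)"
    using self_mem_coset[OF assms] by blast
  finally show ?thesis by (simp add: quotient_vs_def)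
qed

lemma quotient_module: "module complex_vs (quotient_vs V N)"
proof (rule complex_moduleI)
  fix a b x
  assume "x \<in> carrier (quotient_vs V N)"
  then obtain v where v: "v \<in> carrier V" and x: "x = \<pi> v" by (auto simp: quotient_carrier)
  show "(a + b) \<odot>\<^bsub>quotient_vs V N\<^esub> x = a \<odot>\<^bsub>quotient_vs V N\<^esub> x \<oplus>\<^bsub>quotient_vs V N\<^esub> b \<odot>\<^bsub>quotient_vs V N\<^esub> x"
    using v by (simp add: x quotient_add quotient_smult complex_module_rules[OF module_axioms])
  show "(a * b) \<odot>\<^bsub>quotient_vs V N\<^esub> x = a \<odot>\<^bsub>quotient_vs V N\<^esub> (b \<odot>\<^bsub>quotient_vs V N\<^esub> x)"
    using v by (simp add: x quotient_smult complex_module_rules[OF module_axioms])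
  show "1 \<odot>\<^bsub>quotient_vs V N\<^esub> x = x"
    using v by (simp add: x quotient_smult complex_module_rules[OF module_axioms])
  show "x \<oplus>\<^bsub>quotient_vs V N\<^esub> - 1 \<odot>\<^bsub>quotient_vs V N\<^esub> x = \<zero>\<^bsub>quotient_vs V N\<^esub>"
    using v by (simp add: x quotient_add quotient_smult quotient_zero complex_module_rules[OF module_axioms])
next
  fix x y
  assume "x \<in> carrier (quotient_vs V N)" "y \<in> carrier (quotient_vs V N)"
  then obtain v w where v: "v \<in> carrier V" "x = \<pi> v" "w \<in> carrier V" "y = \<pi> w"
    by (auto simp: quotient_carrier)
  then show "x \<oplus>\<^bsub>quotient_vs V N\<^esub> y \<in> carrier (quotient_vs V N)"
    by (simp add: quotient_add)
  show "x \<oplus>\<^bsub>quotient_vs V N\<^esub> y = y \<oplus>\<^bsub>quotient_vs V N\<^esub> x"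
    using v by (simp add: quotient_add a_comm)
  show "a \<odot>\<^bsub>quotient_vs V N\<^esub> (x \<oplus>\<^bsub>quotient_vs V N\<^esub> y)
      = a \<odot>\<^bsub>quotient_vs V N\<^esub> x \<oplus>\<^bsub>quotient_vs V N\<^esub> a \<odot>\<^bsub>quotient_vs V N\<^esub> y" for a
    using v by (simp add: quotient_add quotient_smult smult_r_distr)
qed (auto simp: quotient_carrier quotient_add quotient_smult quotient_zero a_assoc)

lemma linear_map_coset: "linear_map V (quotient_vs V N) \<pi>"
  by (rule linear_mapI) (auto simp: quotient_add quotient_smult)

lemma mem_quotient_elem:
  assumes "S \<in> carrier (quotient_vs V N)" "x \<in> S"
  shows "x \<in> carrier V" "S = \<pi> x"
  using assms coset_subset_carrier mem_coset_eq by (auto simp: quotient_carrier)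

end

definition quotient_functional :: "('a \<Rightarrow> complex) \<Rightarrow> 'a set \<Rightarrow> complex" where
  "quotient_functional f S = f (SOME x. x \<in> S)"

context complex_subspace
begin

context
  fixes f
  assumes f: "linear_map V complex_vs f" and f0: "\<And>x. x \<in> N \<Longrightarrow> f x = 0"
begin

lemma quotient_functional_coset:
  assumes "x \<in> carrier V"
  shows "quotient_functional f (\<pi> x) = f x"
proof -
  define y where "y = (SOME y. y \<in> \<pi> x)"
  have y: "y \<in> \<pi> x"
    unfolding y_def using self_mem_coset[OF assms] by (rule someI)
  have yc: "y \<in> carrier V" using y coset_subset_carrier[OF assms] by blast
  have "y \<ominus> x \<in> N"
    using mem_coset_eq[OF y assms] coset_eq_iff[OF yc assms] by blast
  then have "f y = f x"
    using f0 linear_functional_diff[OF module_axioms f yc assms] by simp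
  then show ?thesis by (simp add: quotient_functional_def y_def)
qed

lemma linear_map_quotient_functional:
  "linear_map (quotient_vs V N) complex_vs (quotient_functional f)"
  by (rule linear_mapI)
    (auto simp: quotient_carrier quotient_add quotient_smult quotient_functional_coset
      linear_mapD[OF f])

end

end

section \<open>Matrix seminorms on quotients and completions\<close>

text \<open>
  Infima are handled with slack. The denominator \<open>a + 1\<close> instead of \<open>a\<close> spares the case \<open>a = 0\<close>.
\<close>

lemma scaled_slack:
  fixes a e x :: real
  assumes "0 \<le> a" "0 < e"
  shows "a * (x + e / (a + 1)) \<le> a * x + e"
proof -
  have "a * (e / (a + 1)) \<le> (a + 1) * (e / (a + 1))"
    using assms by (intro mult_right_mono) auto
  also have "\<dots> = e" using assms by simp
  finally show ?thesis by (simp add: distrib_left)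
qed

lemma mats_dims: "x \<in> mats V m n \<Longrightarrow> dim_row x = m \<and> dim_col x = n"
  by (auto simp: mats_def)

lemma mats_index: "x \<in> mats V m n \<Longrightarrow> i < m \<Longrightarrow> j < n \<Longrightarrow> x $$ (i, j) \<in> carrier V"
  by (simp add: mats_def)

lemma matsI: "x \<in> carrier_mat m n \<Longrightarrow> (\<And>i j. i < m \<Longrightarrow> j < n \<Longrightarrow> x $$ (i, j) \<in> carrier V) \<Longrightarrow> x \<in> mats V m n"
  by (simp add: mats_def)

lemma mat_eqI_mats:
  "x \<in> mats V m n \<Longrightarrow> y \<in> mats W m n \<Longrightarrow> (\<And>i j. i < m \<Longrightarrow> j < n \<Longrightarrow> x $$ (i, j) = y $$ (i, j)) \<Longrightarrow> x = y"
  by (rule eq_matI) (auto simp: mats_def)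

lemma map_mat_mats:
  "x \<in> mats V m n \<Longrightarrow> (\<And>v. v \<in> carrier V \<Longrightarrow> f v \<in> carrier W) \<Longrightarrow> map_mat f x \<in> mats W m n"
  by (auto simp: mats_def)

lemma mats_mat_add:
  "module complex_vs V \<Longrightarrow> x \<in> mats V m n \<Longrightarrow> y \<in> mats V m n \<Longrightarrow> mat_add V x y \<in> mats V m n"
  by (auto simp: mats_def mat_add_def abelian_monoid.a_closed[OF abelian_group.axioms(1)[OF module.axioms(2)]])

lemma mats_mat_smult: "module complex_vs V \<Longrightarrow> x \<in> mats V m n \<Longrightarrow> mat_smult V c x \<in> mats V m n"
  by (auto simp: mats_def mat_smult_def module.smult_closed)

text \<open>
  The part of the operator space axioms that the constructions below inherit from one another.
  Definiteness is left out, as it fails for Cauchy sequences.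
\<close>

locale matrix_seminormed = module complex_vs V for V :: "'a opspace" (structure) +
  assumes mnorm_nonneg: "x \<in> mats V m n \<Longrightarrow> 0 \<le> mnorm V x"
    and mnorm_add: "x \<in> mats V m n \<Longrightarrow> y \<in> mats V m n \<Longrightarrow>
      mnorm V (mat_add V x y) \<le> mnorm V x + mnorm V y"
    and mnorm_smult_le: "x \<in> mats V m n \<Longrightarrow> mnorm V (mat_smult V c x) \<le> cmod c * mnorm V x"
begin

lemma module_V: "module complex_vs V" ..

lemmas mat_add_mats = mats_mat_add[OF module_V]
lemmas mat_smult_mats = mats_mat_smult[OF module_V]

lemma singleton_mats: "v \<in> carrier V \<Longrightarrow> mat 1 1 (\<lambda>_. v) \<in> mats V 1 1"
  by (simp add: mats_def)

lemma vnorm_nonneg: "v \<in> carrier V \<Longrightarrow> 0 \<le> vnorm V v"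
  unfolding vnorm_def by (rule mnorm_nonneg[OF singleton_mats])

lemma vnorm_add:
  assumes "v \<in> carrier V" "w \<in> carrier V"
  shows "vnorm V (v \<oplus> w) \<le> vnorm V v + vnorm V w"
proof -
  have "mat_add V (mat 1 1 (\<lambda>_. v)) (mat 1 1 (\<lambda>_. w)) = mat 1 1 (\<lambda>_. v \<oplus> w)"
    by (rule eq_matI) (auto simp: mat_add_def)
  then show ?thesis
    using mnorm_add[OF singleton_mats[OF assms(1)] singleton_mats[OF assms(2)]] by (simp add: vnorm_def)
qed

lemma vnorm_smult_le:
  assumes "v \<in> carrier V"
  shows "vnorm V (c \<odot> v) \<le> cmod c * vnorm V v"
proof -
  have "mat_smult V c (mat 1 1 (\<lambda>_. v)) = mat 1 1 (\<lambda>_. c \<odot> v)"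
    by (rule eq_matI) (auto simp: mat_smult_def)
  then show ?thesis
    using mnorm_smult_le[OF singleton_mats[OF assms], of c] by (simp add: vnorm_def)
qed

lemma vnorm_zero: "vnorm V \<zero> = 0"
  using vnorm_smult_le[of "\<zero>" 0] vnorm_nonneg[of "\<zero>"]
  by (simp add: complex_module_rules[OF module_V])

lemma vnorm_minus_le:
  assumes "v \<in> carrier V" "w \<in> carrier V"
  shows "vnorm V (v \<ominus> w) \<le> vnorm V v + vnorm V w"
  using vnorm_add[of v "(-1) \<odot> w"] vnorm_smult_le[of w "-1"] assms
  by (simp add: minus_complex_module[OF module_V])

lemma vnorm_kernel_submodule: "submodule {v \<in> carrier V. vnorm V v = 0} complex_vs V"
proof (rule complex_submoduleI[OF module_V])
  show "x \<oplus> y \<in> {v \<in> carrier V. vnorm V v = 0}"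
    if "x \<in> {v \<in> carrier V. vnorm V v = 0}" "y \<in> {v \<in> carrier V. vnorm V v = 0}" for x y
    using that vnorm_add[of x y] vnorm_nonneg[of "x \<oplus> y"] by auto
  show "c \<odot> x \<in> {v \<in> carrier V. vnorm V v = 0}" if "x \<in> {v \<in> carrier V. vnorm V v = 0}" for c x
    using that vnorm_smult_le[of x c] vnorm_nonneg[of "c \<odot> x"] by auto
qed (auto simp: vnorm_zero)

lemma closed_linear_span_submodule:
  assumes "S \<subseteq> carrier V"
  shows "submodule (closed_linear_span V S) complex_vs V"
proof (rule complex_submoduleI[OF module_V])
  note span = linear_span_submodule[OF module_V assms]
  note span_carrier = subsetD[OF submoduleE(1)[OF span]]
  show "closed_linear_span V S \<subseteq> carrier V"
    by (auto simp: closed_linear_span_def)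
  have "vnorm V (\<zero> \<ominus> \<zero>) = 0"
    using vnorm_zero by (simp add: a_minus_def r_neg)
  moreover have "\<zero> \<in> linear_span V S"
    using subgroup.one_closed[OF submodule.axioms(1)[OF span]] by simp
  ultimately show "\<zero> \<in> closed_linear_span V S"
    by (force simp: closed_linear_span_def)
  show "x \<oplus> y \<in> closed_linear_span V S"
    if x: "x \<in> closed_linear_span V S" and y: "y \<in> closed_linear_span V S" for x y
  proof -
    have xc: "x \<in> carrier V" and yc: "y \<in> carrier V"
      using x y by (auto simp: closed_linear_span_def)
    have "\<exists>w\<in>linear_span V S. vnorm V (x \<oplus> y \<ominus> w) < e" if "0 < e" for e
    proof -
      have "0 < e / 2" using that by simp
      then obtain v w where v: "v \<in> linear_span V S" "vnorm V (x \<ominus> v) < e / 2"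
        and w: "w \<in> linear_span V S" "vnorm V (y \<ominus> w) < e / 2"
        using x y unfolding closed_linear_span_def by blast
      have vc: "v \<in> carrier V" "w \<in> carrier V" using v w span_carrier by auto
      have "x \<oplus> y \<ominus> (v \<oplus> w) = (x \<ominus> v) \<oplus> (y \<ominus> w)"
        using xc yc vc by (simp add: a_minus_def minus_add a_ac)
      then have "vnorm V (x \<oplus> y \<ominus> (v \<oplus> w)) \<le> vnorm V (x \<ominus> v) + vnorm V (y \<ominus> w)"
        using vnorm_add xc yc vc by simp
      moreover have "v \<oplus> w \<in> linear_span V S"
        using v w by (intro submoduleE(5)[OF span])
      ultimately show ?thesis using v w by (intro bexI[of _ "v \<oplus> w"]) auto
    qed
    then show ?thesis using xc yc by (simp add: closed_linear_span_def)
  qed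
  show "c \<odot> x \<in> closed_linear_span V S" if x: "x \<in> closed_linear_span V S" for c x
  proof -
    have xc: "x \<in> carrier V" using x by (auto simp: closed_linear_span_def)
    have "\<exists>w\<in>linear_span V S. vnorm V (c \<odot> x \<ominus> w) < e" if e: "0 < e" for e
    proof -
      have "0 < e / (cmod c + 1)" using e by (simp add: add_nonneg_pos)
      then obtain v where v: "v \<in> linear_span V S" "vnorm V (x \<ominus> v) < e / (cmod c + 1)"
        using x unfolding closed_linear_span_def by blast
      have vc: "v \<in> carrier V" using v span_carrier by auto
      have "c \<odot> x \<ominus> c \<odot> v = c \<odot> (x \<ominus> v)"
        using xc vc by (simp add: a_minus_def smult_r_distr smult_r_minus)
      then have "vnorm V (c \<odot> x \<ominus> c \<odot> v) \<le> cmod c * vnorm V (x \<ominus> v)"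
        using vnorm_smult_le xc vc by simp
      also have "\<dots> \<le> (cmod c + 1) * vnorm V (x \<ominus> v)"
        using vnorm_nonneg xc vc by (intro mult_right_mono) auto
      also have "\<dots> < e"
        using v(2) by (simp add: pos_less_divide_eq add_nonneg_pos mult.commute)
      finally show ?thesis using submoduleE(4)[OF span _ v(1), of c] by auto
    qed
    then show ?thesis using xc by (simp add: closed_linear_span_def)
  qed
qed

lemma closed_linear_span_superset:
  assumes "S \<subseteq> carrier V"
  shows "S \<subseteq> closed_linear_span V S"
proof
  fix x assume x: "x \<in> S"
  then have xc: "x \<in> carrier V" using assms by auto
  then have "vnorm V (x \<ominus> x) = 0"
    using vnorm_zero by (simp add: a_minus_def r_neg)
  then show "x \<in> closed_linear_span V S"
    using x xc linear_span_superset[of S V] by (force simp: closed_linear_span_def)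
qed

lemma bounded_functional_zero_on_closed_span:
  assumes "linear_map V complex_vs f" and bound: "\<And>v. v \<in> carrier V \<Longrightarrow> cmod (f v) \<le> B * vnorm V v"
    and "S \<subseteq> carrier V" "\<And>s. s \<in> S \<Longrightarrow> f s = 0" and x: "x \<in> closed_linear_span V S"
  shows "f x = 0"
proof -
  have xc: "x \<in> carrier V" using x by (simp add: closed_linear_span_def)
  have "cmod (f x) \<le> 0 + e" if "0 < e" for e
  proof -
    have "0 < e / (\<bar>B\<bar> + 1)" using that by (simp add: add_nonneg_pos)
    then obtain w where w: "w \<in> linear_span V S" "vnorm V (x \<ominus> w) < e / (\<bar>B\<bar> + 1)"
      using x unfolding closed_linear_span_def by blast
    have wc: "w \<in> carrier V"
      using w submoduleE(1)[OF linear_span_submodule[OF module_V assms(3)]] by auto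
    have "f w = 0"
      by (rule linear_functional_zero_on_span[OF module_V assms(1,3,4) w(1)])
    then have "cmod (f x) = cmod (f (x \<ominus> w))"
      by (simp add: linear_functional_diff[OF module_V assms(1) xc wc])
    also have "\<dots> \<le> B * vnorm V (x \<ominus> w)" using bound xc wc by simp
    also have "\<dots> \<le> (\<bar>B\<bar> + 1) * vnorm V (x \<ominus> w)"
      using vnorm_nonneg xc wc by (intro mult_right_mono) auto
    also have "\<dots> < e" using w(2) by (simp add: pos_less_divide_eq add_nonneg_pos mult.commute)
    finally show ?thesis by simp
  qed
  then have "cmod (f x) \<le> 0" by (rule field_le_epsilon)
  then show ?thesis by simp
qed

end

lemma amplify_index:
  assumes "r < dim_row x * dim_row \<Phi>" "s < dim_col x * dim_col \<Phi>"
  shows "amplify \<Phi> x $$ (r, s) = (\<Phi> $$ (r mod dim_row \<Phi>, s mod dim_col \<Phi>)) (x $$ (r div dim_row \<Phi>, s div dim_col \<Phi>))"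
  using assms by (simp add: amplify_def Let_def)

lemma amplify_dims [simp]:
  "dim_row (amplify \<Phi> x) = dim_row x * dim_row \<Phi>" "dim_col (amplify \<Phi> x) = dim_col x * dim_col \<Phi>"
  by (simp_all add: amplify_def Let_def)

lemma op_norm_amplify_1x1: "op_norm (amplify (mat 1 1 (\<lambda>_. f)) (mat 1 1 (\<lambda>_. v))) = cmod (f v)"
proof -
  have "amplify (mat 1 1 (\<lambda>_. f)) (mat 1 1 (\<lambda>_. v)) = mat 1 1 (\<lambda>_. f v)"
    by (rule eq_matI) (auto simp: amplify_index)
  then show ?thesis by (simp only: op_norm_1x1)
qed

lemma block_index:
  fixes r :: nat assumes "r < p * m" shows "r div m < p" "r mod m < m"
proof -
  have "0 < m" using assms by (cases m) auto
  then show "r mod m < m" by simp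
  show "r div m < p" using assms by (rule less_mult_imp_div_less)
qed

subsection \<open>Quotients\<close>

locale seminormed_subspace = matrix_seminormed V + complex_subspace V N
  for V :: "'a opspace" (structure) and N :: "'a set"
begin

abbreviation Q :: "'a set opspace" where "Q \<equiv> quotient_op V N"

lemma carrier_Q: "carrier Q = \<pi> ` carrier V"
  by (simp add: quotient_op_def quotient_carrier)

lemma module_Q: "module complex_vs Q"
  by (simp add: quotient_op_def quotient_module)

lemma linear_map_coset_Q: "linear_map V Q \<pi>"
  by (simp add: quotient_op_def linear_map_coset)

lemma mats_Q_lift:
  assumes "x \<in> mats Q m n"
  shows "\<exists>y\<in>mats V m n. x = map_mat \<pi> y"
proof -
  have "\<exists>v. v \<in> carrier V \<and> x $$ (i, j) = \<pi> v" if "i < m" "j < n" for i j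
    using mats_index[OF assms that] by (auto simp: carrier_Q)
  then obtain g where g: "\<And>i j. i < m \<Longrightarrow> j < n \<Longrightarrow> g i j \<in> carrier V \<and> x $$ (i, j) = N +> g i j"
    by metis
  then show ?thesis
    using mats_dims[OF assms]
    by (intro bexI[of _ "mat m n (\<lambda>(i, j). g i j)"] eq_matI matsI) auto
qed

text \<open>
  Representatives of the entries of \<open>x\<close> are the same as a matrix over \<open>V\<close> whose image is \<open>x\<close>.
\<close>

lemma mnorm_Q:
  assumes "x \<in> mats Q m n"
  shows "mnorm Q x = Inf {mnorm V y | y. y \<in> mats V m n \<and> x = map_mat \<pi> y}"
proof -
  have "(\<forall>i<m. \<forall>j<n. y $$ (i, j) \<in> x $$ (i, j)) \<longleftrightarrow> x = map_mat \<pi> y"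
    if y: "y \<in> mats V m n" for y
  proof
    assume "\<forall>i<m. \<forall>j<n. y $$ (i, j) \<in> x $$ (i, j)"
    moreover have "x $$ (i, j) \<in> carrier (quotient_vs V N)" if "i < m" "j < n" for i j
      using mats_index[OF assms that] by (simp add: quotient_op_def)
    ultimately show "x = map_mat \<pi> y"
      using mats_dims[OF assms] mats_dims[OF y] mem_quotient_elem(2) by (intro eq_matI) auto
  next
    assume "x = map_mat \<pi> y"
    then show "\<forall>i<m. \<forall>j<n. y $$ (i, j) \<in> x $$ (i, j)"
      using mats_dims[OF y] mats_index[OF y] self_mem_coset by auto
  qed
  then have "{mnorm V y | y. y \<in> mats V m n \<and> (\<forall>i<m. \<forall>j<n. y $$ (i, j) \<in> x $$ (i, j))}
      = {mnorm V y | y. y \<in> mats V m n \<and> x = map_mat \<pi> y}"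
    by blast
  then show ?thesis
    using mats_dims[OF assms] by (simp add: quotient_op_def)
qed

lemma map_coset_mats: "y \<in> mats V m n \<Longrightarrow> map_mat \<pi> y \<in> mats Q m n"
  by (rule map_mat_mats) (auto simp: carrier_Q)

lemma mnorm_Q_le:
  assumes "y \<in> mats V m n"
  shows "mnorm Q (map_mat \<pi> y) \<le> mnorm V y"
  unfolding mnorm_Q[OF map_coset_mats[OF assms]]
  by (rule cInf_lower) (use assms in \<open>auto intro!: bdd_belowI[of _ 0] mnorm_nonneg\<close>)

lemma mnorm_Q_less:
  assumes "x \<in> mats Q m n" "mnorm Q x < c"
  shows "\<exists>y\<in>mats V m n. x = map_mat \<pi> y \<and> mnorm V y < c"
proof -
  have "{mnorm V y | y. y \<in> mats V m n \<and> x = map_mat \<pi> y} \<noteq> {}"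
    using mats_Q_lift[OF assms(1)] by auto
  from cInf_lessD[OF this, of c] show ?thesis
    using assms(2) unfolding mnorm_Q[OF assms(1)] by blast
qed

lemma mnorm_Q_nonneg: "x \<in> mats Q m n \<Longrightarrow> 0 \<le> mnorm Q x"
  unfolding mnorm_Q
  by (rule cInf_greatest) (use mats_Q_lift[of x m n] in \<open>auto intro: mnorm_nonneg\<close>)

lemma matrix_seminormed_Q: "matrix_seminormed Q"
proof (intro matrix_seminormed.intro module_Q matrix_seminormed_axioms.intro)
  fix x m n assume "x \<in> mats Q m n"
  then show "0 \<le> mnorm Q x" by (rule mnorm_Q_nonneg)
next
  fix x m n y assume x: "x \<in> mats Q m n" and y: "y \<in> mats Q m n"
  show "mnorm Q (mat_add Q x y) \<le> mnorm Q x + mnorm Q y"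
  proof (rule field_le_epsilon)
    fix e :: real assume "0 < e"
    then obtain v w where v: "v \<in> mats V m n" "x = map_mat \<pi> v" "mnorm V v < mnorm Q x + e / 2"
      and w: "w \<in> mats V m n" "y = map_mat \<pi> w" "mnorm V w < mnorm Q y + e / 2"
      using mnorm_Q_less[OF x, of "mnorm Q x + e / 2"] mnorm_Q_less[OF y, of "mnorm Q y + e / 2"] by auto
    have "mat_add Q x y = map_mat \<pi> (mat_add V v w)"
      using mats_dims[OF v(1)] mats_dims[OF w(1)] mats_index[OF v(1)] mats_index[OF w(1)]
      by (intro eq_matI) (auto simp: mat_add_def v(2) w(2) linear_mapD(2)[OF linear_map_coset_Q])
    then have "mnorm Q (mat_add Q x y) \<le> mnorm V (mat_add V v w)"
      using mnorm_Q_le[OF mat_add_mats[OF v(1) w(1)]] by simp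
    also have "\<dots> \<le> mnorm V v + mnorm V w" using v(1) w(1) by (rule mnorm_add)
    finally show "mnorm Q (mat_add Q x y) \<le> mnorm Q x + mnorm Q y + e"
      using v(3) w(3) by simp
  qed
next
  fix x m n c assume x: "x \<in> mats Q m n"
  show "mnorm Q (mat_smult Q c x) \<le> cmod c * mnorm Q x"
  proof (rule field_le_epsilon)
    fix e :: real assume e: "0 < e"
    have "0 < e / (cmod c + 1)" using e by (simp add: add_nonneg_pos)
    then obtain v where v: "v \<in> mats V m n" "x = map_mat \<pi> v"
        "mnorm V v < mnorm Q x + e / (cmod c + 1)"
      using mnorm_Q_less[OF x, of "mnorm Q x + e / (cmod c + 1)"] by auto
    have "mat_smult Q c x = map_mat \<pi> (mat_smult V c v)"
      using mats_dims[OF v(1)] mats_index[OF v(1)]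
      by (intro eq_matI) (auto simp: mat_smult_def v(2) linear_mapD(3)[OF linear_map_coset_Q])
    then have "mnorm Q (mat_smult Q c x) \<le> mnorm V (mat_smult V c v)"
      using mnorm_Q_le[OF mat_smult_mats[OF v(1)]] by simp
    also have "\<dots> \<le> cmod c * mnorm V v" using v(1) by (rule mnorm_smult_le)
    also have "\<dots> \<le> cmod c * (mnorm Q x + e / (cmod c + 1))"
      using v(3) by (intro mult_left_mono) auto
    also have "\<dots> \<le> cmod c * mnorm Q x + e"
      using e by (intro scaled_slack) auto
    finally show "mnorm Q (mat_smult Q c x) \<le> cmod c * mnorm Q x + e" .
  qed
qed

lemma vnorm_coset_le:
  assumes "v \<in> carrier V"
  shows "vnorm Q (\<pi> v) \<le> vnorm V v"
proof -
  have "map_mat \<pi> (mat 1 1 (\<lambda>_. v)) = mat 1 1 (\<lambda>_. \<pi> v)"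
    by (rule eq_matI) auto
  then show ?thesis
    using mnorm_Q_le[OF singleton_mats[OF assms]] by (simp add: vnorm_def)
qed

text \<open>
  The amplification at \<open>x\<close> is computed at any lift of \<open>x\<close>, and some lift has almost the norm of \<open>x\<close>.
\<close>

lemma amplify_bound_Q:
  assumes "0 \<le> C" and x: "x \<in> mats Q p q"
    and bound: "\<And>y. y \<in> mats V p q \<Longrightarrow>
      op_norm (amplify (map_mat (\<lambda>f v. f (\<pi> v)) \<Phi>) y) \<le> C * mnorm V y"
  shows "op_norm (amplify \<Phi> x) \<le> C * mnorm Q x"
proof (rule field_le_epsilon)
  fix e :: real assume e: "0 < e"
  have "0 < e / (C + 1)" using e assms(1) by simp
  then obtain y where y: "y \<in> mats V p q" "x = map_mat \<pi> y" "mnorm V y < mnorm Q x + e / (C + 1)"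
    using mnorm_Q_less[OF x, of "mnorm Q x + e / (C + 1)"] by auto
  have "amplify \<Phi> x = amplify (map_mat (\<lambda>f v. f (\<pi> v)) \<Phi>) y"
    by (rule eq_matI) (auto simp: amplify_index y(2) block_index)
  then have "op_norm (amplify \<Phi> x) \<le> C * mnorm V y"
    using bound[OF y(1)] by simp
  also have "\<dots> \<le> C * (mnorm Q x + e / (C + 1))"
    using y(3) assms(1) by (intro mult_left_mono) auto
  also have "\<dots> \<le> C * mnorm Q x + e"
    using assms(1) e by (rule scaled_slack)
  finally show "op_norm (amplify \<Phi> x) \<le> C * mnorm Q x + e" .
qed

text \<open>
  The case of \<open>1 \<times> 1\<close> matrices of the preceding bound.
\<close>

lemma quotient_functional_bound:
  assumes "0 \<le> B" and f: "linear_map V complex_vs f" "\<And>x. x \<in> N \<Longrightarrow> f x = 0"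
    and bound: "\<And>v. v \<in> carrier V \<Longrightarrow> cmod (f v) \<le> B * vnorm V v"
    and S: "S \<in> carrier Q"
  shows "cmod (quotient_functional f S) \<le> B * vnorm Q S"
proof -
  have "op_norm (amplify (mat 1 1 (\<lambda>_. quotient_functional f)) (mat 1 1 (\<lambda>_. S)))
      \<le> B * mnorm Q (mat 1 1 (\<lambda>_. S))"
  proof (rule amplify_bound_Q[OF assms(1)])
    show "mat 1 1 (\<lambda>_. S) \<in> mats Q 1 1" using S by (simp add: mats_def)
    fix y assume y: "y \<in> mats V 1 1"
    define v where "v = y $$ (0, 0)"
    have y1: "y = mat 1 1 (\<lambda>_. v)" using mats_dims[OF y] by (intro eq_matI) (auto simp: v_def)
    have v: "v \<in> carrier V" using mats_index[OF y] by (simp add: v_def)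
    have "map_mat (\<lambda>f v. f (\<pi> v)) (mat 1 1 (\<lambda>_. quotient_functional f)) = mat 1 1 (\<lambda>_. \<lambda>v. quotient_functional f (\<pi> v))"
      by (rule eq_matI) auto
    then show "op_norm (amplify (map_mat (\<lambda>f v. f (\<pi> v)) (mat 1 1 (\<lambda>_. quotient_functional f))) y)
        \<le> B * mnorm V y"
      using bound[OF v] quotient_functional_coset[OF f v] by (simp only: y1 op_norm_amplify_1x1 vnorm_def)
  qed
  then show ?thesis by (simp only: op_norm_amplify_1x1 vnorm_def)
qed

end

subsection \<open>Cauchy sequences and the completion\<close>

text \<open>
  The bound of a matrix by its entries makes the matrix norms along an entrywise Cauchy sequence
  converge, so that the limit defining the norm on Cauchy sequences exists.
\<close>

locale entrywise_seminormed = matrix_seminormed V for V :: "'a opspace" (structure) +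
  assumes mnorm_le_entries:
    "x \<in> mats V m n \<Longrightarrow> mnorm V x \<le> (\<Sum>i<m. \<Sum>j<n. vnorm V (x $$ (i, j)))"
begin

abbreviation C :: "(nat \<Rightarrow> 'a) opspace" where "C \<equiv> cauchy_seqs V"
abbreviation null :: "(nat \<Rightarrow> 'a) set" where "null \<equiv> null_seqs V"

abbreviation term_mat :: "nat \<Rightarrow> (nat \<Rightarrow> 'a) mat \<Rightarrow> 'a mat" where
  "term_mat k x \<equiv> map_mat (\<lambda>s. s k) x"

lemma C_simps [simp]:
  "zero C = (\<lambda>_. \<zero>)" "add C = (\<lambda>s t k. s k \<oplus> t k)" "smult C = (\<lambda>c s k. c \<odot> s k)"
  by (simp_all add: cauchy_seqs_def)

lemma carrier_C_iff: "s \<in> carrier C \<longleftrightarrow> (\<forall>k. s k \<in> carrier V) \<and>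
    (\<forall>e>0. \<exists>M. \<forall>k\<ge>M. \<forall>l\<ge>M. vnorm V (s k \<ominus> s l) < e)"
  by (simp add: cauchy_seqs_def)

lemma C_term [simp]: "s \<in> carrier C \<Longrightarrow> s k \<in> carrier V"
  by (simp add: carrier_C_iff)

lemma C_cauchy: "s \<in> carrier C \<Longrightarrow> 0 < e \<Longrightarrow> \<exists>M. \<forall>k\<ge>M. \<forall>l\<ge>M. vnorm V (s k \<ominus> s l) < e"
  by (simp add: carrier_C_iff)

text \<open>
  Sums and scalar multiples of Cauchy sequences are Cauchy by one argument: \<open>B = 1\<close> serves the former, and
  \<open>t = 0\<close> the latter.
\<close>

lemma carrier_C_of_dominated:
  assumes "\<And>k. u k \<in> carrier V" "s \<in> carrier C" "t \<in> carrier C" "0 \<le> B"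
    and "\<And>k l. vnorm V (u k \<ominus> u l) \<le> B * vnorm V (s k \<ominus> s l) + vnorm V (t k \<ominus> t l)"
  shows "u \<in> carrier C"
  unfolding carrier_C_iff
proof (intro conjI allI impI)
  show "u k \<in> carrier V" for k by fact
  fix e :: real assume e: "0 < e"
  have "0 < (e / 2) / (B + 1)" using e assms(4) by simp
  from C_cauchy[OF assms(2) this] obtain M
    where M: "\<And>k l. M \<le> k \<Longrightarrow> M \<le> l \<Longrightarrow> vnorm V (s k \<ominus> s l) < (e / 2) / (B + 1)" by blast
  have "0 < e / 2" using e by simp
  from C_cauchy[OF assms(3) this] obtain M'
    where M': "\<And>k l. M' \<le> k \<Longrightarrow> M' \<le> l \<Longrightarrow> vnorm V (t k \<ominus> t l) < e / 2" by blast
  have "vnorm V (u k \<ominus> u l) < e" if "max M M' \<le> k" "max M M' \<le> l" for k l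
  proof -
    have "B * vnorm V (s k \<ominus> s l) \<le> B * (0 + (e / 2) / (B + 1))"
      using M[of k l] that assms(4) by (intro mult_left_mono) auto
    also have "\<dots> \<le> B * 0 + e / 2" using assms(4) e by (intro scaled_slack) auto
    finally show ?thesis using assms(5)[of k l] M'[of k l] that by simp
  qed
  then show "\<exists>M. \<forall>k\<ge>M. \<forall>l\<ge>M. vnorm V (u k \<ominus> u l) < e" by blast
qed

lemma const_C [simp]: "v \<in> carrier V \<Longrightarrow> (\<lambda>_. v) \<in> carrier C"
  using vnorm_zero by (auto simp: carrier_C_iff a_minus_def r_neg)

lemma add_C: "s \<in> carrier C \<Longrightarrow> t \<in> carrier C \<Longrightarrow> (\<lambda>k. s k \<oplus> t k) \<in> carrier C"
proof (rule carrier_C_of_dominated[of _ s t 1])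
  assume st: "s \<in> carrier C" "t \<in> carrier C"
  fix k l
  have "s k \<oplus> t k \<ominus> (s l \<oplus> t l) = (s k \<ominus> s l) \<oplus> (t k \<ominus> t l)"
    using st by (simp add: a_minus_def minus_add a_ac)
  then show "vnorm V (s k \<oplus> t k \<ominus> (s l \<oplus> t l))
      \<le> 1 * vnorm V (s k \<ominus> s l) + vnorm V (t k \<ominus> t l)"
    using vnorm_add st by simp
qed auto

lemma smult_C: "s \<in> carrier C \<Longrightarrow> (\<lambda>k. c \<odot> s k) \<in> carrier C"
proof (rule carrier_C_of_dominated[of _ s "\<lambda>_. \<zero>" "cmod c"])
  assume s: "s \<in> carrier C"
  fix k l
  have "c \<odot> s k \<ominus> c \<odot> s l = c \<odot> (s k \<ominus> s l)"
    using s by (simp add: a_minus_def smult_r_distr smult_r_minus)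
  moreover have "vnorm V (\<zero> \<ominus> \<zero>) = 0"
    using vnorm_zero by (simp add: a_minus_def r_neg)
  ultimately show "vnorm V (c \<odot> s k \<ominus> c \<odot> s l)
      \<le> cmod c * vnorm V (s k \<ominus> s l) + vnorm V (\<zero> \<ominus> \<zero>)"
    using vnorm_smult_le[of "s k \<ominus> s l" c] s by simp
qed auto

lemma module_C: "module complex_vs C"
  by (rule complex_moduleI)
    (simp_all add: add_C smult_C fun_eq_iff a_assoc smult_r_distr complex_module_rules[OF module_V],
     simp add: a_comm)

lemma minus_C: "s \<in> carrier C \<Longrightarrow> t \<in> carrier C \<Longrightarrow> (s \<ominus>\<^bsub>C\<^esub> t) k = s k \<ominus> t k"
  by (simp add: minus_complex_module[OF module_C] minus_complex_module[OF module_V])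

lemma term_mats: "x \<in> mats C m n \<Longrightarrow> term_mat k x \<in> mats V m n"
  by (rule map_mat_mats) auto

lemma mnorm_le_add_entries:
  assumes "x \<in> mats V m n" "y \<in> mats V m n"
  shows "mnorm V x \<le> mnorm V y + (\<Sum>i<m. \<Sum>j<n. vnorm V (x $$ (i, j) \<ominus> y $$ (i, j)))"
proof -
  define d where "d = mat m n (\<lambda>ij. x $$ ij \<ominus> y $$ ij)"
  have d: "d \<in> mats V m n"
    using mats_index[OF assms(1)] mats_index[OF assms(2)] by (auto simp: d_def mats_def)
  have cancel: "b \<oplus> (a \<ominus> b) = a" if "a \<in> carrier V" "b \<in> carrier V" for a b
    using that by (simp add: a_minus_def a_lcomm r_neg)
  have "x = mat_add V y d"
    using mats_dims[OF assms(1)] mats_dims[OF assms(2)] mats_index[OF assms(1)] mats_index[OF assms(2)]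
    by (intro eq_matI) (auto simp: mat_add_def d_def cancel)
  then have "mnorm V x \<le> mnorm V y + mnorm V d"
    using mnorm_add[OF assms(2) d] by simp
  also have "mnorm V d \<le> (\<Sum>i<m. \<Sum>j<n. vnorm V (d $$ (i, j)))"
    by (rule mnorm_le_entries[OF d])
  also have "\<dots> = (\<Sum>i<m. \<Sum>j<n. vnorm V (x $$ (i, j) \<ominus> y $$ (i, j)))"
    by (intro sum.cong) (auto simp: d_def)
  finally show ?thesis by simp
qed

text \<open>
  Beyond a common index \<open>L\<close> all entries of \<open>x\<close> vary by less than \<open>d\<close>, and therefore the matrix norms by at
  most \<open>mnd < e\<close>.
\<close>

lemma mnorm_C_tendsto:
  assumes "x \<in> mats C m n"
  shows "(\<lambda>k. mnorm V (term_mat k x)) \<longlonglongrightarrow> mnorm C x"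
proof -
  have "Cauchy (\<lambda>k. mnorm V (term_mat k x))"
  proof (rule CauchyI)
    fix e :: real assume e: "0 < e"
    define d where "d = e / (real (m * n) + 1)"
    have d: "0 < d" unfolding d_def by (rule divide_pos_pos[OF e]) (simp add: add_nonneg_pos)
    have "\<forall>i j. \<exists>M. i < m \<longrightarrow> j < n \<longrightarrow>
        (\<forall>k\<ge>M. \<forall>l\<ge>M. vnorm V ((x $$ (i, j)) k \<ominus> (x $$ (i, j)) l) < d)"
      using C_cauchy[OF mats_index[OF assms] d] by blast
    then obtain M where M: "\<And>i j k l. i < m \<Longrightarrow> j < n \<Longrightarrow> M i j \<le> k \<Longrightarrow> M i j \<le> l \<Longrightarrow>
        vnorm V ((x $$ (i, j)) k \<ominus> (x $$ (i, j)) l) < d"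
      unfolding choice_iff by blast
    define L where "L = Max (insert 0 ((\<lambda>(i, j). M i j) ` ({..<m} \<times> {..<n})))"
    have L: "M i j \<le> L" if "i < m" "j < n" for i j
    proof -
      have "M i j \<in> (\<lambda>(i, j). M i j) ` ({..<m} \<times> {..<n})"
        using that by (intro image_eqI[of _ _ "(i, j)"]) simp_all
      then show ?thesis unfolding L_def by (intro Max_ge insertI2) simp_all
    qed
    have one_sided: "mnorm V (term_mat k x) \<le> mnorm V (term_mat l x) + real (m * n) * d"
      if kl: "L \<le> k" "L \<le> l" for k l
    proof -
      have "(\<Sum>i<m. \<Sum>j<n. vnorm V (term_mat k x $$ (i, j) \<ominus> term_mat l x $$ (i, j)))
          \<le> (\<Sum>i<m. \<Sum>j<n. d)"
      proof (intro sum_mono)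
        fix i j assume ij: "i \<in> {..<m}" "j \<in> {..<n}"
        then have "M i j \<le> k" "M i j \<le> l" using L[of i j] kl by auto
        then show "vnorm V (term_mat k x $$ (i, j) \<ominus> term_mat l x $$ (i, j)) \<le> d"
          using M[of i j k l] ij mats_dims[OF assms] by simp
      qed
      then show ?thesis
        using mnorm_le_add_entries[OF term_mats[OF assms, of k] term_mats[OF assms, of l]] by simp
    qed
    have ne: "real (m * n) + 1 \<noteq> 0"
      using of_nat_0_le_iff[of "m * n", where ?'a = real] by linarith
    have "real (m * n) * d < (real (m * n) + 1) * d"
      using d by (simp only: distrib_right mult_1_left less_add_same_cancel1)
    also have "\<dots> = e"
      using ne unfolding d_def times_divide_eq_right by (rule nonzero_mult_div_cancel_left)
    finally have small: "real (m * n) * d < e" .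
    have "norm (mnorm V (term_mat k x) - mnorm V (term_mat l x)) < e"
      if "L \<le> k" "L \<le> l" for k l
      using one_sided[OF that] one_sided[OF that(2,1)] small unfolding real_norm_def by linarith
    then show "\<exists>M. \<forall>k\<ge>M. \<forall>l\<ge>M. norm (mnorm V (term_mat k x) - mnorm V (term_mat l x)) < e"
      by blast
  qed
  then have "convergent (\<lambda>k. mnorm V (term_mat k x))"
    by (rule Cauchy_convergent)
  moreover have "mnorm C x = lim (\<lambda>k. mnorm V (term_mat k x))"
    unfolding cauchy_seqs_def by (simp only: opspace.select_convs)
  ultimately show ?thesis
    by (simp only: convergent_LIMSEQ_iff[symmetric])
qed

lemma matrix_seminormed_C: "matrix_seminormed C"
proof (intro matrix_seminormed.intro module_C matrix_seminormed_axioms.intro)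
  fix x m n assume x: "x \<in> mats C m n"
  show "0 \<le> mnorm C x"
    by (rule LIMSEQ_le_const[OF mnorm_C_tendsto[OF x]]) (use mnorm_nonneg[OF term_mats[OF x]] in auto)
  show "mnorm C (mat_smult C c x) \<le> cmod c * mnorm C x" for c
  proof (rule LIMSEQ_le[OF mnorm_C_tendsto tendsto_mult_left[OF mnorm_C_tendsto[OF x]]])
    show "mat_smult C c x \<in> mats C m n" using x by (auto simp: mats_def mat_smult_def smult_C)
    have "term_mat k (mat_smult C c x) = mat_smult V c (term_mat k x)" for k
      by (rule eq_matI) (auto simp: mat_smult_def)
    then show "\<exists>M. \<forall>k\<ge>M. mnorm V (term_mat k (mat_smult C c x)) \<le> cmod c * mnorm V (term_mat k x)"
      using mnorm_smult_le[OF term_mats[OF x]] by simp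
  qed
  fix y assume y: "y \<in> mats C m n"
  show "mnorm C (mat_add C x y) \<le> mnorm C x + mnorm C y"
  proof (rule LIMSEQ_le[OF mnorm_C_tendsto tendsto_add[OF mnorm_C_tendsto[OF x] mnorm_C_tendsto[OF y]]])
    show "mat_add C x y \<in> mats C m n" using x y by (auto simp: mats_def mat_add_def add_C)
    have "term_mat k (mat_add C x y) = mat_add V (term_mat k x) (term_mat k y)" for k
      using mats_dims[OF x] mats_dims[OF y] by (intro eq_matI) (auto simp: mat_add_def)
    then show "\<exists>M. \<forall>k\<ge>M. mnorm V (term_mat k (mat_add C x y))
        \<le> mnorm V (term_mat k x) + mnorm V (term_mat k y)"
      using mnorm_add[OF term_mats[OF x] term_mats[OF y]] by simp
  qed
qed

lemma vnorm_C_tendsto: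
  assumes "s \<in> carrier C"
  shows "(\<lambda>k. vnorm V (s k)) \<longlonglongrightarrow> vnorm C s"
proof -
  have "term_mat k (mat 1 1 (\<lambda>_. s)) = mat 1 1 (\<lambda>_. s k)" for k
    by (rule eq_matI) auto
  moreover have "mat 1 1 (\<lambda>_. s) \<in> mats C 1 1" using assms by (simp add: mats_def)
  ultimately show ?thesis
    using mnorm_C_tendsto[of "mat 1 1 (\<lambda>_. s)" 1 1] by (simp only: vnorm_def)
qed

lemma vnorm_const_C: "v \<in> carrier V \<Longrightarrow> vnorm C (\<lambda>_. v) = vnorm V v"
  using LIMSEQ_unique[OF vnorm_C_tendsto[OF const_C] tendsto_const] by blast

text \<open>
  The density of \<open>V\<close> in its completion.
\<close>

lemma const_approx_C:
  assumes "s \<in> carrier C"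
  shows "(\<lambda>k. vnorm C (s \<ominus>\<^bsub>C\<^esub> (\<lambda>_. s k))) \<longlonglongrightarrow> 0"
proof (rule LIMSEQ_I)
  interpret C: matrix_seminormed C by (rule matrix_seminormed_C)
  fix e :: real assume e: "0 < e"
  then have "0 < e / 2" by simp
  from C_cauchy[OF assms this] obtain M
    where M: "\<And>k l. M \<le> k \<Longrightarrow> M \<le> l \<Longrightarrow> vnorm V (s k \<ominus> s l) < e / 2" by blast
  have "norm (vnorm C (s \<ominus>\<^bsub>C\<^esub> (\<lambda>_. s k)) - 0) < e" if k: "M \<le> k" for k
  proof -
    have d: "s \<ominus>\<^bsub>C\<^esub> (\<lambda>_. s k) \<in> carrier C" using assms by simp
    have "vnorm C (s \<ominus>\<^bsub>C\<^esub> (\<lambda>_. s k)) \<le> e / 2"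
    proof (rule LIMSEQ_le_const2[OF vnorm_C_tendsto[OF d]])
      have "vnorm V ((s \<ominus>\<^bsub>C\<^esub> (\<lambda>_. s k)) l) \<le> e / 2" if "M \<le> l" for l
        using M[OF that k] assms by (simp add: minus_C)
      then show "\<exists>N. \<forall>l\<ge>N. vnorm V ((s \<ominus>\<^bsub>C\<^esub> (\<lambda>_. s k)) l) \<le> e / 2" by blast
    qed
    then show ?thesis using C.vnorm_nonneg[OF d] e by simp
  qed
  then show "\<exists>M. \<forall>k\<ge>M. norm (vnorm C (s \<ominus>\<^bsub>C\<^esub> (\<lambda>_. s k)) - 0) < e" by blast
qed

lemma null_seqs_subset: "null \<subseteq> carrier C"
proof
  fix s assume s: "s \<in> null"
  then have sc: "s k \<in> carrier V" for k by (simp add: null_seqs_def)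
  have lim: "(\<lambda>k. vnorm V (s k)) \<longlonglongrightarrow> 0" using s by (simp add: null_seqs_def)
  show "s \<in> carrier C"
    unfolding carrier_C_iff
  proof (intro conjI allI impI)
    fix e :: real assume e: "0 < e"
    then obtain M where M: "\<And>k. M \<le> k \<Longrightarrow> norm (vnorm V (s k) - 0) < e / 2"
      using LIMSEQ_D[OF lim, of "e / 2"] by auto
    have "vnorm V (s k \<ominus> s l) < e" if "M \<le> k" "M \<le> l" for k l
      using vnorm_minus_le[OF sc[of k] sc[of l]] M[OF that(1)] M[OF that(2)] by simp
    then show "\<exists>M. \<forall>k\<ge>M. \<forall>l\<ge>M. vnorm V (s k \<ominus> s l) < e" by blast
  qed (rule sc)
qed

text \<open>
  Being the kernel of the limit seminorm, the null sequences form a subspace.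
\<close>

lemma null_seqs_eq: "null = {s \<in> carrier C. vnorm C s = 0}"
proof (intro equalityI subsetI CollectI conjI)
  fix s assume s: "s \<in> null"
  then show sc: "s \<in> carrier C" using null_seqs_subset by auto
  show "vnorm C s = 0"
    using LIMSEQ_unique[OF vnorm_C_tendsto[OF sc]] s by (simp add: null_seqs_def)
next
  fix s assume "s \<in> {s \<in> carrier C. vnorm C s = 0}"
  then show "s \<in> null" using vnorm_C_tendsto[of s] by (simp add: null_seqs_def)
qed

lemma seminormed_subspace_null: "seminormed_subspace C null"
  unfolding null_seqs_eq
  by (intro seminormed_subspace.intro matrix_seminormed_C complex_subspace.intro module_C
      complex_subspace_axioms.intro matrix_seminormed.vnorm_kernel_submodule)

lemma matrix_seminormed_completion: "matrix_seminormed (completion V)"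
  unfolding completion_def by (rule seminormed_subspace.matrix_seminormed_Q[OF seminormed_subspace_null])

lemma linear_map_completion_embed: "linear_map V (completion V) (completion_embed V)"
proof -
  have "linear_map V C (\<lambda>v _. v)" by (rule linear_mapI) auto
  from linear_map_comp[OF this seminormed_subspace.linear_map_coset_Q[OF seminormed_subspace_null]]
  show ?thesis
    by (simp add: completion_def completion_embed_def[abs_def])
qed

lemma vnorm_completion_embed_le: "v \<in> carrier V \<Longrightarrow> vnorm (completion V) (completion_embed V v) \<le> vnorm V v"
  using seminormed_subspace.vnorm_coset_le[OF seminormed_subspace_null const_C]
  by (simp add: completion_def completion_embed_def vnorm_const_C)

text \<open>
  A bound for a matrix of functionals passes from the terms of a Cauchy sequence to its limit, since
  it is a bound for bilinear forms in the entries.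
\<close>

lemma amplify_bound_C:
  assumes "0 \<le> B" and dims: "dim_row \<Psi> = dim_row \<Phi>" "dim_col \<Psi> = dim_col \<Phi>"
    and lim: "\<And>i j s. i < dim_row \<Phi> \<Longrightarrow> j < dim_col \<Phi> \<Longrightarrow> s \<in> carrier C \<Longrightarrow>
      (\<lambda>k. (\<Psi> $$ (i, j)) (s k)) \<longlonglongrightarrow> (\<Phi> $$ (i, j)) s"
    and bound: "\<And>y. y \<in> mats V p q \<Longrightarrow> op_norm (amplify \<Psi> y) \<le> B * mnorm V y"
    and x: "x \<in> mats C p q"
  shows "op_norm (amplify \<Phi> x) \<le> B * mnorm C x"
proof (rule op_norm_leI)
  interpret C: matrix_seminormed C by (rule matrix_seminormed_C)
  show "0 \<le> B * mnorm C x" using assms(1) C.mnorm_nonneg[OF x] by simp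
  note xd = mats_dims[OF x]
  fix y z
  let ?R = "dim_row (amplify \<Phi> x)" and ?S = "dim_col (amplify \<Phi> x)"
  let ?t = "\<lambda>k. term_mat k x"
  have "(\<lambda>k. bilin (amplify \<Psi> (?t k)) y z) \<longlonglongrightarrow> bilin (amplify \<Phi> x) y z"
  proof -
    have "(\<lambda>k. amplify \<Psi> (?t k) $$ (r, s)) \<longlonglongrightarrow> amplify \<Phi> x $$ (r, s)" if "r < ?R" "s < ?S" for r s
      using lim[of "r mod dim_row \<Phi>" "s mod dim_col \<Phi>" "x $$ (r div dim_row \<Phi>, s div dim_col \<Phi>)"]
        that mats_index[OF x] xd
      by (simp add: amplify_index dims block_index)
    then have "(\<lambda>k. \<Sum>r<?R. \<Sum>s<?S. y r * amplify \<Psi> (?t k) $$ (r, s) * z s)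
        \<longlonglongrightarrow> (\<Sum>r<?R. \<Sum>s<?S. y r * amplify \<Phi> x $$ (r, s) * z s)"
      by (intro tendsto_sum tendsto_mult tendsto_const) auto
    then show ?thesis by (simp add: bilin_def dims)
  qed
  then have lhs: "(\<lambda>k. cmod (bilin (amplify \<Psi> (?t k)) y z)) \<longlonglongrightarrow> cmod (bilin (amplify \<Phi> x) y z)"
    by (rule tendsto_norm)
  have rhs: "(\<lambda>k. B * mnorm V (?t k) * l2 ?R y * l2 ?S z) \<longlonglongrightarrow> B * mnorm C x * l2 ?R y * l2 ?S z"
    by (intro tendsto_mult tendsto_const mnorm_C_tendsto[OF x])
  show "cmod (bilin (amplify \<Phi> x) y z) \<le> B * mnorm C x * l2 ?R y * l2 ?S z"
  proof (rule LIMSEQ_le[OF lhs rhs], intro exI allI impI)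
    fix k
    have "cmod (bilin (amplify \<Psi> (?t k)) y z) \<le> op_norm (amplify \<Psi> (?t k)) * l2 ?R y * l2 ?S z"
      using bilin_le_op_norm[of "amplify \<Psi> (?t k)" y z] by (simp add: dims)
    also have "\<dots> \<le> B * mnorm V (?t k) * l2 ?R y * l2 ?S z"
      by (intro mult_right_mono bound term_mats[OF x] L2_set_nonneg)
    finally show "cmod (bilin (amplify \<Psi> (?t k)) y z) \<le> B * mnorm V (?t k) * l2 ?R y * l2 ?S z" .
  qed
qed

lemma bounded_functional_C_tendsto:
  assumes "0 \<le> B" and f: "linear_map C complex_vs f"
    and bound: "\<And>s. s \<in> carrier C \<Longrightarrow> cmod (f s) \<le> B * vnorm C s" and s: "s \<in> carrier C"
  shows "(\<lambda>k. f (\<lambda>_. s k)) \<longlonglongrightarrow> f s"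
proof -
  interpret C: matrix_seminormed C by (rule matrix_seminormed_C)
  have "norm (f s - f (\<lambda>_. s k)) \<le> norm (vnorm C (s \<ominus>\<^bsub>C\<^esub> (\<lambda>_. s k))) * B" for k
  proof -
    have d: "s \<ominus>\<^bsub>C\<^esub> (\<lambda>_. s k) \<in> carrier C"
      using s module_C by (simp add: abelian_group.minus_closed module.axioms(2))
    then show ?thesis
      using bound[OF d] linear_functional_diff[OF module_C f s const_C, of "s k"] s C.vnorm_nonneg[OF d]
      by (simp add: mult.commute)
  qed
  then have "(\<lambda>k. f s - f (\<lambda>_. s k)) \<longlonglongrightarrow> 0"
    by (intro tendsto_0_le[OF const_approx_C[OF s] always_eventually] allI)
  from tendsto_diff[OF tendsto_const[of "f s"] this] show ?thesis by simp
qed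

context
  fixes g B
  assumes B: "0 \<le> B" and g: "linear_map V complex_vs g"
    and bound: "\<And>v. v \<in> carrier V \<Longrightarrow> cmod (g v) \<le> B * vnorm V v"
begin

lemma functional_cauchy_tendsto:
  assumes "s \<in> carrier C"
  shows "(\<lambda>k. g (s k)) \<longlonglongrightarrow> lim (\<lambda>k. g (s k))"
proof -
  have "Cauchy (\<lambda>k. g (s k))"
  proof (rule CauchyI)
    fix e :: real assume e: "0 < e"
    have "0 < e / (B + 1)" using e B by simp
    from C_cauchy[OF assms this] obtain M
      where M: "\<And>k l. M \<le> k \<Longrightarrow> M \<le> l \<Longrightarrow> vnorm V (s k \<ominus> s l) < e / (B + 1)" by blast
    have "norm (g (s k) - g (s l)) < e" if "M \<le> k" "M \<le> l" for k l
    proof -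
      have "norm (g (s k) - g (s l)) \<le> B * vnorm V (s k \<ominus> s l)"
        using bound[of "s k \<ominus> s l"] linear_functional_diff[OF module_V g, of "s k" "s l"] assms by simp
      also have "\<dots> \<le> (B + 1) * vnorm V (s k \<ominus> s l)"
        using vnorm_nonneg assms by (intro mult_right_mono) auto
      also have "\<dots> < e" using M[OF that] B by (simp add: pos_less_divide_eq add_nonneg_pos mult.commute)
      finally show ?thesis .
    qed
    then show "\<exists>M. \<forall>k\<ge>M. \<forall>l\<ge>M. norm (g (s k) - g (s l)) < e" by blast
  qed
  then have "convergent (\<lambda>k. g (s k))"
    by (rule Cauchy_convergent)
  then show ?thesis
    by (simp only: convergent_LIMSEQ_iff[symmetric])
qed

lemma linear_map_cauchy_limit: "linear_map C complex_vs (\<lambda>s. lim (\<lambda>k. g (s k)))"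
proof (rule linear_mapI)
  fix s t assume st: "s \<in> carrier C" "t \<in> carrier C"
  have "(\<lambda>k. g ((s \<oplus>\<^bsub>C\<^esub> t) k)) \<longlonglongrightarrow> lim (\<lambda>k. g (s k)) + lim (\<lambda>k. g (t k))"
    using tendsto_add[OF functional_cauchy_tendsto[OF st(1)] functional_cauchy_tendsto[OF st(2)]] st
    by (simp add: linear_mapD(2)[OF g])
  from limI[OF this] show "lim (\<lambda>k. g ((s \<oplus>\<^bsub>C\<^esub> t) k)) = lim (\<lambda>k. g (s k)) \<oplus>\<^bsub>complex_vs\<^esub> lim (\<lambda>k. g (t k))"
    by simp
next
  fix c s assume s: "s \<in> carrier C"
  have "(\<lambda>k. g ((c \<odot>\<^bsub>C\<^esub> s) k)) \<longlonglongrightarrow> c * lim (\<lambda>k. g (s k))"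
    using tendsto_mult_left[OF functional_cauchy_tendsto[OF s], of c] s
    by (simp add: linear_mapD(3)[OF g])
  from limI[OF this] show "lim (\<lambda>k. g ((c \<odot>\<^bsub>C\<^esub> s) k)) = c \<odot>\<^bsub>complex_vs\<^esub> lim (\<lambda>k. g (s k))"
    by simp
qed simp

lemma cauchy_limit_bound:
  assumes "s \<in> carrier C"
  shows "cmod (lim (\<lambda>k. g (s k))) \<le> B * vnorm C s"
  by (rule LIMSEQ_le[OF tendsto_norm[OF functional_cauchy_tendsto[OF assms]]
        tendsto_mult_left[OF vnorm_C_tendsto[OF assms]]]) (use bound assms in auto)

lemma cauchy_limit_null: 
  assumes "s \<in> null"
  shows "lim (\<lambda>k. g (s k)) = 0"
  using cauchy_limit_bound[of s] assms by (simp add: null_seqs_eq)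

text \<open>
  The extension of \<open>g\<close> takes limits along Cauchy sequences; these vanish on null sequences, so they
  descend to the quotient.
\<close>

lemma completion_functional:
  "\<exists>h. linear_map (completion V) complex_vs h \<and> (\<forall>v\<in>carrier V. h (completion_embed V v) = g v) \<and>
     (\<forall>S\<in>carrier (completion V). cmod (h S) \<le> B * vnorm (completion V) S)"
proof (intro exI conjI ballI)
  let ?l = "\<lambda>s. lim (\<lambda>k. g (s k))"
  let ?h = "quotient_functional ?l"
  interpret n: seminormed_subspace C null by (rule seminormed_subspace_null)
  note l = linear_map_cauchy_limit cauchy_limit_null
  show "linear_map (completion V) complex_vs ?h"
    using n.linear_map_quotient_functional[OF l] by (simp add: completion_def quotient_op_def)
  show "?h (completion_embed V v) = g v" if "v \<in> carrier V" for v
    using n.quotient_functional_coset[OF l const_C[OF that]] by (simp add: completion_embed_def)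
  show "cmod (?h S) \<le> B * vnorm (completion V) S" if "S \<in> carrier (completion V)" for S
    using n.quotient_functional_bound[OF B l cauchy_limit_bound] that by (simp add: completion_def)
qed

end

end

section \<open>The algebraic tensor product\<close>

lemma lookup_map_scale: "Poly_Mapping.lookup (Poly_Mapping.map ((*) c) u) k = c * Poly_Mapping.lookup u k" for c :: complex
  by (simp add: Poly_Mapping.map.rep_eq when_def)

lemma free_vs_simps [simp]:
  "carrier (free_vs S) = {u. Poly_Mapping.keys u \<subseteq> S}" "zero (free_vs S) = 0"
  "add (free_vs S) = (+)" "smult (free_vs S) = (\<lambda>c. Poly_Mapping.map ((*) c))"
  by (simp_all add: free_vs_def)

lemma keys_map_scale: "Poly_Mapping.keys (Poly_Mapping.map ((*) c) u) \<subseteq> Poly_Mapping.keys u" for c :: complex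
  by (auto simp: in_keys_iff lookup_map_scale)

lemma module_free_vs: "module complex_vs (free_vs S)"
proof (rule complex_moduleI)
  show "x \<oplus>\<^bsub>free_vs S\<^esub> y \<in> carrier (free_vs S)" if "x \<in> carrier (free_vs S)" "y \<in> carrier (free_vs S)" for x y
    using that Poly_Mapping.keys_add[of x y] by auto
  show "c \<odot>\<^bsub>free_vs S\<^esub> x \<in> carrier (free_vs S)" if "x \<in> carrier (free_vs S)" for c x
    using that keys_map_scale[of c x] by auto
qed (auto intro!: poly_mapping_eqI simp: lookup_map_scale lookup_add algebra_simps)

lemma map_scale_single: "Poly_Mapping.map ((*) c) (Poly_Mapping.single k d) = Poly_Mapping.single k (c * d)" for c :: complex
  by (rule poly_mapping_eqI) (simp add: lookup_map_scale lookup_single when_def)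

lemma minus_free_vs:
  assumes "u \<in> carrier (free_vs S)" "v \<in> carrier (free_vs S)"
  shows "u \<ominus>\<^bsub>free_vs S\<^esub> v = u - v"
proof -
  have "u + Poly_Mapping.map ((*) (-1)) v = u - v"
    by (rule poly_mapping_eqI) (simp add: lookup_map_scale lookup_add lookup_minus)
  then show ?thesis
    using minus_complex_module[OF module_free_vs assms] by simp
qed

lemma finsum_one_term:
  fixes V (structure)
  assumes "abelian_group V" "finite A" "a \<in> A" "f \<in> A \<rightarrow> carrier V" "\<And>b. b \<in> A \<Longrightarrow> b \<noteq> a \<Longrightarrow> f b = \<zero>"
  shows "finsum V f A = f a"
proof -
  interpret abelian_group V by fact
  have "finsum V f A = finsum V (\<lambda>j. if a = j then f j else \<zero>) A"
    using assms by (intro finsum_cong') auto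
  also have "\<dots> = f a"
    using assms by (intro finsum_singleton) auto
  finally show ?thesis .
qed

lemma finsum_lessThan_add:
  fixes V (structure) and p p' :: nat
  assumes "abelian_group V" "f \<in> {..<p + p'} \<rightarrow> carrier V"
  shows "finsum V f {..<p + p'} = finsum V f {..<p} \<oplus> finsum V (\<lambda>k. f (p + k)) {..<p'}"
proof -
  interpret abelian_group V by fact
  have "finsum V f {..<p + p'} = finsum V f ({..<p} \<union> (\<lambda>k. p + k) ` {..<p'})"
  proof (rule arg_cong[where f = "finsum V f"])
    have "k \<in> (\<lambda>k. p + k) ` {..<p'}" if "k < p + p'" "\<not> k < p" for k
      using that by (intro image_eqI[of _ _ "k - p"]) auto
    then show "{..<p + p'} = {..<p} \<union> (\<lambda>k. p + k) ` {..<p'}" by auto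
  qed
  also have "\<dots> = finsum V f {..<p} \<oplus> finsum V f ((\<lambda>k. p + k) ` {..<p'})"
    using assms(2) by (intro finsum_Un_disjoint) auto
  also have "finsum V f ((\<lambda>k. p + k) ` {..<p'}) = finsum V (\<lambda>k. f (p + k)) {..<p'}"
    using assms(2) by (intro finsum_reindex) auto
  finally show ?thesis .
qed

locale tensor_pair =
  fixes E :: "'a opspace" and F :: "'b opspace"
  assumes E: "module complex_vs E" and F: "module complex_vs F"
begin

abbreviation "free \<equiv> free_vs (carrier E \<times> carrier F)"
abbreviation "T \<equiv> alg_tensor E F"
abbreviation "el \<equiv> alg_tensor_elem E F"

lemma tensor_generators_subset:
  "{Poly_Mapping.single (x \<oplus>\<^bsub>E\<^esub> x', y) (1 :: complex)
        - Poly_Mapping.single (x, y) 1 - Poly_Mapping.single (x', y) 1 | x x' y.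
        x \<in> carrier E \<and> x' \<in> carrier E \<and> y \<in> carrier F} \<union>
     {Poly_Mapping.single (x, y \<oplus>\<^bsub>F\<^esub> y') 1
        - Poly_Mapping.single (x, y) 1 - Poly_Mapping.single (x, y') 1 | x y y'.
        x \<in> carrier E \<and> y \<in> carrier F \<and> y' \<in> carrier F} \<union>
     {Poly_Mapping.single (c \<odot>\<^bsub>E\<^esub> x, y) 1 - Poly_Mapping.single (x, y) c | c x y.
        x \<in> carrier E \<and> y \<in> carrier F} \<union>
     {Poly_Mapping.single (x, c \<odot>\<^bsub>F\<^esub> y) 1 - Poly_Mapping.single (x, y) c | c x y.
        x \<in> carrier E \<and> y \<in> carrier F} \<subseteq> carrier free"
proof -
  interpret E: module complex_vs E by (rule E)
  interpret F: module complex_vs F by (rule F)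
  have diff: "u - v \<in> carrier free" if "u \<in> carrier free" "v \<in> carrier free" for u v
    using that keys_diff[of u v] by auto
  have single: "Poly_Mapping.single (x, y) c \<in> carrier free" if "x \<in> carrier E" "y \<in> carrier F" for x y c
    using that by simp
  show ?thesis
    by (intro Un_least subsetI; elim CollectE exE conjE; hypsubst; intro diff single) simp_all
qed

lemma tensor_subspace: "complex_subspace free (tensor_rels E F)"
  unfolding tensor_rels_def
  by (intro complex_subspace.intro complex_subspace_axioms.intro module_free_vs
      linear_span_submodule tensor_generators_subset)

interpretation complex_subspace free "tensor_rels E F" by (rule tensor_subspace)

lemma tensor_rels_generators:
  assumes "x \<in> carrier E" "y \<in> carrier F"
  shows "x' \<in> carrier E \<Longrightarrow> Poly_Mapping.single (x \<oplus>\<^bsub>E\<^esub> x', y) (1 :: complex)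
        - Poly_Mapping.single (x, y) 1 - Poly_Mapping.single (x', y) 1 \<in> tensor_rels E F"
    and "Poly_Mapping.single (c \<odot>\<^bsub>E\<^esub> x, y) 1 - Poly_Mapping.single (x, y) c \<in> tensor_rels E F"
    and "Poly_Mapping.single (x, c \<odot>\<^bsub>F\<^esub> y) 1 - Poly_Mapping.single (x, y) c \<in> tensor_rels E F"
proof -
  note gen = subsetD[OF linear_span_superset]
  show "Poly_Mapping.single (x \<oplus>\<^bsub>E\<^esub> x', y) (1 :: complex)
        - Poly_Mapping.single (x, y) 1 - Poly_Mapping.single (x', y) 1 \<in> tensor_rels E F" if "x' \<in> carrier E"
    using assms that unfolding tensor_rels_def by (intro gen UnI1[OF UnI1[OF UnI1]]) blast
  show "Poly_Mapping.single (c \<odot>\<^bsub>E\<^esub> x, y) 1 - Poly_Mapping.single (x, y) c \<in> tensor_rels E F"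
    using assms unfolding tensor_rels_def by (intro gen UnI1[OF UnI2]) blast
  show "Poly_Mapping.single (x, c \<odot>\<^bsub>F\<^esub> y) 1 - Poly_Mapping.single (x, y) c \<in> tensor_rels E F"
    using assms unfolding tensor_rels_def by (intro gen UnI2) blast
qed

lemma module_T: "module complex_vs T"
  unfolding alg_tensor_def by (rule quotient_module)

lemma single_carrier: "x \<in> carrier E \<Longrightarrow> y \<in> carrier F \<Longrightarrow> Poly_Mapping.single (x, y) c \<in> carrier free"
  by simp

lemma el_closed: "x \<in> carrier E \<Longrightarrow> y \<in> carrier F \<Longrightarrow> el x y \<in> carrier T"
  unfolding alg_tensor_def alg_tensor_elem_def by (intro coset_in_quotient single_carrier)

lemma smult_el:
  "x \<in> carrier E \<Longrightarrow> y \<in> carrier F \<Longrightarrow>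
    c \<odot>\<^bsub>T\<^esub> el x y = tensor_rels E F +>\<^bsub>free\<^esub> Poly_Mapping.single (x, y) c"
  unfolding alg_tensor_def alg_tensor_elem_def
  by (subst quotient_smult[OF single_carrier]) (simp_all add: map_scale_single)

lemma el_add_left:
  assumes "x \<in> carrier E" "x' \<in> carrier E" "y \<in> carrier F"
  shows "el (x \<oplus>\<^bsub>E\<^esub> x') y = el x y \<oplus>\<^bsub>T\<^esub> el x' y"
proof -
  interpret E: module complex_vs E by (rule E)
  have c: "Poly_Mapping.single (x \<oplus>\<^bsub>E\<^esub> x', y) (1::complex) \<in> carrier free"
    "Poly_Mapping.single (x, y) (1::complex) \<in> carrier free" "Poly_Mapping.single (x', y) (1::complex) \<in> carrier free"
    using assms by (intro single_carrier; simp)+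
  then have s: "Poly_Mapping.single (x, y) (1::complex) + Poly_Mapping.single (x', y) 1 \<in> carrier free"
    using module_free_vs a_closed[OF c(2,3)] by simp
  show ?thesis
    unfolding alg_tensor_def alg_tensor_elem_def quotient_add[OF c(2,3)]
    using coset_eq_iff[OF c(1) s] tensor_rels_generators(1)[OF assms(1,3,2)] minus_free_vs[OF c(1) s]
    by (simp add: diff_diff_eq)
qed

lemma el_smult_left:
  assumes "x \<in> carrier E" "y \<in> carrier F"
  shows "el (c \<odot>\<^bsub>E\<^esub> x) y = c \<odot>\<^bsub>T\<^esub> el x y"
proof -
  interpret E: module complex_vs E by (rule E)
  have c: "Poly_Mapping.single (c \<odot>\<^bsub>E\<^esub> x, y) (1::complex) \<in> carrier free" "Poly_Mapping.single (x, y) c \<in> carrier free"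
    using assms by (intro single_carrier; simp)+
  show ?thesis
    unfolding smult_el[OF assms] unfolding alg_tensor_elem_def
    using coset_eq_iff[OF c] tensor_rels_generators(2)[OF assms] minus_free_vs[OF c] by simp
qed

lemma el_smult_right:
  assumes "x \<in> carrier E" "y \<in> carrier F"
  shows "el x (c \<odot>\<^bsub>F\<^esub> y) = c \<odot>\<^bsub>T\<^esub> el x y"
proof -
  interpret F: module complex_vs F by (rule F)
  have c: "Poly_Mapping.single (x, c \<odot>\<^bsub>F\<^esub> y) (1::complex) \<in> carrier free" "Poly_Mapping.single (x, y) c \<in> carrier free"
    using assms by (intro single_carrier; simp)+
  show ?thesis
    unfolding smult_el[OF assms] unfolding alg_tensor_elem_def
    using coset_eq_iff[OF c] tensor_rels_generators(3)[OF assms] minus_free_vs[OF c] by simp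
qed

lemma el_zero_left: "y \<in> carrier F \<Longrightarrow> el \<zero>\<^bsub>E\<^esub> y = \<zero>\<^bsub>T\<^esub>"
proof -
  interpret E: module complex_vs E by (rule E)
  assume y: "y \<in> carrier F"
  have "el (0 \<odot>\<^bsub>E\<^esub> \<zero>\<^bsub>E\<^esub>) y = 0 \<odot>\<^bsub>T\<^esub> el \<zero>\<^bsub>E\<^esub> y" using y by (intro el_smult_left) auto
  then show ?thesis
    using y by (simp add: complex_module_rules[OF E] complex_module_rules[OF module_T] el_closed)
qed

lemma el_zero_right: "x \<in> carrier E \<Longrightarrow> el x \<zero>\<^bsub>F\<^esub> = \<zero>\<^bsub>T\<^esub>"
proof -
  interpret F: module complex_vs F by (rule F)
  assume x: "x \<in> carrier E"
  have "el x (0 \<odot>\<^bsub>F\<^esub> \<zero>\<^bsub>F\<^esub>) = 0 \<odot>\<^bsub>T\<^esub> el x \<zero>\<^bsub>F\<^esub>" using x by (intro el_smult_right) auto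
  then show ?thesis
    using x by (simp add: complex_module_rules[OF F] complex_module_rules[OF module_T] el_closed)
qed

text \<open>
  Linear combinations need no separate step, since scalars are absorbed into the first factor:
  \<open>c (x \<otimes> y) = (c x) \<otimes> y\<close>.
\<close>

lemma alg_tensor_induct:
  assumes t: "t \<in> carrier T"
    and el: "\<And>x y. x \<in> carrier E \<Longrightarrow> y \<in> carrier F \<Longrightarrow> P (el x y)"
    and zero: "P \<zero>\<^bsub>T\<^esub>"
    and add: "\<And>t u. t \<in> carrier T \<Longrightarrow> u \<in> carrier T \<Longrightarrow> P t \<Longrightarrow> P u \<Longrightarrow> P (t \<oplus>\<^bsub>T\<^esub> u)"
  shows "P t"
proof -
  interpret E: module complex_vs E by (rule E)
  have "P (tensor_rels E F +>\<^bsub>free\<^esub> u)" if "u \<in> carrier free" for u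
    using that
  proof (induction u rule: Poly_Mapping.update_induct)
    case const
    then show ?case using zero quotient_zero unfolding alg_tensor_def by simp
  next
    case (update u k c)
    have sub: "u \<in> carrier free" and k: "k \<in> carrier E \<times> carrier F"
      using update.prems update.hyps by (auto simp: Poly_Mapping.keys_update)
    obtain x y where xy: "k = (x, y)" "x \<in> carrier E" "y \<in> carrier F" using k by blast
    have split: "Poly_Mapping.update k c u = u + Poly_Mapping.single k c"
      using update.hyps(1)
      by (intro poly_mapping_eqI) (auto simp: lookup_update lookup_add lookup_single when_def in_keys_iff)
    have "tensor_rels E F +>\<^bsub>free\<^esub> Poly_Mapping.single (x, y) c = el (c \<odot>\<^bsub>E\<^esub> x) y"
      using smult_el[OF xy(2,3)] el_smult_left[OF xy(2,3)] by simp
    then have "P (tensor_rels E F +>\<^bsub>free\<^esub> Poly_Mapping.single (x, y) c)"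
      using el[of "c \<odot>\<^bsub>E\<^esub> x" y] xy by simp
    moreover have "tensor_rels E F +>\<^bsub>free\<^esub> (u + Poly_Mapping.single k c)
        = (tensor_rels E F +>\<^bsub>free\<^esub> u) \<oplus>\<^bsub>T\<^esub> (tensor_rels E F +>\<^bsub>free\<^esub> Poly_Mapping.single (x, y) c)"
      using quotient_add[OF sub single_carrier[OF xy(2,3)], of c] by (simp add: alg_tensor_def xy(1))
    ultimately show ?case
      unfolding split
      using add[of "tensor_rels E F +>\<^bsub>free\<^esub> u" "tensor_rels E F +>\<^bsub>free\<^esub> Poly_Mapping.single (x, y) c"]
        update.IH[OF sub] coset_in_quotient[OF sub] coset_in_quotient[OF single_carrier[OF xy(2,3)], of c]
      by (simp add: alg_tensor_def)
  qed
  then show ?thesis using t unfolding alg_tensor_def quotient_carrier by blast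
qed

text \<open>
  The universal property of the tensor product: the linear extension of \<open>\<beta>\<close> to the free vector
  space on pairs vanishes on the bilinearity relations.
\<close>

lemma bilinear_form_functional:
  assumes add_left: "\<And>x x' y. x \<in> carrier E \<Longrightarrow> x' \<in> carrier E \<Longrightarrow> y \<in> carrier F \<Longrightarrow>
      \<beta> (x \<oplus>\<^bsub>E\<^esub> x') y = \<beta> x y + \<beta> x' y"
    and add_right: "\<And>x y y'. x \<in> carrier E \<Longrightarrow> y \<in> carrier F \<Longrightarrow> y' \<in> carrier F \<Longrightarrow>
      \<beta> x (y \<oplus>\<^bsub>F\<^esub> y') = \<beta> x y + \<beta> x y'"
    and smult_left: "\<And>c x y. x \<in> carrier E \<Longrightarrow> y \<in> carrier F \<Longrightarrow> \<beta> (c \<odot>\<^bsub>E\<^esub> x) y = c * \<beta> x y"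
    and smult_right: "\<And>c x y. x \<in> carrier E \<Longrightarrow> y \<in> carrier F \<Longrightarrow> \<beta> x (c \<odot>\<^bsub>F\<^esub> y) = c * \<beta> x y"
  shows "\<exists>g. linear_map T complex_vs g \<and> (\<forall>x\<in>carrier E. \<forall>y\<in>carrier F. g (el x y) = \<beta> x y)"
proof -
  define h where "h u = (\<Sum>k\<in>Poly_Mapping.keys u. Poly_Mapping.lookup u k * (case k of (x, y) \<Rightarrow> \<beta> x y))" for u
  have h_eq: "h u = (\<Sum>k\<in>A. Poly_Mapping.lookup u k * (case k of (x, y) \<Rightarrow> \<beta> x y))"
    if "finite A" "Poly_Mapping.keys u \<subseteq> A" for u A
    unfolding h_def by (rule sum.mono_neutral_left) (use that in \<open>auto simp: in_keys_iff\<close>)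
  have h_single: "h (Poly_Mapping.single (x, y) c) = c * \<beta> x y" for x y c
    by (subst h_eq[of "{(x, y)}"]) auto
  have h_add: "h (u + v) = h u + h v" for u v
  proof -
    have "h w = (\<Sum>k\<in>Poly_Mapping.keys u \<union> Poly_Mapping.keys v. Poly_Mapping.lookup w k * (case k of (x, y) \<Rightarrow> \<beta> x y))"
      if "w \<in> {u, v, u + v}" for w
      using that Poly_Mapping.keys_add[of u v] by (intro h_eq) auto
    then show ?thesis by (simp add: lookup_add distrib_right sum.distrib)
  qed
  have h_scale: "h (Poly_Mapping.map ((*) c) u) = c * h u" for c u
    by (subst h_eq[OF finite_keys keys_map_scale]) (simp add: h_def lookup_map_scale sum_distrib_left mult.assoc)
  have h_lin: "linear_map free complex_vs h"
    by (rule linear_mapI) (simp_all add: h_add h_scale)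
  have h_diff: "h (u - v) = h u - h v" for u v
    using h_add[of "u - v" v] by simp
  have h0: "h u = 0" if "u \<in> tensor_rels E F" for u
    by (rule linear_functional_zero_on_span[OF module_free_vs h_lin tensor_generators_subset _
          that[unfolded tensor_rels_def]])
      (auto simp: h_diff h_single add_left add_right smult_left smult_right)
  show ?thesis
  proof (intro exI conjI ballI)
    show "linear_map T complex_vs (quotient_functional h)"
      unfolding alg_tensor_def by (rule linear_map_quotient_functional[OF h_lin h0])
    show "quotient_functional h (el x y) = \<beta> x y" if "x \<in> carrier E" "y \<in> carrier F" for x y
      using quotient_functional_coset[OF h_lin h0 single_carrier[OF that, of 1]]
      by (simp add: alg_tensor_elem_def h_single)
  qed
qed

end

section \<open>The Haagerup norm\<close>

subsection \<open>Block matrices over an operator space\<close>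

definition row_block :: "'a mat \<Rightarrow> 'a mat \<Rightarrow> 'a mat" where
  "row_block a a' = mat (dim_row a) (dim_col a + dim_col a') (\<lambda>(i, k).
     if k < dim_col a then a $$ (i, k) else a' $$ (i, k - dim_col a))"

definition col_block :: "'a mat \<Rightarrow> 'a mat \<Rightarrow> 'a mat" where
  "col_block b b' = mat (dim_row b + dim_row b') (dim_col b) (\<lambda>(k, j).
     if k < dim_row b then b $$ (k, j) else b' $$ (k - dim_row b, j))"

definition place_row :: "'a opspace \<Rightarrow> nat \<Rightarrow> nat \<Rightarrow> 'a mat \<Rightarrow> 'a mat" where
  "place_row V m i a = mat m (dim_col a) (\<lambda>(i', k). if i' = i then a $$ (0, k) else \<zero>\<^bsub>V\<^esub>)"

definition place_col :: "'a opspace \<Rightarrow> nat \<Rightarrow> nat \<Rightarrow> 'a mat \<Rightarrow> 'a mat" where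
  "place_col V n j b = mat (dim_row b) n (\<lambda>(k, j'). if j' = j then b $$ (k, 0) else \<zero>\<^bsub>V\<^esub>)"

lemma row_block_mats: "a \<in> mats V m p \<Longrightarrow> a' \<in> mats V m p' \<Longrightarrow> row_block a a' \<in> mats V m (p + p')"
  by (auto simp: row_block_def mats_def)

lemma col_block_mats: "b \<in> mats V p n \<Longrightarrow> b' \<in> mats V p' n \<Longrightarrow> col_block b b' \<in> mats V (p + p') n"
  by (auto simp: col_block_def mats_def)

lemma bimult_one_term:
  fixes V (structure)
  assumes V: "module complex_vs V" and x: "x \<in> mats V m n"
    and "\<alpha> \<in> carrier_mat p m" "\<beta> \<in> carrier_mat n q" "i < p" "j < q" "k < m" "l < n"
    and zero: "\<And>k' l'. k' < m \<Longrightarrow> l' < n \<Longrightarrow> (k', l') \<noteq> (k, l) \<Longrightarrow>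
      \<alpha> $$ (i, k') = 0 \<or> \<beta> $$ (l', j) = 0 \<or> x $$ (k', l') = \<zero>"
  shows "mat_bimult V \<alpha> x \<beta> $$ (i, j) = (\<alpha> $$ (i, k) * \<beta> $$ (l, j)) \<odot> x $$ (k, l)"
proof -
  interpret module complex_vs V by (rule V)
  have xc: "x $$ (k', l') \<in> carrier V" if "k' < m" "l' < n" for k' l'
    using mats_index[OF x that] .
  have null: "c \<odot> \<zero> = \<zero>" for c using smult_r_null[of c] by simp
  have "mat_bimult V \<alpha> x \<beta> $$ (i, j) = finsum V (\<lambda>(k, l). (\<alpha> $$ (i, k) * \<beta> $$ (l, j)) \<odot> x $$ (k, l))
      ({..<m} \<times> {..<n})"
    using assms(3-6) mats_dims[OF x] by (simp add: mat_bimult_def)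
  also have "\<dots> = (\<lambda>(k, l). (\<alpha> $$ (i, k) * \<beta> $$ (l, j)) \<odot> x $$ (k, l)) (k, l)"
  proof (rule finsum_one_term[OF abelian_group_axioms])
    show "(\<lambda>(k, l). (\<alpha> $$ (i, k) * \<beta> $$ (l, j)) \<odot> x $$ (k, l)) \<in> {..<m} \<times> {..<n} \<rightarrow> carrier V"
      using xc by auto
    show "(case kl of (k, l) \<Rightarrow> (\<alpha> $$ (i, k) * \<beta> $$ (l, j)) \<odot> x $$ (k, l)) = \<zero>"
      if "kl \<in> {..<m} \<times> {..<n}" "kl \<noteq> (k, l)" for kl
      using that zero[of "fst kl" "snd kl"] xc[of "fst kl" "snd kl"]
      by (cases kl) (auto simp: complex_module_rules[OF V] null)
  qed (use assms in auto)
  finally show ?thesis by simp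
qed

context
  fixes V :: "'a opspace" (structure)
  assumes V: "operator_space V"
begin

interpretation operator_space V by (rule V)

lemma module_of_operator_space: "module complex_vs V" ..

lemma mat_dsum_mats: "x \<in> mats V m n \<Longrightarrow> y \<in> mats V p q \<Longrightarrow> mat_dsum V x y \<in> mats V (m + p) (n + q)"
  by (auto simp: mats_def mat_dsum_def mat_zero_def)

text \<open>
  A matrix whose entries are multiples of single entries of \<open>x\<close>, as prescribed by \<open>\<alpha>\<close> and \<open>\<beta>\<close>, is
  \<open>\<alpha> x \<beta>\<close>; blocks and padding by zeros are of this form.
\<close>

lemma mnorm_bimult_entries:
  assumes x: "x \<in> mats V m n" and \<alpha>: "\<alpha> \<in> carrier_mat p m" "op_norm \<alpha> \<le> r"
    and \<beta>: "\<beta> \<in> carrier_mat n q" "op_norm \<beta> \<le> s"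
    and z: "z \<in> carrier_mat p q" and idx: "\<And>i j. i < p \<Longrightarrow> j < q \<Longrightarrow> k i j < m \<and> l i j < n"
    and entry: "\<And>i j. i < p \<Longrightarrow> j < q \<Longrightarrow>
      z $$ (i, j) = (\<alpha> $$ (i, k i j) * \<beta> $$ (l i j, j)) \<odot> x $$ (k i j, l i j)"
    and zero: "\<And>i j k' l'. i < p \<Longrightarrow> j < q \<Longrightarrow> k' < m \<Longrightarrow> l' < n \<Longrightarrow> (k', l') \<noteq> (k i j, l i j) \<Longrightarrow>
      \<alpha> $$ (i, k') = 0 \<or> \<beta> $$ (l', j) = 0 \<or> x $$ (k', l') = \<zero>"
  shows "mnorm V z \<le> r * mnorm V x * s"
proof -
  have "z = mat_bimult V \<alpha> x \<beta>"
  proof (rule eq_matI)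
    fix i j assume "i < dim_row (mat_bimult V \<alpha> x \<beta>)" "j < dim_col (mat_bimult V \<alpha> x \<beta>)"
    then have ij: "i < p" "j < q" using \<alpha>(1) \<beta>(1) by (auto simp: mat_bimult_def)
    show "z $$ (i, j) = mat_bimult V \<alpha> x \<beta> $$ (i, j)"
      unfolding entry[OF ij] using idx[OF ij]
      by (intro bimult_one_term[symmetric, OF module_of_operator_space x \<alpha>(1) \<beta>(1) ij]) (auto simp: zero[OF ij])
  qed (use \<alpha>(1) \<beta>(1) z in \<open>auto simp: mat_bimult_def\<close>)
  then have "mnorm V z \<le> op_norm \<alpha> * mnorm V x * op_norm \<beta>"
    using mnorm_bimult[OF \<alpha>(1) x \<beta>(1)] by simp
  also have "\<dots> \<le> r * mnorm V x * s"
    using mnorm_nonneg[OF x] \<alpha>(2) \<beta>(2) op_norm_nonneg[of \<alpha>] op_norm_nonneg[of \<beta>]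
    by (intro mult_mono mult_nonneg_nonneg) auto
  finally show ?thesis .
qed

lemma smult_cancel: "v \<in> carrier V \<Longrightarrow> c \<noteq> 0 \<Longrightarrow> c \<odot> ((1 / c) \<odot> v) = v"
  using complex_module_rules(4)[OF module_of_operator_space, of v c "1 / c"]
    complex_module_rules(1)[OF module_of_operator_space, of v] by simp

text \<open>
  \<open>[a, a'] = [s1, t1] (a/s \<oplus> a'/t)\<close>, and the direct sum is contractive.
\<close>

lemma mnorm_row_block:
  assumes a: "a \<in> mats V m p" and a': "a' \<in> mats V m p'" and st: "0 < s" "0 < t"
    and le: "mnorm V a \<le> s" "mnorm V a' \<le> t"
  shows "mnorm V (row_block a a') \<le> sqrt (s\<^sup>2 + t\<^sup>2)"
proof -
  let ?a = "mat_smult V (1 / of_real s) a" and ?a' = "mat_smult V (1 / of_real t) a'"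
  note b = mats_mat_smult[OF module_of_operator_space a, of "1 / of_real s"]
    and b' = mats_mat_smult[OF module_of_operator_space a', of "1 / of_real t"]
  have "mnorm V (row_block a a') \<le> sqrt (s\<^sup>2 + t\<^sup>2) * mnorm V (mat_dsum V ?a ?a') * 1"
    by (rule mnorm_bimult_entries[OF mat_dsum_mats[OF b b'] _ op_norm_row_block _ op_norm_one_le,
          where k = "\<lambda>i j. if j < p then i else m + i" and l = "\<lambda>i j. j"])
      (use st mats_dims[OF a] mats_dims[OF a'] mats_index[OF a] mats_index[OF a'] in
        \<open>auto simp: mat_dsum_def mat_zero_def row_block_def mat_smult_def smult_cancel\<close>)
  also have "\<dots> \<le> sqrt (s\<^sup>2 + t\<^sup>2) * 1 * 1"
    using mnorm_dsum[OF b b'] st le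
    by (intro mult_right_mono mult_left_mono) (auto simp: mnorm_smult[OF a] mnorm_smult[OF a'] norm_divide)
  finally show ?thesis by simp
qed

lemma mnorm_col_block:
  assumes a: "a \<in> mats V p n" and a': "a' \<in> mats V p' n" and st: "0 < s" "0 < t"
    and le: "mnorm V a \<le> s" "mnorm V a' \<le> t"
  shows "mnorm V (col_block a a') \<le> sqrt (s\<^sup>2 + t\<^sup>2)"
proof -
  let ?a = "mat_smult V (1 / of_real s) a" and ?a' = "mat_smult V (1 / of_real t) a'"
  note b = mats_mat_smult[OF module_of_operator_space a, of "1 / of_real s"]
    and b' = mats_mat_smult[OF module_of_operator_space a', of "1 / of_real t"]
  have "mnorm V (col_block a a') \<le> 1 * mnorm V (mat_dsum V ?a ?a') * sqrt (s\<^sup>2 + t\<^sup>2)"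
    by (rule mnorm_bimult_entries[OF mat_dsum_mats[OF b b'] _ op_norm_one_le _
          order_trans[OF op_norm_transpose_le op_norm_row_block[of n s t]],
          where k = "\<lambda>i j. i" and l = "\<lambda>i j. if i < p then j else n + j"])
      (use st mats_dims[OF a] mats_dims[OF a'] mats_index[OF a] mats_index[OF a'] in
        \<open>auto simp: mat_dsum_def mat_zero_def col_block_def mat_smult_def smult_cancel split: if_splits\<close>)
  also have "\<dots> \<le> 1 * 1 * sqrt (s\<^sup>2 + t\<^sup>2)"
    using mnorm_dsum[OF b b'] st le
    by (intro mult_right_mono) (auto simp: mnorm_smult[OF a] mnorm_smult[OF a'] norm_divide)
  finally show ?thesis by simp
qed

lemma l2_unit_le: "l2 n (\<lambda>k. if k = i then 1 else 0) \<le> 1"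
proof -
  have "(\<Sum>k<n. (cmod (if k = i then 1 else 0))\<^sup>2) = (\<Sum>k<n. if k = i then 1 else 0 :: real)"
    by (rule sum.cong) auto
  also have "\<dots> \<le> 1" by simp
  finally show ?thesis by (simp add: L2_set_def)
qed

lemma mnorm_place_row:
  assumes a: "a \<in> mats V 1 p"
  shows "place_row V m i a \<in> mats V m p" and "mnorm V (place_row V m i a) \<le> mnorm V a"
proof -
  show "place_row V m i a \<in> mats V m p"
    using a by (auto simp: place_row_def mats_def)
  have "mnorm V (place_row V m i a) \<le> 1 * mnorm V a * 1"
    by (rule mnorm_bimult_entries[OF a _ order_trans[OF op_norm_col_le l2_unit_le] _ op_norm_one_le,
          where k = "\<lambda>i j. 0" and l = "\<lambda>i j. j"])
      (use mats_dims[OF a] mats_index[OF a, of 0] in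
        \<open>auto simp: place_row_def complex_module_rules[OF module_of_operator_space]\<close>)
  then show "mnorm V (place_row V m i a) \<le> mnorm V a" by simp
qed

lemma mnorm_place_col:
  assumes b: "b \<in> mats V p 1"
  shows "place_col V n j b \<in> mats V p n" and "mnorm V (place_col V n j b) \<le> mnorm V b"
proof -
  show "place_col V n j b \<in> mats V p n"
    using b by (auto simp: place_col_def mats_def)
  have "mnorm V (place_col V n j b) \<le> 1 * mnorm V b * 1"
    by (rule mnorm_bimult_entries[OF b _ op_norm_one_le _ order_trans[OF op_norm_row_le l2_unit_le],
          where k = "\<lambda>i j. i" and l = "\<lambda>i j. 0"])
      (use mats_dims[OF b] mats_index[OF b, of _ 0] in
        \<open>auto simp: place_col_def complex_module_rules[OF module_of_operator_space]\<close>)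
  then show "mnorm V (place_col V n j b) \<le> mnorm V b" by simp
qed

text \<open>
  Contractive functionals are completely contractive: the bilinear form of \<open>h\<close> at \<open>a\<close> is the value of
  \<open>h\<close> at the vector \<open>y a x\<close>, whose norm the bimodule axiom controls.
\<close>

lemma functional_bilinear_bound:
  assumes h: "linear_map V complex_vs h" and contr: "\<And>v. v \<in> carrier V \<Longrightarrow> cmod (h v) \<le> vnorm V v"
    and a: "a \<in> mats V m n"
  shows "cmod (\<Sum>k<m. \<Sum>l<n. y k * h (a $$ (k, l)) * x l) \<le> mnorm V a * l2 m y * l2 n x"
proof -
  let ?\<alpha> = "mat 1 m (\<lambda>(_, k). y k)" and ?\<beta> = "mat n 1 (\<lambda>(l, _). x l)"
  define v where "v = finsum V (\<lambda>(k, l). (y k * x l) \<odot> a $$ (k, l)) ({..<m} \<times> {..<n})"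
  have terms: "(\<lambda>(k, l). (y k * x l) \<odot> a $$ (k, l)) \<in> {..<m} \<times> {..<n} \<rightarrow> carrier V"
    using mats_index[OF a] by auto
  have vc: "v \<in> carrier V" unfolding v_def using terms by (intro finsum_closed)
  have bim: "mat_bimult V ?\<alpha> a ?\<beta> = mat 1 1 (\<lambda>_. v)"
  proof (rule eq_matI)
    fix i j assume "i < dim_row (mat 1 1 (\<lambda>_. v))" "j < dim_col (mat 1 1 (\<lambda>_. v))"
    then have "i = 0" "j = 0" by auto
    moreover have "finsum V (\<lambda>(k, l). (?\<alpha> $$ (0, k) * ?\<beta> $$ (l, 0)) \<odot> a $$ (k, l)) ({..<m} \<times> {..<n}) = v"
      unfolding v_def using terms by (intro finsum_cong') auto
    ultimately show "mat_bimult V ?\<alpha> a ?\<beta> $$ (i, j) = mat 1 1 (\<lambda>_. v) $$ (i, j)"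
      using mats_dims[OF a] by (simp add: mat_bimult_def)
  qed (auto simp: mat_bimult_def)
  have "h v = (\<Sum>(k, l)\<in>{..<m} \<times> {..<n}. y k * h (a $$ (k, l)) * x l)"
    unfolding v_def using terms mats_index[OF a]
    by (subst linear_functional_finsum[OF module_of_operator_space h])
      (auto intro!: sum.cong simp: linear_mapD(3)[OF h])
  then have "cmod (\<Sum>k<m. \<Sum>l<n. y k * h (a $$ (k, l)) * x l) = cmod (h v)"
    by (simp add: sum.cartesian_product)
  also have "\<dots> \<le> mnorm V (mat_bimult V ?\<alpha> a ?\<beta>)"
    using contr[OF vc] unfolding bim vnorm_def .
  also have "\<dots> \<le> op_norm ?\<alpha> * mnorm V a * op_norm ?\<beta>"
    by (rule mnorm_bimult[OF _ a]) auto
  also have "\<dots> \<le> l2 m y * mnorm V a * l2 n x"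
    using mnorm_nonneg[OF a]
    by (intro mult_mono op_norm_row_le op_norm_col_le) (auto intro: mult_nonneg_nonneg op_norm_nonneg L2_set_nonneg)
  finally show ?thesis by (simp add: mult_ac)
qed

end

subsection \<open>The Haagerup norm is a matrix seminorm\<close>

locale haagerup_pair =
  fixes E :: "'a opspace" and F :: "'b opspace"
  assumes op_E: "operator_space E" and op_F: "operator_space F"
begin

sublocale tensor_pair E F
  by (rule tensor_pair.intro[OF module_of_operator_space[OF op_E] module_of_operator_space[OF op_F]])

abbreviation "H \<equiv> haagerup_alg E F"
abbreviation "tmult \<equiv> tensor_mat_mult E F"

lemma abelian_T: "abelian_group T"
  using module_T by (rule module.axioms(2))

lemma times_dims [simp]: "dim_row (tmult a b) = dim_row a" "dim_col (tmult a b) = dim_col b"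
  by (simp_all add: tensor_mat_mult_def)

lemma times_index:
  assumes "a \<in> mats E m p" "b \<in> mats F p n" "i < m" "j < n"
  shows "tmult a b $$ (i, j) = finsum T (\<lambda>k. el (a $$ (i, k)) (b $$ (k, j))) {..<p}"
  using assms mats_dims[OF assms(1)] mats_dims[OF assms(2)] by (simp add: tensor_mat_mult_def)

lemma times_terms:
  assumes "a \<in> mats E m p" "b \<in> mats F p n" "i < m" "j < n"
  shows "(\<lambda>k. el (a $$ (i, k)) (b $$ (k, j))) \<in> {..<p} \<rightarrow> carrier T"
  using mats_index[OF assms(1)] mats_index[OF assms(2)] assms(3,4) by (auto intro: el_closed)

lemma times_mats:
  assumes "a \<in> mats E m p" "b \<in> mats F p n"
  shows "tmult a b \<in> mats T m n"
proof (rule matsI)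
  interpret T: abelian_group T by (rule abelian_T)
  show "tmult a b \<in> carrier_mat m n"
    by (rule carrier_matI) (simp_all only: times_dims mats_dims[OF assms(1)] mats_dims[OF assms(2)])
  show "tmult a b $$ (i, j) \<in> carrier T" if "i < m" "j < n" for i j
    unfolding times_index[OF assms that] by (rule T.finsum_closed[OF times_terms[OF assms that]])
qed

lemma times_smult:
  assumes a: "a \<in> mats E m p" and b: "b \<in> mats F p n"
  shows "tmult (mat_smult E c a) (mat_smult F d b) = mat_smult T (c * d) (tmult a b)"
proof -
  interpret E: module complex_vs E by (rule E)
  interpret F: module complex_vs F by (rule F)
  interpret T: module complex_vs T by (rule module_T)
  have a': "mat_smult E c a \<in> mats E m p" by (rule mats_mat_smult[OF E a])
  have b': "mat_smult F d b \<in> mats F p n" by (rule mats_mat_smult[OF F b])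
  show ?thesis
  proof (rule mat_eqI_mats[OF times_mats[OF a' b']])
    show "mat_smult T (c * d) (tmult a b) \<in> mats T m n"
      by (rule mats_mat_smult[OF module_T times_mats[OF a b]])
    fix i j assume ij: "i < m" "j < n"
    have entry: "el (c \<odot>\<^bsub>E\<^esub> a $$ (i, k)) (d \<odot>\<^bsub>F\<^esub> b $$ (k, j)) = (c * d) \<odot>\<^bsub>T\<^esub> el (a $$ (i, k)) (b $$ (k, j))"
      if "k < p" for k
      using that ij mats_index[OF a, of i k] mats_index[OF b, of k j]
      by (simp add: el_smult_left el_smult_right el_closed
          complex_module_rules(4)[OF module_T, symmetric] mult.commute)
    have "tmult (mat_smult E c a) (mat_smult F d b) $$ (i, j)
        = finsum T (\<lambda>k. (c * d) \<odot>\<^bsub>T\<^esub> el (a $$ (i, k)) (b $$ (k, j))) {..<p}"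
      unfolding times_index[OF a' b' ij]
      using ij mats_dims[OF a] mats_dims[OF b] entry times_terms[OF a b ij]
      by (intro T.finsum_cong') (auto simp: mat_smult_def Pi_iff)
    also have "\<dots> = (c * d) \<odot>\<^bsub>T\<^esub> tmult a b $$ (i, j)"
      unfolding times_index[OF a b ij]
      using times_terms[OF a b ij] by (intro T.finsum_smult_ldistr[symmetric]) auto
    finally show "tmult (mat_smult E c a) (mat_smult F d b) $$ (i, j) = mat_smult T (c * d) (tmult a b) $$ (i, j)"
      using ij mats_dims[OF a] mats_dims[OF b] by (simp add: mat_smult_def)
  qed
qed

lemma times_blocks:
  assumes a: "a \<in> mats E m p" and b: "b \<in> mats F p n" and a': "a' \<in> mats E m p'" and b': "b' \<in> mats F p' n"
  shows "tmult (row_block a a') (col_block b b') = mat_add T (tmult a b) (tmult a' b')"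
proof -
  interpret T: module complex_vs T by (rule module_T)
  note R = row_block_mats[OF a a'] and K = col_block_mats[OF b b']
  note dims = mats_dims[OF a] mats_dims[OF b] mats_dims[OF a'] mats_dims[OF b']
  show ?thesis
  proof (rule mat_eqI_mats[OF times_mats[OF R K]])
    show "mat_add T (tmult a b) (tmult a' b') \<in> mats T m n"
      by (intro mats_mat_add module_T times_mats[OF a b] times_mats[OF a' b'])
    fix i j assume ij: "i < m" "j < n"
    let ?f = "\<lambda>k. el (row_block a a' $$ (i, k)) (col_block b b' $$ (k, j))"
    have "finsum T ?f {..<p} = tmult a b $$ (i, j)"
      unfolding times_index[OF a b ij] using times_terms[OF a b ij] ij dims
      by (intro T.finsum_cong') (auto simp: row_block_def col_block_def)
    moreover have "finsum T (\<lambda>k. ?f (p + k)) {..<p'} = tmult a' b' $$ (i, j)"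
      unfolding times_index[OF a' b' ij] using times_terms[OF a' b' ij] ij dims
      by (intro T.finsum_cong') (auto simp: row_block_def col_block_def)
    ultimately show "tmult (row_block a a') (col_block b b') $$ (i, j) = mat_add T (tmult a b) (tmult a' b') $$ (i, j)"
      using finsum_lessThan_add[OF abelian_T times_terms[OF R K ij]] ij dims
      by (simp add: times_index[OF R K ij] mat_add_def)
  qed
qed

definition place :: "nat \<Rightarrow> nat \<Rightarrow> nat \<Rightarrow> nat \<Rightarrow> (('a \<times> 'b) \<Rightarrow>\<^sub>0 complex) set \<Rightarrow> (('a \<times> 'b) \<Rightarrow>\<^sub>0 complex) set mat" where
  "place m n i j t = mat m n (\<lambda>ij. if ij = (i, j) then t else \<zero>\<^bsub>T\<^esub>)"

lemma times_place:
  assumes a: "a \<in> mats E 1 p" and b: "b \<in> mats F p 1"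
  shows "tmult (place_row E m i a) (place_col F n j b) = place m n i j (tmult a b $$ (0, 0))"
proof -
  interpret E: module complex_vs E by (rule E)
  interpret F: module complex_vs F by (rule F)
  interpret T: module complex_vs T by (rule module_T)
  note R = mnorm_place_row(1)[OF op_E a, of m i] and K = mnorm_place_col(1)[OF op_F b, of n j]
  note dims = mats_dims[OF a] mats_dims[OF b]
  show ?thesis
  proof (rule eq_matI)
    fix i' j' assume "i' < dim_row (place m n i j (tmult a b $$ (0, 0)))" "j' < dim_col (place m n i j (tmult a b $$ (0, 0)))"
    then have ij: "i' < m" "j' < n" by (auto simp: place_def)
    let ?f = "\<lambda>k. el (place_row E m i a $$ (i', k)) (place_col F n j b $$ (k, j'))"
    show "tmult (place_row E m i a) (place_col F n j b) $$ (i', j') = place m n i j (tmult a b $$ (0, 0)) $$ (i', j')"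
    proof (cases "(i', j') = (i, j)")
      case True
      have "finsum T ?f {..<p} = finsum T (\<lambda>k. el (a $$ (0, k)) (b $$ (k, 0))) {..<p}"
        using times_terms[OF a b, of 0 0] ij dims True
        by (intro T.finsum_cong') (auto simp: place_row_def place_col_def)
      then show ?thesis
        using True ij times_index[OF R K ij] times_index[OF a b, of 0 0] by (simp add: place_def)
    next
      case False
      have "?f k = \<zero>\<^bsub>T\<^esub>" if "k < p" for k
        using False ij that dims mats_index[OF a, of 0 k] mats_index[OF b, of k 0]
        by (auto simp: place_row_def place_col_def el_zero_left el_zero_right)
      then have "finsum T ?f {..<p} = finsum T (\<lambda>_. \<zero>\<^bsub>T\<^esub>) {..<p}"
        by (intro T.finsum_cong') auto
      then show ?thesis
        using False ij times_index[OF R K ij] by (auto simp: place_def)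
    qed
  qed (auto simp: place_def place_row_def place_col_def)
qed

lemma mnorm_E_nonneg: "a \<in> mats E m p \<Longrightarrow> 0 \<le> mnorm E a"
  by (rule operator_space.mnorm_nonneg[OF op_E])

lemma mnorm_F_nonneg: "b \<in> mats F p n \<Longrightarrow> 0 \<le> mnorm F b"
  by (rule operator_space.mnorm_nonneg[OF op_F])

text \<open>
  The norm of \<open>u\<close> is governed by the numbers \<open>c > 0\<close> for which \<open>u = ab\<close> with both factors of norm at most
  \<open>sqrt c\<close>. Unlike factorizations with a bound on the product of the norms, these add: the blocks
  \<open>[a, a']\<close> and \<open>[b; b']\<close> have norm at most \<open>sqrt (c + c')\<close>.
\<close>

definition factors :: "nat \<Rightarrow> nat \<Rightarrow> (('a \<times> 'b) \<Rightarrow>\<^sub>0 complex) set mat \<Rightarrow> real \<Rightarrow> bool" where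
  "factors m n u c \<longleftrightarrow> 0 < c \<and> (\<exists>p. \<exists>a\<in>mats E m p. \<exists>b\<in>mats F p n.
     u = tmult a b \<and> mnorm E a \<le> sqrt c \<and> mnorm F b \<le> sqrt c)"

text \<open>
  The products \<open>ab\<close> and \<open>(r a) (b/r)\<close> agree, so the norms of the factors can be balanced. If \<open>a\<close> has
  norm 0, a large \<open>r\<close> makes \<open>b/r\<close> small enough.
\<close>

lemma factors_times:
  assumes a: "a \<in> mats E m p" and b: "b \<in> mats F p n" and less: "mnorm E a * mnorm F b < c"
  shows "factors m n (tmult a b) c"
proof -
  have na: "0 \<le> mnorm E a" and nb: "0 \<le> mnorm F b"
    using mnorm_E_nonneg[OF a] mnorm_F_nonneg[OF b] .
  then have c: "0 < c" using less by (meson le_less_trans mult_nonneg_nonneg)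
  then have sq: "sqrt c * sqrt c = c" "0 < sqrt c" by auto
  have "\<exists>r>0. r * mnorm E a \<le> sqrt c \<and> mnorm F b \<le> r * sqrt c"
  proof (cases "mnorm E a = 0")
    case True
    then show ?thesis
      using nb sq(2) by (intro exI[of _ "mnorm F b / sqrt c + 1"]) (auto simp: distrib_right add_nonneg_pos)
  next
    case False
    then show ?thesis
      using na less sq by (intro exI[of _ "sqrt c / mnorm E a"]) (auto simp: field_simps)
  qed
  then obtain r where r: "0 < r" "r * mnorm E a \<le> sqrt c" "mnorm F b \<le> r * sqrt c" by blast
  let ?a = "mat_smult E (of_real r) a" and ?b = "mat_smult F (of_real (1 / r)) b"
  have "mat_smult T 1 (tmult a b) = tmult a b"
    using mats_index[OF times_mats[OF a b]] mats_dims[OF times_mats[OF a b]]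
    by (intro eq_matI) (auto simp: mat_smult_def complex_module_rules[OF module_T])
  then have "tmult a b = tmult ?a ?b"
    using r(1) by (simp add: times_smult[OF a b])
  moreover have "mnorm E ?a \<le> sqrt c" "mnorm F ?b \<le> sqrt c"
    using operator_space.mnorm_smult[OF op_E a] operator_space.mnorm_smult[OF op_F b] r
    by (auto simp: norm_divide field_simps)
  ultimately show ?thesis
    unfolding factors_def using c mats_mat_smult[OF E a] mats_mat_smult[OF F b] by blast
qed

lemma factors_add:
  assumes "factors m n u c" "factors m n v d"
  shows "factors m n (mat_add T u v) (c + d)"
proof -
  obtain p a b where ab: "a \<in> mats E m p" "b \<in> mats F p n" "u = tmult a b" "mnorm E a \<le> sqrt c" "mnorm F b \<le> sqrt c"
    using assms(1) by (auto simp: factors_def)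
  obtain q a' b' where ab': "a' \<in> mats E m q" "b' \<in> mats F q n" "v = tmult a' b'" "mnorm E a' \<le> sqrt d" "mnorm F b' \<le> sqrt d"
    using assms(2) by (auto simp: factors_def)
  have cd: "0 < c" "0 < d" using assms by (auto simp: factors_def)
  then have "sqrt ((sqrt c)\<^sup>2 + (sqrt d)\<^sup>2) = sqrt (c + d)" by simp
  moreover have "mnorm E (row_block a a') \<le> sqrt ((sqrt c)\<^sup>2 + (sqrt d)\<^sup>2)"
    using cd by (intro mnorm_row_block[OF op_E ab(1) ab'(1) _ _ ab(4) ab'(4)]) auto
  moreover have "mnorm F (col_block b b') \<le> sqrt ((sqrt c)\<^sup>2 + (sqrt d)\<^sup>2)"
    using cd by (intro mnorm_col_block[OF op_F ab(2) ab'(2) _ _ ab(5) ab'(5)]) auto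
  moreover have "mat_add T u v = tmult (row_block a a') (col_block b b')"
    unfolding times_blocks[OF ab(1,2) ab'(1,2)] ab(3) ab'(3) ..
  ultimately show ?thesis
    unfolding factors_def using cd row_block_mats[OF ab(1) ab'(1)] col_block_mats[OF ab(2) ab'(2)]
    by (metis add_pos_pos)
qed

lemma factors_place:
  assumes "factors 1 1 (mat 1 1 (\<lambda>_. t)) c"
  shows "factors m n (place m n i j t) c"
proof -
  obtain p a b where ab: "a \<in> mats E 1 p" "b \<in> mats F p 1" "mat 1 1 (\<lambda>_. t) = tmult a b"
    "mnorm E a \<le> sqrt c" "mnorm F b \<le> sqrt c" and c: "0 < c"
    using assms by (auto simp: factors_def)
  have "tmult a b $$ (0, 0) = t" by (simp flip: ab(3))
  then have "place m n i j t = tmult (place_row E m i a) (place_col F n j b)"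
    using times_place[OF ab(1,2)] by simp
  then show ?thesis
    unfolding factors_def
    using c mnorm_place_row[OF op_E ab(1), of m i] mnorm_place_col[OF op_F ab(2), of n j] ab(4,5)
    by (meson order_trans)
qed

lemma times_1x1:
  assumes "x \<in> carrier E" "y \<in> carrier F"
  shows "mat 1 1 (\<lambda>_. x) \<in> mats E 1 1" "mat 1 1 (\<lambda>_. y) \<in> mats F 1 1"
    and "mat 1 1 (\<lambda>_. el x y) = tmult (mat 1 1 (\<lambda>_. x)) (mat 1 1 (\<lambda>_. y))"
proof -
  interpret T: abelian_group T by (rule abelian_T)
  show "mat 1 1 (\<lambda>_. x) \<in> mats E 1 1" "mat 1 1 (\<lambda>_. y) \<in> mats F 1 1"
    using assms by (auto simp: mats_def)
  show "mat 1 1 (\<lambda>_. el x y) = tmult (mat 1 1 (\<lambda>_. x)) (mat 1 1 (\<lambda>_. y))"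
    using assms by (intro eq_matI) (auto simp: tensor_mat_mult_def lessThan_Suc el_closed)
qed

text \<open>
  The zero matrix is an empty sum of products, with inner dimension 0 and factors of norm 0.
\<close>

lemma factors_zero:
  assumes "0 < c"
  shows "factors m n (mat_zero T m n) c"
proof -
  interpret T: abelian_group T by (rule abelian_T)
  have E0: "mat_zero E m 0 \<in> mats E m 0" and F0: "mat_zero F 0 n \<in> mats F 0 n"
    by (auto simp: mats_def mat_zero_def)
  have "mat_zero T m n = tmult (mat_zero E m 0) (mat_zero F 0 n)"
    by (intro eq_matI) (auto simp: tensor_mat_mult_def mat_zero_def)
  moreover have "mnorm E (mat_zero E m 0) = 0"
    using operator_space.mnorm_eq_0[OF op_E E0] by simp
  ultimately show ?thesis using factors_times[OF E0 F0, of c] assms by simp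
qed

lemma factors_1x1:
  assumes "t \<in> carrier T"
  shows "\<exists>c. factors 1 1 (mat 1 1 (\<lambda>_. t)) c"
  using assms
proof (induction rule: alg_tensor_induct[consumes 1, case_names elem zero add])
  case (elem x y)
  note xy = times_1x1[OF elem]
  show ?case
    unfolding xy(3) by (rule exI, rule factors_times[OF xy(1,2) less_add_one])
next
  case zero
  have "mat 1 1 (\<lambda>_. \<zero>\<^bsub>T\<^esub>) = mat_zero T 1 1" by (simp add: mat_zero_def)
  then show ?case using factors_zero[of 1 1 1] by auto
next
  case (add t u)
  have "mat 1 1 (\<lambda>_. t \<oplus>\<^bsub>T\<^esub> u) = mat_add T (mat 1 1 (\<lambda>_. t)) (mat 1 1 (\<lambda>_. u))"
    by (rule eq_matI) (auto simp: mat_add_def)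
  then show ?case using add.IH factors_add by metis
qed

lemma factors_entries:
  assumes u: "u \<in> mats T m n" and e: "0 < e"
    and c: "\<And>i j. i < m \<Longrightarrow> j < n \<Longrightarrow> factors 1 1 (mat 1 1 (\<lambda>_. u $$ (i, j))) (c (i, j))"
  shows "factors m n u (e + (\<Sum>i<m. \<Sum>j<n. c (i, j)))"
proof -
  interpret T: abelian_group T by (rule abelian_T)
  define r where "r S = mat m n (\<lambda>ij. if ij \<in> S then u $$ ij else \<zero>\<^bsub>T\<^esub>)" for S
  have "factors m n (r S) (e + sum c S)" if "finite S" "S \<subseteq> {..<m} \<times> {..<n}" for S
    using that
  proof (induction S)
    case empty
    then show ?case using factors_zero[OF e] by (simp add: r_def mat_zero_def)
  next
    case (insert ij S)
    obtain i j where ij: "ij = (i, j)" "i < m" "j < n" using insert.prems by auto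
    have "r (insert ij S) = mat_add T (r S) (place m n i j (u $$ (i, j)))"
      using mats_dims[OF u] mats_index[OF u] insert.hyps ij
      by (intro eq_matI) (auto simp: r_def mat_add_def place_def)
    moreover have "factors m n (mat_add T (r S) (place m n i j (u $$ (i, j)))) ((e + sum c S) + c ij)"
      unfolding ij(1) using insert by (intro factors_add factors_place c ij(2,3)) auto
    moreover have "(e + sum c S) + c ij = e + sum c (insert ij S)"
      using insert.hyps by simp
    ultimately show ?case by simp
  qed
  moreover have "r ({..<m} \<times> {..<n}) = u"
    using mats_dims[OF u] by (intro eq_matI) (auto simp: r_def)
  ultimately show ?thesis
    by (metis finite_SigmaI finite_lessThan order_refl sum.cartesian_product case_prod_eta)
qed

lemma H_simps [simp]:
  "carrier H = carrier T" "zero H = zero T" "add H = add T" "smult H = smult T" "mats H = mats T"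
  "mat_add H = mat_add T" "mat_smult H = mat_smult T" "linear_map H W = linear_map T W"
  by (simp_all add: haagerup_alg_def)

lemma module_H: "module complex_vs H"
  by (simp add: haagerup_alg_def module_T)

lemma mnorm_H:
  assumes "u \<in> mats T m n"
  shows "mnorm H u = Inf {mnorm E a * mnorm F b | a b p. a \<in> mats E m p \<and> b \<in> mats F p n \<and> u = tmult a b}"
  using mats_dims[OF assms] by (simp add: haagerup_alg_def)

lemma mnorm_H_le:
  assumes "a \<in> mats E m p" "b \<in> mats F p n"
  shows "mnorm H (tmult a b) \<le> mnorm E a * mnorm F b"
  unfolding mnorm_H[OF times_mats[OF assms]]
  by (rule cInf_lower)
    (use assms in \<open>auto intro!: bdd_belowI[of _ 0] mult_nonneg_nonneg mnorm_E_nonneg mnorm_F_nonneg\<close>)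

lemma factorsE:
  assumes "factors m n u c"
  obtains p a b where "a \<in> mats E m p" "b \<in> mats F p n" "u = tmult a b" "mnorm E a * mnorm F b \<le> c"
proof -
  obtain p a b where ab: "a \<in> mats E m p" "b \<in> mats F p n" "u = tmult a b"
    and le: "mnorm E a \<le> sqrt c" "mnorm F b \<le> sqrt c" and c: "0 < c"
    using assms by (auto simp: factors_def)
  have "mnorm E a * mnorm F b \<le> sqrt c * sqrt c"
    using le c by (intro mult_mono mnorm_F_nonneg[OF ab(2)]) auto
  then show thesis using that[OF ab] c by simp
qed

lemma mnorm_H_le_factors:
  assumes "factors m n u c"
  shows "mnorm H u \<le> c"
proof -
  obtain p a b where ab: "a \<in> mats E m p" "b \<in> mats F p n" "u = tmult a b" "mnorm E a * mnorm F b \<le> c"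
    using assms by (rule factorsE)
  then show ?thesis using mnorm_H_le[OF ab(1,2)] by simp
qed

text \<open>
  The infimum that defines the Haagerup norm is not over the empty set: one entry is a finite sum of
  elementary tensors, and a matrix is the sum of its entries, each placed in a zero matrix.
\<close>

lemma times_exists:
  assumes "u \<in> mats T m n"
  shows "{mnorm E a * mnorm F b | a b p. a \<in> mats E m p \<and> b \<in> mats F p n \<and> u = tmult a b} \<noteq> {}"
proof -
  have "\<forall>ij. \<exists>c. fst ij < m \<longrightarrow> snd ij < n \<longrightarrow> factors 1 1 (mat 1 1 (\<lambda>_. u $$ ij)) c"
    using factors_1x1[OF mats_index[OF assms]] by simp
  then obtain c where "\<And>i j. i < m \<Longrightarrow> j < n \<Longrightarrow> factors 1 1 (mat 1 1 (\<lambda>_. u $$ (i, j))) (c (i, j))"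
    unfolding choice_iff by auto
  then have "factors m n u (1 + (\<Sum>i<m. \<Sum>j<n. c (i, j)))"
    by (intro factors_entries[OF assms]) auto
  then show ?thesis by (rule factorsE) blast
qed

lemma factors_of_less:
  assumes "u \<in> mats T m n" "mnorm H u < c"
  shows "factors m n u c"
  using cInf_lessD[OF times_exists[OF assms(1)], of c] assms(2) factors_times unfolding mnorm_H[OF assms(1)] by blast

lemma mnorm_H_nonneg:
  assumes "u \<in> mats T m n"
  shows "0 \<le> mnorm H u"
  unfolding mnorm_H[OF assms]
  by (rule cInf_greatest[OF times_exists[OF assms]])
    (auto intro!: mult_nonneg_nonneg mnorm_E_nonneg mnorm_F_nonneg)

lemma matrix_seminormed_H: "matrix_seminormed H"
proof (intro matrix_seminormed.intro module_H matrix_seminormed_axioms.intro)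
  fix u m n assume "u \<in> mats H m n"
  then have u: "u \<in> mats T m n" by simp
  show "0 \<le> mnorm H u" by (rule mnorm_H_nonneg[OF u])
  show "mnorm H (mat_smult H c u) \<le> cmod c * mnorm H u" for c
  proof (rule field_le_epsilon)
    fix e :: real assume e: "0 < e"
    have "0 < e / (cmod c + 1)" using e by (simp add: add_nonneg_pos)
    then have "factors m n u (mnorm H u + e / (cmod c + 1))"
      by (intro factors_of_less u) simp
    then obtain p a b where ab: "a \<in> mats E m p" "b \<in> mats F p n" "u = tmult a b"
      and le: "mnorm E a * mnorm F b \<le> mnorm H u + e / (cmod c + 1)"
      by (rule factorsE)
    have one: "mat_smult F 1 b = b"
      using mats_dims[OF ab(2)] mats_index[OF ab(2)]
      by (intro eq_matI) (auto simp: mat_smult_def complex_module_rules[OF F])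
    have "mnorm H (mat_smult H c u) \<le> mnorm E (mat_smult E c a) * mnorm F b"
      using mnorm_H_le[OF mats_mat_smult[OF E ab(1)] ab(2), of c] times_smult[OF ab(1,2), of c 1] by (simp add: one ab(3))
    also have "\<dots> = cmod c * (mnorm E a * mnorm F b)"
      using operator_space.mnorm_smult[OF op_E ab(1)] by simp
    also have "\<dots> \<le> cmod c * (mnorm H u + e / (cmod c + 1))"
      using le by (intro mult_left_mono) auto
    also have "\<dots> \<le> cmod c * mnorm H u + e"
      using e by (intro scaled_slack) auto
    finally show "mnorm H (mat_smult H c u) \<le> cmod c * mnorm H u + e" .
  qed
  fix v assume "v \<in> mats H m n"
  then have v: "v \<in> mats T m n" by simp
  show "mnorm H (mat_add H u v) \<le> mnorm H u + mnorm H v"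
  proof (rule field_le_epsilon)
    fix e :: real assume e: "0 < e"
    have "factors m n (mat_add T u v) ((mnorm H u + e / 2) + (mnorm H v + e / 2))"
      using e by (intro factors_add factors_of_less u v) auto
    then show "mnorm H (mat_add H u v) \<le> mnorm H u + mnorm H v + e"
      using mnorm_H_le_factors by fastforce
  qed
qed

text \<open>
  Each of the \<open>mn\<close> entries is factored with slack \<open>d\<close>, and the zero matrix to which they are added takes
  another \<open>d\<close>; hence the total slack \<open>(mn + 1) d = e\<close>.
\<close>

lemma entrywise_seminormed_H: "entrywise_seminormed H"
proof (rule entrywise_seminormed.intro[OF matrix_seminormed_H entrywise_seminormed_axioms.intro])
  fix u m n assume "u \<in> mats H m n"
  then have u: "u \<in> mats T m n" by simp
  show "mnorm H u \<le> (\<Sum>i<m. \<Sum>j<n. vnorm H (u $$ (i, j)))"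
  proof (rule field_le_epsilon)
    fix e :: real assume e: "0 < e"
    define d where "d = e / (real m * real n + 1)"
    have N: "0 < real m * real n + 1" by (simp add: add_nonneg_pos)
    have d: "0 < d" unfolding d_def by (rule divide_pos_pos[OF e N])
    have "factors 1 1 (mat 1 1 (\<lambda>_. u $$ (i, j))) (vnorm H (u $$ (i, j)) + d)" if "i < m" "j < n" for i j
      using mats_index[OF u that] d by (intro factors_of_less) (auto simp: mats_def vnorm_def)
    then have "factors m n u (d + (\<Sum>i<m. \<Sum>j<n. vnorm H (u $$ (i, j)) + d))"
      using factors_entries[OF u d, of "\<lambda>ij. vnorm H (u $$ ij) + d"] by simp
    moreover have "d + (\<Sum>i<m. \<Sum>j<n. vnorm H (u $$ (i, j)) + d)
        = (\<Sum>i<m. \<Sum>j<n. vnorm H (u $$ (i, j))) + (real m * real n + 1) * d"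
      by (simp add: sum.distrib algebra_simps)
    moreover have "(real m * real n + 1) * d = e"
      using N unfolding d_def times_divide_eq_right by (intro nonzero_mult_div_cancel_left) simp
    ultimately show "mnorm H u \<le> (\<Sum>i<m. \<Sum>j<n. vnorm H (u $$ (i, j))) + e"
      using mnorm_H_le_factors by metis
  qed
qed

lemma vnorm_el_le:
  assumes "x \<in> carrier E" "y \<in> carrier F"
  shows "vnorm H (el x y) \<le> vnorm E x * vnorm F y"
  unfolding vnorm_def times_1x1(3)[OF assms] by (rule mnorm_H_le[OF times_1x1(1,2)[OF assms]])

lemma functional_times:
  assumes "linear_map T complex_vs g" "a \<in> mats E m p" "b \<in> mats F p n" "i < m" "j < n"
  shows "g (tmult a b $$ (i, j)) = (\<Sum>k<p. g (el (a $$ (i, k)) (b $$ (k, j))))"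
  unfolding times_index[OF assms(2-5)]
  by (rule linear_functional_finsum[OF module_T assms(1) _ times_terms[OF assms(2-5)]]) simp

end

section \<open>Square functions on \<open>\<ell>\<^sup>1\<close> and multipliers\<close>

text \<open>
  By the parallelogram law the squared norms of \<open>s + w\<^sub>j\<close> and \<open>s - w\<^sub>j\<close> have the mean
  \<open>\<parallel>s\<parallel>\<^sup>2 + \<parallel>w\<^sub>j\<parallel>\<^sup>2\<close>, so one choice of the next sign reaches at least this value.
\<close>

lemma exists_signs:
  fixes w :: "'i \<Rightarrow> nat \<Rightarrow> complex"
  assumes "finite F"
  shows "\<exists>\<epsilon>. (\<forall>i. cmod (\<epsilon> i) = 1) \<and> (\<Sum>i\<in>F. (l2 p (w i))\<^sup>2) \<le> (l2 p (\<lambda>k. \<Sum>i\<in>F. \<epsilon> i * w i k))\<^sup>2"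
  using assms
proof (induction F)
  case empty
  show ?case by (intro exI[of _ "\<lambda>_. 1"]) simp
next
  case (insert j F)
  then obtain \<epsilon> where one: "\<And>i. cmod (\<epsilon> i) = 1"
    and le: "(\<Sum>i\<in>F. (l2 p (w i))\<^sup>2) \<le> (l2 p (\<lambda>k. \<Sum>i\<in>F. \<epsilon> i * w i k))\<^sup>2" by blast
  define s where "s = (\<lambda>k. \<Sum>i\<in>F. \<epsilon> i * w i k)"
  have le': "(\<Sum>i\<in>F. (l2 p (w i))\<^sup>2) \<le> (l2 p s)\<^sup>2" using le by (simp add: s_def)
  have "(cmod (a + b))\<^sup>2 + (cmod (a - b))\<^sup>2 = 2 * (cmod a)\<^sup>2 + 2 * (cmod b)\<^sup>2" for a b
    unfolding cmod_power2 by (simp add: power2_eq_square algebra_simps)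
  then have "(l2 p (\<lambda>k. s k + w j k))\<^sup>2 + (l2 p (\<lambda>k. s k - w j k))\<^sup>2 = 2 * ((l2 p s)\<^sup>2 + (l2 p (w j))\<^sup>2)"
    by (simp only: l2_square sum.distrib[symmetric] sum_distrib_left distrib_left)
  then have "(l2 p s)\<^sup>2 + (l2 p (w j))\<^sup>2 \<le> (l2 p (\<lambda>k. s k + w j k))\<^sup>2 \<or>
      (l2 p s)\<^sup>2 + (l2 p (w j))\<^sup>2 \<le> (l2 p (\<lambda>k. s k - w j k))\<^sup>2"
    by (smt (verit))
  then obtain \<delta> :: complex where d: "cmod \<delta> = 1"
    and dle: "(l2 p s)\<^sup>2 + (l2 p (w j))\<^sup>2 \<le> (l2 p (\<lambda>k. s k + \<delta> * w j k))\<^sup>2"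
    using that[of 1] that[of "-1"] by auto
  show ?case
  proof (intro exI[of _ "\<epsilon>(j := \<delta>)"] conjI)
    show "\<forall>i. cmod ((\<epsilon>(j := \<delta>)) i) = 1" using one d by simp
    have "(\<Sum>i\<in>F. (\<epsilon>(j := \<delta>)) i * w i k) = s k" for k
      unfolding s_def using insert.hyps by (intro sum.cong) auto
    then show "(\<Sum>i\<in>insert j F. (l2 p (w i))\<^sup>2) \<le> (l2 p (\<lambda>k. \<Sum>i\<in>insert j F. (\<epsilon>(j := \<delta>)) i * w i k))\<^sup>2"
      using le' dle insert.hyps by (simp add: add.commute)
  qed
qed

lemma has_sum_finite_sum:
  fixes f :: "'b \<Rightarrow> 'i \<Rightarrow> complex"
  assumes "finite B" "\<And>b. b \<in> B \<Longrightarrow> (f b has_sum s b) A"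
  shows "((\<lambda>i. \<Sum>b\<in>B. f b i) has_sum (\<Sum>b\<in>B. s b)) A"
  using assms by (induction B) (auto intro: has_sum_add)

lemma has_sum_norm_le:
  fixes f :: "'i \<Rightarrow> complex"
  assumes "(f has_sum s) A" "\<And>F. finite F \<Longrightarrow> F \<subseteq> A \<Longrightarrow> cmod (sum f F) \<le> C"
  shows "cmod s \<le> C"
proof (rule tendsto_upperbound)
  show "((\<lambda>F. cmod (sum f F)) \<longlongrightarrow> cmod s) (finite_subsets_at_top A)"
    using assms(1) unfolding has_sum_def by (rule tendsto_norm)
  show "\<forall>\<^sub>F F in finite_subsets_at_top A. cmod (sum f F) \<le> C"
    using assms(2) by (rule eventually_finite_subsets_at_top_weakI)
qed simp

lemma block_less:
  fixes P r N p :: nat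
  assumes "P < p" "r < N"
  shows "P * N + r < p * N"
proof -
  have "P * N + r < Suc P * N" using assms(2) by simp
  also have "\<dots> \<le> p * N" using assms(1) by (intro mult_le_mono1) simp
  finally show ?thesis .
qed

lemma sum_blocks: "(\<Sum>R<p * N. f R) = (\<Sum>P<p. \<Sum>r<N. f (P * N + r))" for N :: nat
proof -
  have "sum f {P * N..<P * N + N} = (\<Sum>r<N. f (P * N + r))" for P
    using sum.shift_bounds_nat_ivl[of f 0 "P * N" N]
    by (simp add: lessThan_atLeast0 add.commute)
  then show ?thesis
    by (simp only: sum.nat_group[symmetric])
qed

locale ol1_space =
  fixes I :: "'i set" and \<mu> :: "('i \<Rightarrow> complex) mat \<Rightarrow> real"
  assumes op_A: "operator_space (ol1 I \<mu>)"
    and vnorm_A: "\<And>f. f \<in> carrier (ol1 I \<mu>) \<Longrightarrow> vnorm (ol1 I \<mu>) f = l1_norm I f"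
begin

abbreviation A :: "('i \<Rightarrow> complex) opspace" where "A \<equiv> ol1 I \<mu>"

sublocale haagerup_pair A A by (rule haagerup_pair.intro[OF op_A op_A])

lemma A_simps [simp]:
  "zero A = (\<lambda>_. 0)" "add A = (\<lambda>f g i. f i + g i)" "smult A = (\<lambda>c f i. c * f i)"
  "monoid.mult A f g = (\<lambda>i. f i * g i)"
  by (simp_all add: ol1_def l1_def pointwise_vs_def)

lemma carrier_A_iff: "f \<in> carrier A \<longleftrightarrow> (\<forall>i. i \<notin> I \<longrightarrow> f i = 0) \<and> (\<lambda>i. cmod (f i)) summable_on I"
  by (simp add: ol1_def l1_def pointwise_vs_def)

lemma sum_le_l1_norm:
  assumes "f \<in> carrier A" "finite F" "F \<subseteq> I"
  shows "(\<Sum>i\<in>F. cmod (f i)) \<le> l1_norm I f"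
  unfolding l1_norm_def using assms by (intro finite_sum_le_infsum) (auto simp: carrier_A_iff)

lemma sign_functional:
  assumes F: "finite F" "F \<subseteq> I" and one: "\<And>i. cmod (\<epsilon> i) = 1"
  defines "h \<equiv> \<lambda>f. \<Sum>i\<in>F. \<epsilon> i * f i"
  shows "linear_map A complex_vs h" and "\<And>f. f \<in> carrier A \<Longrightarrow> cmod (h f) \<le> vnorm A f"
proof -
  show "linear_map A complex_vs h"
    by (rule linear_mapI) (auto simp: h_def distrib_left sum.distrib sum_distrib_left mult_ac)
  fix f assume f: "f \<in> carrier A"
  have "cmod (h f) \<le> (\<Sum>i\<in>F. cmod (f i))"
    unfolding h_def by (rule order_trans[OF norm_sum]) (simp add: norm_mult one)
  then show "cmod (h f) \<le> vnorm A f" using sum_le_l1_norm[OF f F] vnorm_A[OF f] by simp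
qed

text \<open>
  Both square functions are bounded by evaluating the contractive functional \<open>f \<mapsto> \<Sum>\<^sub>i \<epsilon>\<^sub>i f(i)\<close> with well chosen
  signs.
\<close>

lemma square_function_col:
  assumes a: "a \<in> mats A m n" and F: "finite F" "F \<subseteq> I"
  shows "(\<Sum>i\<in>F. (l2 m (\<lambda>k. \<Sum>l<n. (a $$ (k, l)) i * x l))\<^sup>2) \<le> (mnorm A a * l2 n x)\<^sup>2"
proof -
  obtain \<epsilon> :: "'i \<Rightarrow> complex" where one: "\<And>i. cmod (\<epsilon> i) = 1"
    and le: "(\<Sum>i\<in>F. (l2 m (\<lambda>k. \<Sum>l<n. (a $$ (k, l)) i * x l))\<^sup>2)
      \<le> (l2 m (\<lambda>k. \<Sum>i\<in>F. \<epsilon> i * (\<Sum>l<n. (a $$ (k, l)) i * x l)))\<^sup>2"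
    using exists_signs[OF F(1), where p = m and w = "\<lambda>i k. \<Sum>l<n. (a $$ (k, l)) i * x l"] by blast
  define h where "h f = (\<Sum>i\<in>F. \<epsilon> i * f i)" for f
  note h = sign_functional[OF F, of \<epsilon>, folded h_def, OF one]
  have swap: "(\<Sum>i\<in>F. \<epsilon> i * (\<Sum>l<n. (a $$ (k, l)) i * x l)) = (\<Sum>l<n. h (a $$ (k, l)) * x l)" for k
    unfolding h_def sum_distrib_left sum_distrib_right by (subst sum.swap) (simp add: mult.assoc)
  have "l2 m (\<lambda>k. \<Sum>l<n. h (a $$ (k, l)) * x l) \<le> mnorm A a * l2 n x"
  proof (rule l2_le_of_linear_form)
    show "0 \<le> mnorm A a * l2 n x"
      using mnorm_E_nonneg[OF a] by (simp add: L2_set_nonneg)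
    show "cmod (\<Sum>k<m. y k * (\<Sum>l<n. h (a $$ (k, l)) * x l)) \<le> mnorm A a * l2 n x * l2 m y" for y
      using functional_bilinear_bound[OF op_A h a, of y x] by (simp add: sum_distrib_left mult_ac)
  qed
  then show ?thesis
    by (intro order_trans[OF le[unfolded swap]] power_mono L2_set_nonneg)
qed

lemma square_function_row:
  assumes a: "a \<in> mats A m n" and F: "finite F" "F \<subseteq> I"
  shows "(\<Sum>i\<in>F. (l2 n (\<lambda>l. \<Sum>k<m. y k * (a $$ (k, l)) i))\<^sup>2) \<le> (mnorm A a * l2 m y)\<^sup>2"
proof -
  obtain \<epsilon> :: "'i \<Rightarrow> complex" where one: "\<And>i. cmod (\<epsilon> i) = 1"
    and le: "(\<Sum>i\<in>F. (l2 n (\<lambda>l. \<Sum>k<m. y k * (a $$ (k, l)) i))\<^sup>2)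
      \<le> (l2 n (\<lambda>l. \<Sum>i\<in>F. \<epsilon> i * (\<Sum>k<m. y k * (a $$ (k, l)) i)))\<^sup>2"
    using exists_signs[OF F(1), where p = n and w = "\<lambda>i l. \<Sum>k<m. y k * (a $$ (k, l)) i"] by blast
  define h where "h f = (\<Sum>i\<in>F. \<epsilon> i * f i)" for f
  note h = sign_functional[OF F, of \<epsilon>, folded h_def, OF one]
  have swap: "(\<Sum>i\<in>F. \<epsilon> i * (\<Sum>k<m. y k * (a $$ (k, l)) i)) = (\<Sum>k<m. y k * h (a $$ (k, l)))" for l
    unfolding h_def sum_distrib_left by (subst sum.swap) (simp add: mult_ac)
  have "l2 n (\<lambda>l. \<Sum>k<m. y k * h (a $$ (k, l))) \<le> mnorm A a * l2 m y"
  proof (rule l2_le_of_linear_form)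
    show "0 \<le> mnorm A a * l2 m y"
      using mnorm_E_nonneg[OF a] by (simp add: L2_set_nonneg)
    have "(\<Sum>l<n. x l * (\<Sum>k<m. y k * h (a $$ (k, l)))) = (\<Sum>k<m. \<Sum>l<n. y k * h (a $$ (k, l)) * x l)" for x
      unfolding sum_distrib_left by (subst sum.swap) (simp add: mult_ac)
    then show "cmod (\<Sum>l<n. x l * (\<Sum>k<m. y k * h (a $$ (k, l)))) \<le> mnorm A a * l2 m y * l2 n x" for x
      using functional_bilinear_bound[OF op_A h a, of y x] by simp
  qed
  then show ?thesis
    by (intro order_trans[OF le[unfolded swap]] power_mono L2_set_nonneg)
qed

text \<open>
  At the product of \<open>a\<close> and \<open>b\<close>, the bilinear form of the multiplier is a sum over
  \<open>i\<close> and over the inner index \<open>k\<close> of the forms of \<open>P i\<close>; these cost at most \<open>K\<close>, and by the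
  Cauchy-Schwarz inequality what remains is one square function of \<open>a\<close> and one of \<open>b\<close>.
\<close>

context
  fixes P :: "'i \<Rightarrow> complex mat" and G and K :: real and N :: nat
  assumes K: "0 \<le> K" and dims: "\<And>i. P i \<in> carrier_mat N N" "G \<in> carrier_mat N N"
    and P: "\<And>i. i \<in> I \<Longrightarrow> op_norm (P i) \<le> K"
    and G_lin: "\<And>r s. r < N \<Longrightarrow> s < N \<Longrightarrow> linear_map T complex_vs (G $$ (r, s))"
    and G: "\<And>r s f g. r < N \<Longrightarrow> s < N \<Longrightarrow> f \<in> carrier A \<Longrightarrow> g \<in> carrier A \<Longrightarrow>
      ((\<lambda>i. P i $$ (r, s) * (f i * g i)) has_sum (G $$ (r, s)) (el f g)) I"
begin

lemma multiplier_bound_product: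
  assumes a: "a \<in> mats A p t" and b: "b \<in> mats A t q"
  shows "op_norm (amplify G (tmult a b)) \<le> K * (mnorm A a * mnorm A b)"
proof (rule op_norm_leI)
  note na = mnorm_E_nonneg[OF a] and nb = mnorm_E_nonneg[OF b]
  note ad = mats_dims[OF a] and bd = mats_dims[OF b]
  have Gd: "dim_row G = N" "dim_col G = N" using dims(2) by auto
  show "0 \<le> K * (mnorm A a * mnorm A b)" using K na nb by simp
  (* Rows and columns of the amplification are numbered Pp * N + r and Qq * N + s, with r, s indexing P i
     and Pp, Qq indexing the product; x i k and y i k contract the outer indices with the test vectors. *)
  fix Y X
  define x where "x i k r = (\<Sum>Pp<p. Y (Pp * N + r) * (a $$ (Pp, k)) i)" for i k r
  define y where "y i k s = (\<Sum>Qq<q. (b $$ (k, Qq)) i * X (Qq * N + s))" for i k s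
  define tm where "tm i = (\<Sum>k<t. bilin (P i) (x i k) (y i k))" for i
  let ?e = "\<lambda>i Pp r Qq s k. Y (Pp * N + r) * (P i $$ (r, s) * ((a $$ (Pp, k)) i * (b $$ (k, Qq)) i)) * X (Qq * N + s)"
    and ?g = "\<lambda>Pp r Qq s k. Y (Pp * N + r) * (G $$ (r, s)) (el (a $$ (Pp, k)) (b $$ (k, Qq))) * X (Qq * N + s)"
  have "(tm has_sum bilin (amplify G (tmult a b)) Y X) I"
  proof -
    have "((\<lambda>i. \<Sum>Pp<p. \<Sum>r<N. \<Sum>Qq<q. \<Sum>s<N. \<Sum>k<t. ?e i Pp r Qq s k)
        has_sum (\<Sum>Pp<p. \<Sum>r<N. \<Sum>Qq<q. \<Sum>s<N. \<Sum>k<t. ?g Pp r Qq s k)) I"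
      by (intro has_sum_finite_sum has_sum_cmult_left has_sum_cmult_right G finite_lessThan)
        (use mats_index[OF a] mats_index[OF b] in auto)
    also have "(\<lambda>i. \<Sum>Pp<p. \<Sum>r<N. \<Sum>Qq<q. \<Sum>s<N. \<Sum>k<t. ?e i Pp r Qq s k) = tm"
    proof
      fix i
      have Pd: "dim_row (P i) = N" "dim_col (P i) = N" using dims(1)[of i] by auto
      have "tm i = (\<Sum>k<t. \<Sum>r<N. \<Sum>s<N. \<Sum>Pp<p. \<Sum>Qq<q. ?e i Pp r Qq s k)"
        unfolding tm_def bilin_def Pd x_def y_def
        by (simp add: sum_distrib_left sum_distrib_right mult_ac)
      also have "\<dots> = (\<Sum>r<N. \<Sum>s<N. \<Sum>Pp<p. \<Sum>Qq<q. \<Sum>k<t. ?e i Pp r Qq s k)"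
        by (simp only: sum.swap[of _ _ "{..<t}"])
      also have "\<dots> = (\<Sum>r<N. \<Sum>Pp<p. \<Sum>s<N. \<Sum>Qq<q. \<Sum>k<t. ?e i Pp r Qq s k)"
        by (rule sum.cong[OF refl], rule sum.swap)
      also have "\<dots> = (\<Sum>Pp<p. \<Sum>r<N. \<Sum>s<N. \<Sum>Qq<q. \<Sum>k<t. ?e i Pp r Qq s k)"
        by (rule sum.swap)
      also have "\<dots> = (\<Sum>Pp<p. \<Sum>r<N. \<Sum>Qq<q. \<Sum>s<N. \<Sum>k<t. ?e i Pp r Qq s k)"
        by (rule sum.cong[OF refl], rule sum.cong[OF refl], rule sum.swap)
      finally show "(\<Sum>Pp<p. \<Sum>r<N. \<Sum>Qq<q. \<Sum>s<N. \<Sum>k<t. ?e i Pp r Qq s k) = tm i" ..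
    qed
    also have "(\<Sum>Pp<p. \<Sum>r<N. \<Sum>Qq<q. \<Sum>s<N. \<Sum>k<t. ?g Pp r Qq s k)
        = bilin (amplify G (tmult a b)) Y X"
    proof -
      have entry: "amplify G (tmult a b) $$ (Pp * N + r, Qq * N + s)
          = (\<Sum>k<t. (G $$ (r, s)) (el (a $$ (Pp, k)) (b $$ (k, Qq))))"
        if "Pp < p" "r < N" "Qq < q" "s < N" for Pp r Qq s
      proof -
        have "Pp * N + r < p * N" "Qq * N + s < q * N"
          using that by (auto intro: block_less)
        then show ?thesis
          using that ad bd functional_times[OF G_lin[OF that(2,4)] a b that(1,3)]
          by (simp add: amplify_index Gd)
      qed
      have "bilin (amplify G (tmult a b)) Y X = (\<Sum>Pp<p. \<Sum>r<N. \<Sum>Qq<q. \<Sum>s<N.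
          Y (Pp * N + r) * amplify G (tmult a b) $$ (Pp * N + r, Qq * N + s) * X (Qq * N + s))"
        by (simp add: bilin_def Gd ad bd sum_blocks)
      also have "\<dots> = (\<Sum>Pp<p. \<Sum>r<N. \<Sum>Qq<q. \<Sum>s<N. \<Sum>k<t. ?g Pp r Qq s k)"
        by (intro sum.cong refl) (simp add: entry sum_distrib_left sum_distrib_right)
      finally show ?thesis ..
    qed
    finally show ?thesis .
  qed
  then show "cmod (bilin (amplify G (tmult a b)) Y X)
      \<le> K * (mnorm A a * mnorm A b) * l2 (dim_row (amplify G (tmult a b))) Y * l2 (dim_col (amplify G (tmult a b))) X"
  proof (rule has_sum_norm_le)
    fix F assume F: "finite F" "F \<subseteq> I"
    have sq_x: "(\<Sum>i\<in>F. \<Sum>k<t. (l2 N (x i k))\<^sup>2) \<le> (mnorm A a * l2 (p * N) Y)\<^sup>2"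
    proof -
      have "(\<Sum>i\<in>F. \<Sum>k<t. (l2 N (x i k))\<^sup>2) = (\<Sum>r<N. \<Sum>i\<in>F. (l2 t (\<lambda>k. x i k r))\<^sup>2)"
        by (simp only: l2_square sum.swap[of _ "{..<N}"])
      also have "\<dots> \<le> (\<Sum>r<N. (mnorm A a * l2 p (\<lambda>j. Y (j * N + r)))\<^sup>2)"
        unfolding x_def by (intro sum_mono square_function_row[OF a F])
      also have "\<dots> = (mnorm A a * l2 (p * N) Y)\<^sup>2"
        unfolding power_mult_distrib l2_square sum_blocks sum_distrib_left[symmetric] by (simp only: sum.swap[of _ "{..<N}"])
      finally show ?thesis .
    qed
    have sq_y: "(\<Sum>i\<in>F. \<Sum>k<t. (l2 N (y i k))\<^sup>2) \<le> (mnorm A b * l2 (q * N) X)\<^sup>2"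
    proof -
      have "(\<Sum>i\<in>F. \<Sum>k<t. (l2 N (y i k))\<^sup>2) = (\<Sum>r<N. \<Sum>i\<in>F. (l2 t (\<lambda>k. y i k r))\<^sup>2)"
        by (simp only: l2_square sum.swap[of _ "{..<N}"])
      also have "\<dots> \<le> (\<Sum>r<N. (mnorm A b * l2 q (\<lambda>j. X (j * N + r)))\<^sup>2)"
        unfolding y_def by (intro sum_mono square_function_col[OF b F])
      also have "\<dots> = (mnorm A b * l2 (q * N) X)\<^sup>2"
        unfolding power_mult_distrib l2_square sum_blocks sum_distrib_left[symmetric] by (simp only: sum.swap[of _ "{..<N}"])
      finally show ?thesis .
    qed
    let ?S = "F \<times> {..<t}"
    let ?x = "\<lambda>(i, k). l2 N (x i k)" and ?y = "\<lambda>(i, k). l2 N (y i k)"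
    have "cmod (sum tm F) \<le> (\<Sum>i\<in>F. \<Sum>k<t. cmod (bilin (P i) (x i k) (y i k)))"
      unfolding tm_def by (intro order_trans[OF norm_sum] sum_mono norm_sum)
    also have "\<dots> \<le> (\<Sum>i\<in>F. \<Sum>k<t. K * (l2 N (x i k) * l2 N (y i k)))"
    proof (intro sum_mono)
      fix i k assume "i \<in> F"
      then have i: "i \<in> I" using F by auto
      have "cmod (bilin (P i) (x i k) (y i k)) \<le> op_norm (P i) * l2 N (x i k) * l2 N (y i k)"
        using bilin_le_op_norm[of "P i"] dims(1)[of i] by auto
      also have "\<dots> \<le> K * l2 N (x i k) * l2 N (y i k)"
        by (intro mult_right_mono P[OF i] L2_set_nonneg)
      finally show "cmod (bilin (P i) (x i k) (y i k)) \<le> K * (l2 N (x i k) * l2 N (y i k))"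
        by (simp add: mult.assoc)
    qed
    also have "\<dots> = K * (\<Sum>ik\<in>?S. \<bar>?x ik\<bar> * \<bar>?y ik\<bar>)"
      by (simp add: sum.cartesian_product[symmetric] sum_distrib_left L2_set_nonneg case_prod_unfold
          sum.cartesian_product' )
    also have "\<dots> \<le> K * (L2_set ?x ?S * L2_set ?y ?S)"
      by (intro mult_left_mono L2_set_mult_ineq K)
    also have "\<dots> \<le> K * ((mnorm A a * l2 (p * N) Y) * (mnorm A b * l2 (q * N) X))"
    proof (intro mult_left_mono mult_mono K)
      show "L2_set ?x ?S \<le> mnorm A a * l2 (p * N) Y"
        unfolding L2_set_def[of ?x] using sq_x na
        by (intro real_le_lsqrt) (auto simp: sum.cartesian_product[symmetric] case_prod_unfold sum.cartesian_product' sum_nonneg L2_set_nonneg)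
      show "L2_set ?y ?S \<le> mnorm A b * l2 (q * N) X"
        unfolding L2_set_def[of ?y] using sq_y nb
        by (intro real_le_lsqrt) (auto simp: sum.cartesian_product[symmetric] case_prod_unfold sum.cartesian_product' sum_nonneg L2_set_nonneg)
    qed (use na in \<open>auto simp: L2_set_nonneg\<close>)
    finally show "cmod (sum tm F)
        \<le> K * (mnorm A a * mnorm A b) * l2 (dim_row (amplify G (tmult a b))) Y * l2 (dim_col (amplify G (tmult a b))) X"
      by (simp add: Gd ad bd mult_ac)
  qed
qed

lemma multiplier_bound:
  assumes u: "u \<in> mats H p q"
  shows "op_norm (amplify G u) \<le> K * mnorm H u"
proof (rule field_le_epsilon)
  fix e :: real assume e: "0 < e"
  have "0 < e / (K + 1)" using e K by simp
  then have "factors p q u (mnorm H u + e / (K + 1))"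
    using u by (intro factors_of_less) auto
  then obtain t a b where ab: "a \<in> mats A p t" "b \<in> mats A t q" "u = tmult a b"
    and less: "mnorm A a * mnorm A b \<le> mnorm H u + e / (K + 1)"
    by (rule factorsE)
  have "op_norm (amplify G u) \<le> K * (mnorm A a * mnorm A b)"
    unfolding ab(3) by (rule multiplier_bound_product[OF ab(1,2)])
  also have "\<dots> \<le> K * (mnorm H u + e / (K + 1))"
    using less K by (intro mult_left_mono) auto
  also have "\<dots> \<le> K * mnorm H u + e"
    using K e by (rule scaled_slack)
  finally show "op_norm (amplify G u) \<le> K * mnorm H u + e" .
qed

end

end

section \<open>The minimal structure of \<open>\<ell>\<^sup>\<infinity>(I)\<close>\<close>

text \<open>The value 0 accounts for empty \<open>I\<close>.\<close>

definition sup_norm :: "'i set \<Rightarrow> ('i \<Rightarrow> complex) mat \<Rightarrow> real" where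
  "sup_norm I X = Sup (insert 0 ((\<lambda>i. op_norm (map_mat (\<lambda>f. f i) X)) ` I))"

lemma linf_simps [simp]:
  "zero (linf I) = (\<lambda>_. 0)" "add (linf I) = (\<lambda>f g i. f i + g i)" "smult (linf I) = (\<lambda>c f i. c * f i)"
  by (simp_all add: linf_def pointwise_vs_def)

lemma carrier_linf_iff:
  "f \<in> carrier (linf I) \<longleftrightarrow> (\<forall>i. i \<notin> I \<longrightarrow> f i = 0) \<and> bdd_above ((\<lambda>i. cmod (f i)) ` I)"
  by (simp add: linf_def pointwise_vs_def)

lemma linf_bound:
  assumes "f \<in> carrier (linf I)" "i \<in> I"
  shows "cmod (f i) \<le> linf_norm I f"
  unfolding linf_norm_def using assms by (intro cSup_upper) (auto simp: carrier_linf_iff)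

lemma linf_norm_leI:
  assumes "0 \<le> K" "\<And>i. i \<in> I \<Longrightarrow> cmod (f i) \<le> K"
  shows "linf_norm I f \<le> K"
  unfolding linf_norm_def using assms by (intro cSup_least) auto

lemma linf_norm_nonneg: "f \<in> carrier (linf I) \<Longrightarrow> 0 \<le> linf_norm I f"
  unfolding linf_norm_def by (intro cSup_upper) (auto simp: carrier_linf_iff)

lemma linf_carrierI:
  assumes "\<And>i. i \<notin> I \<Longrightarrow> f i = 0" "\<And>i. i \<in> I \<Longrightarrow> cmod (f i) \<le> K"
  shows "f \<in> carrier (linf I)"
  unfolding carrier_linf_iff using assms by (intro conjI allI impI bdd_aboveI2[of I _ K])

lemma linf_module: "module complex_vs (linf I)"
proof (rule complex_moduleI)
  fix f assume f: "f \<in> carrier (linf I)"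
  show "c \<odot>\<^bsub>linf I\<^esub> f \<in> carrier (linf I)" for c
    by (rule linf_carrierI[of _ _ "cmod c * linf_norm I f"])
      (use f linf_bound[OF f] in \<open>auto simp: carrier_linf_iff norm_mult mult_left_mono\<close>)
  fix g assume g: "g \<in> carrier (linf I)"
  show "f \<oplus>\<^bsub>linf I\<^esub> g \<in> carrier (linf I)"
    by (rule linf_carrierI[of _ _ "linf_norm I f + linf_norm I g"])
      (use f g linf_bound[OF f] linf_bound[OF g] in
        \<open>auto simp: carrier_linf_iff intro!: order_trans[OF norm_triangle_ineq] add_mono\<close>)
qed (auto simp: carrier_linf_iff algebra_simps)

lemma sup_norm_bdd:
  assumes X: "X \<in> mats (linf I) m n"
  shows "bdd_above ((\<lambda>i. op_norm (map_mat (\<lambda>f. f i) X)) ` I)"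
proof (rule bdd_aboveI2)
  fix i assume i: "i \<in> I"
  have "op_norm (map_mat (\<lambda>f. f i) X) \<le> (\<Sum>k<m. \<Sum>l<n. cmod ((X $$ (k, l)) i))"
    using op_norm_le_entries[of "map_mat (\<lambda>f. f i) X"] mats_dims[OF X] by simp
  also have "\<dots> \<le> (\<Sum>k<m. \<Sum>l<n. linf_norm I (X $$ (k, l)))"
    using mats_index[OF X] i by (intro sum_mono linf_bound) auto
  finally show "op_norm (map_mat (\<lambda>f. f i) X) \<le> (\<Sum>k<m. \<Sum>l<n. linf_norm I (X $$ (k, l)))" .
qed

lemma sup_norm_nonneg: "X \<in> mats (linf I) m n \<Longrightarrow> 0 \<le> sup_norm I X"
  unfolding sup_norm_def using sup_norm_bdd by (intro cSup_upper) auto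

lemma op_norm_le_sup_norm:
  "X \<in> mats (linf I) m n \<Longrightarrow> i \<in> I \<Longrightarrow> op_norm (map_mat (\<lambda>f. f i) X) \<le> sup_norm I X"
  unfolding sup_norm_def using sup_norm_bdd by (intro cSup_upper) auto

lemma sup_norm_leI:
  "0 \<le> K \<Longrightarrow> (\<And>i. i \<in> I \<Longrightarrow> op_norm (map_mat (\<lambda>f. f i) X) \<le> K) \<Longrightarrow> sup_norm I X \<le> K"
  unfolding sup_norm_def by (intro cSup_least) auto

lemma Sup_eq_sup_norm:
  assumes r0: "r0 \<in> S" "0 \<le> r0" and upper: "\<And>r. r \<in> S \<Longrightarrow> r \<le> sup_norm I X"
    and eval: "\<And>i. i \<in> I \<Longrightarrow> op_norm (map_mat (\<lambda>f. f i) X) \<in> S"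
  shows "Sup S = sup_norm I X"
proof (rule antisym)
  have bdd: "bdd_above S" using upper by (rule bdd_aboveI)
  show "Sup S \<le> sup_norm I X" using r0 upper by (intro cSup_least) auto
  show "sup_norm I X \<le> Sup S"
    using order_trans[OF r0(2) cSup_upper[OF r0(1) bdd]] cSup_upper[OF eval bdd] by (rule sup_norm_leI)
qed

text \<open>
  A contractive functional \<open>h\<close> commutes with bilinear forms: the form of \<open>h(X)\<close> is the value of \<open>h\<close> at a
  bounded function \<open>v\<close>, and the sup norm of \<open>v\<close> is found from the forms of the \<open>X(i)\<close>. So the point
  evaluations already determine the minimal matrix norms.
\<close>

lemma mnorm_min_linf:
  assumes X: "X \<in> mats (linf I) m n"
  shows "mnorm (min_linf I) X = sup_norm I X"
proof -
  let ?S = "{op_norm (map_mat h X) | h. linear_map (linf I) complex_vs h \<and>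
     (\<forall>v\<in>carrier (linf I). cmod (h v) \<le> linf_norm I v)}"
  have upper: "r \<le> sup_norm I X" if r_mem: "r \<in> ?S" for r
  proof -
    obtain h where r: "r = op_norm (map_mat h X)" and h: "linear_map (linf I) complex_vs h"
      and contr: "\<And>v. v \<in> carrier (linf I) \<Longrightarrow> cmod (h v) \<le> linf_norm I v" using r_mem by blast
    have "op_norm (map_mat h X) \<le> sup_norm I X"
    proof (rule op_norm_leI[OF sup_norm_nonneg[OF X]])
      fix y x
      define v where "v = finsum (linf I) (\<lambda>kl. (y (fst kl) * x (snd kl)) \<odot>\<^bsub>linf I\<^esub> X $$ kl) ({..<m} \<times> {..<n})"
      have terms: "(\<lambda>kl. (y (fst kl) * x (snd kl)) \<odot>\<^bsub>linf I\<^esub> X $$ kl) \<in> {..<m} \<times> {..<n} \<rightarrow> carrier (linf I)"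
        using mats_index[OF X] module.smult_closed[OF linf_module] by fastforce
      then have v: "v \<in> carrier (linf I)"
        unfolding v_def by (intro abelian_monoid.finsum_closed abelian_group.axioms(1) module.axioms(2)[OF linf_module])
      have at_v: "g v = bilin (map_mat g X) y x" if g: "linear_map (linf I) complex_vs g" for g
      proof -
        have "g v = (\<Sum>kl\<in>{..<m} \<times> {..<n}. g ((y (fst kl) * x (snd kl)) \<odot>\<^bsub>linf I\<^esub> X $$ kl))"
          unfolding v_def by (rule linear_functional_finsum[OF linf_module g _ terms]) simp
        also have "\<dots> = (\<Sum>kl\<in>{..<m} \<times> {..<n}. (y (fst kl) * x (snd kl)) * g (X $$ kl))"
          using mats_index[OF X]
          by (intro sum.cong refl, subst linear_mapD(3)[OF g]) auto
        also have "\<dots> = bilin (map_mat g X) y x"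
          using mats_dims[OF X] by (simp add: bilin_def sum.cartesian_product case_prod_unfold mult_ac)
        finally show ?thesis .
      qed
      have v_bilin: "v i = bilin (map_mat (\<lambda>f. f i) X) y x" for i
        by (rule at_v) (auto intro: linear_mapI)
      have "cmod (bilin (map_mat h X) y x) = cmod (h v)"
        by (simp only: at_v[OF h])
      also have "\<dots> \<le> linf_norm I v" by (rule contr[OF v])
      also have "\<dots> \<le> sup_norm I X * l2 m y * l2 n x"
      proof (rule linf_norm_leI)
        show "0 \<le> sup_norm I X * l2 m y * l2 n x"
          using sup_norm_nonneg[OF X] by (simp add: L2_set_nonneg)
        show "cmod (v i) \<le> sup_norm I X * l2 m y * l2 n x" if "i \<in> I" for i
        proof -
          have "cmod (v i) \<le> op_norm (map_mat (\<lambda>f. f i) X) * l2 m y * l2 n x"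
            using bilin_le_op_norm[of "map_mat (\<lambda>f. f i) X" y x] mats_dims[OF X] by (simp add: v_bilin)
          also have "\<dots> \<le> sup_norm I X * l2 m y * l2 n x"
            by (intro mult_right_mono op_norm_le_sup_norm[OF X that] L2_set_nonneg)
          finally show ?thesis .
        qed
      qed
      finally show "cmod (bilin (map_mat h X) y x)
          \<le> sup_norm I X * l2 (dim_row (map_mat h X)) y * l2 (dim_col (map_mat h X)) x"
        using mats_dims[OF X] by simp
    qed
    then show ?thesis by (simp add: r)
  qed
  have zero: "op_norm (map_mat (\<lambda>_. 0) X) \<in> ?S"
    by (intro CollectI exI[of _ "\<lambda>_. 0"] conjI refl linear_mapI) (auto simp: linf_norm_nonneg)
  have eval: "op_norm (map_mat (\<lambda>f. f i) X) \<in> ?S" if "i \<in> I" for i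
    using linf_bound[OF _ that] by (intro CollectI exI[of _ "\<lambda>f. f i"] conjI refl linear_mapI) auto
  have "Sup ?S = sup_norm I X"
    by (rule Sup_eq_sup_norm[OF zero op_norm_nonneg upper eval])
  then show ?thesis by (simp add: min_linf_def min_op_def)
qed

section \<open>Functionals on the module tensor product are multipliers\<close>

context ol1_space
begin

definition \<delta> :: "'i \<Rightarrow> 'i \<Rightarrow> complex" where
  "\<delta> i = (\<lambda>j. if j = i then 1 else 0)"

lemma module_A: "module complex_vs A"
  by (rule E)

lemma delta_carrier: "i \<in> I \<Longrightarrow> \<delta> i \<in> carrier A"
proof -
  assume i: "i \<in> I"
  have "((\<lambda>j. cmod (\<delta> i j)) has_sum 1) I"
    by (rule has_sum_finite_neutralI[of "{i}"]) (use i in \<open>auto simp: \<delta>_def\<close>)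
  then show ?thesis
    using i by (auto simp: carrier_A_iff \<delta>_def has_sum_imp_summable)
qed

lemma l1_norm_delta: "i \<in> I \<Longrightarrow> l1_norm I (\<delta> i) = 1"
proof -
  assume i: "i \<in> I"
  have "((\<lambda>j. cmod (\<delta> i j)) has_sum 1) I"
    by (rule has_sum_finite_neutralI[of "{i}"]) (use i in \<open>auto simp: \<delta>_def\<close>)
  then show ?thesis unfolding l1_norm_def by (rule infsumI)
qed

lemma l1_norm_nonneg: "0 \<le> l1_norm I f"
  unfolding l1_norm_def by (rule infsum_nonneg) simp

lemma cmod_le_l1_norm:
  assumes "f \<in> carrier A" "i \<in> I"
  shows "cmod (f i) \<le> l1_norm I f"
  using sum_le_l1_norm[OF assms(1), of "{i}"] assms(2) by simp

lemma mult_carrier: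
  assumes "f \<in> carrier A" "g \<in> carrier A"
  shows "(\<lambda>i. f i * g i) \<in> carrier A"
proof -
  have "(\<lambda>i. cmod (f i) * l1_norm I g) summable_on I"
    using assms(1) by (intro summable_on_cmult_left) (simp add: carrier_A_iff)
  then have "(\<lambda>i. cmod (f i * g i)) summable_on I"
    by (rule abs_summable_on_comparison_test')
      (use cmod_le_l1_norm[OF assms(2)] in \<open>simp add: norm_mult mult_left_mono\<close>)
  then show ?thesis using assms by (simp add: carrier_A_iff)
qed

lemma restrict_carrier:
  assumes "f \<in> carrier A"
  shows "(\<lambda>j. if j \<in> S then f j else 0) \<in> carrier A"
proof -
  have "(\<lambda>j. cmod (f j)) summable_on I" using assms by (simp add: carrier_A_iff)
  then have "(\<lambda>j. cmod (if j \<in> S then f j else 0)) summable_on I"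
    by (rule abs_summable_on_comparison_test') simp
  then show ?thesis using assms by (simp add: carrier_A_iff)
qed

lemma l1_norm_tail_tendsto:
  assumes f: "f \<in> carrier A"
  shows "((\<lambda>F. l1_norm I (\<lambda>j. if j \<in> - F then f j else 0)) \<longlongrightarrow> 0) (finite_subsets_at_top I)"
proof -
  have sum: "((\<lambda>j. cmod (f j)) has_sum l1_norm I f) I"
    unfolding l1_norm_def using f by (intro has_sum_infsum) (simp add: carrier_A_iff)
  have tail: "l1_norm I (\<lambda>j. if j \<in> - F then f j else 0) = l1_norm I f - (\<Sum>j\<in>F. cmod (f j))"
    if "finite F" "F \<subseteq> I" for F
  proof -
    have "((\<lambda>j. cmod (if j \<in> F then f j else 0)) has_sum (\<Sum>j\<in>F. cmod (f j))) I"
      by (rule has_sum_finite_neutralI[of F]) (use that in auto)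
    moreover have "(\<lambda>j. cmod (if j \<in> - F then f j else 0)) summable_on I"
      using restrict_carrier[OF f, of "- F"] by (simp add: carrier_A_iff)
    ultimately have "((\<lambda>j. cmod (if j \<in> F then f j else 0) + cmod (if j \<in> - F then f j else 0))
        has_sum ((\<Sum>j\<in>F. cmod (f j)) + l1_norm I (\<lambda>j. if j \<in> - F then f j else 0))) I"
      unfolding l1_norm_def by (intro has_sum_add has_sum_infsum)
    also have "(\<lambda>j. cmod (if j \<in> F then f j else 0) + cmod (if j \<in> - F then f j else 0)) = (\<lambda>j. cmod (f j))"
      by auto
    finally show ?thesis using has_sum_unique[OF sum] by simp
  qed
  have "((\<lambda>F. l1_norm I f - (\<Sum>j\<in>F. cmod (f j))) \<longlongrightarrow> l1_norm I f - l1_norm I f) (finite_subsets_at_top I)"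
    using sum unfolding has_sum_def by (intro tendsto_diff tendsto_const)
  then have "((\<lambda>F. l1_norm I f - (\<Sum>j\<in>F. cmod (f j))) \<longlongrightarrow> 0) (finite_subsets_at_top I)" by simp
  then show ?thesis
    by (rule Lim_transform_eventually)
      (intro eventually_finite_subsets_at_top_weakI, rule tail[symmetric])
qed

text \<open>
  A bounded balanced form is diagonal: \<open>g(\<delta>\<^sub>i \<otimes> b) = g(\<delta>\<^sub>i \<delta>\<^sub>i \<otimes> b) = g(\<delta>\<^sub>i \<otimes> \<delta>\<^sub>i b)\<close>, and
  \<open>\<delta>\<^sub>i b\<close> is a multiple of \<open>\<delta>\<^sub>i\<close>. Boundedness then gives the value at \<open>a \<otimes> b\<close> from the finite
  truncations of \<open>a\<close>.
\<close>

lemma balanced_functional_has_sum: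
  assumes g: "linear_map T complex_vs g" and B: "0 \<le> B"
    and bound: "\<And>t. t \<in> carrier T \<Longrightarrow> cmod (g t) \<le> B * vnorm H t"
    and balanced: "\<And>a b c. a \<in> carrier A \<Longrightarrow> b \<in> carrier A \<Longrightarrow> c \<in> carrier A \<Longrightarrow>
      g (el (\<lambda>i. a i * b i) c) = g (el a (\<lambda>i. b i * c i))"
    and a: "a \<in> carrier A" and b: "b \<in> carrier A"
  shows "((\<lambda>i. g (el (\<delta> i) (\<delta> i)) * (a i * b i)) has_sum g (el a b)) I"
proof -
  let ?\<phi> = "\<lambda>i. g (el (\<delta> i) (\<delta> i))"
  let ?fin = "\<lambda>F. \<lambda>j. if j \<in> F then a j else 0"
  have delta_left: "g (el (\<lambda>j. c * \<delta> i j) b) = ?\<phi> i * (c * b i)" if i: "i \<in> I" for i c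
  proof -
    note d = delta_carrier[OF i]
    have "(\<lambda>j. \<delta> i j * \<delta> i j) = \<delta> i" by (auto simp: \<delta>_def)
    then have "g (el (\<delta> i) b) = g (el (\<lambda>j. \<delta> i j * \<delta> i j) b)" by simp
    also have "\<dots> = g (el (\<delta> i) (\<lambda>j. \<delta> i j * b j))" by (rule balanced[OF d d b])
    also have "(\<lambda>j. \<delta> i j * b j) = b i \<odot>\<^bsub>A\<^esub> \<delta> i" by (auto simp: \<delta>_def)
    also have "g (el (\<delta> i) (b i \<odot>\<^bsub>A\<^esub> \<delta> i)) = b i * ?\<phi> i"
      using linear_mapD(3)[OF g el_closed[OF d d]] by (simp only: el_smult_right[OF d d] complex_vs_simps)
    finally have "g (el (\<delta> i) b) = b i * ?\<phi> i" .
    moreover have "g (el (c \<odot>\<^bsub>A\<^esub> \<delta> i) b) = c * g (el (\<delta> i) b)"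
      using linear_mapD(3)[OF g el_closed[OF d b]] by (simp only: el_smult_left[OF d b] complex_vs_simps)
    ultimately show ?thesis by (simp add: mult_ac)
  qed
  have finite_part: "g (el (?fin F) b) = (\<Sum>i\<in>F. ?\<phi> i * (a i * b i))" if "finite F" "F \<subseteq> I" for F
    using that
  proof (induction F)
    case empty
    have "el (\<lambda>_. 0) b = \<zero>\<^bsub>T\<^esub>" using el_zero_left[OF b] by simp
    then show ?case using linear_functional_zero[OF module_T g] by simp
  next
    case (insert i F)
    then have i: "i \<in> I" by simp
    have "?fin (insert i F) = ?fin F \<oplus>\<^bsub>A\<^esub> (\<lambda>j. a i * \<delta> i j)"
      using insert.hyps by (auto simp: \<delta>_def)
    moreover have da: "(\<lambda>j. a i * \<delta> i j) \<in> carrier A"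
      using module.smult_closed[OF module_A _ delta_carrier[OF i], of "a i"] by simp
    ultimately have "el (?fin (insert i F)) b = el (?fin F) b \<oplus>\<^bsub>T\<^esub> el (\<lambda>j. a i * \<delta> i j) b"
      using el_add_left[OF restrict_carrier[OF a] da b] by simp
    then have "g (el (?fin (insert i F)) b) = g (el (?fin F) b) + g (el (\<lambda>j. a i * \<delta> i j) b)"
      using linear_mapD(2)[OF g el_closed[OF restrict_carrier[OF a] b] el_closed[OF da b]] by simp
    then show ?case using insert delta_left[OF i, of "a i"] by simp
  qed
  have err: "norm (g (el a b) - (\<Sum>i\<in>F. ?\<phi> i * (a i * b i)))
      \<le> norm (l1_norm I (\<lambda>j. if j \<in> - F then a j else 0)) * (B * l1_norm I b)" if F: "finite F" "F \<subseteq> I" for F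
  proof -
    let ?tail = "\<lambda>j. if j \<in> - F then a j else 0"
    note fc = restrict_carrier[OF a, of F] and tc = restrict_carrier[OF a, of "- F"]
    have "a = ?fin F \<oplus>\<^bsub>A\<^esub> ?tail" by auto
    then have "g (el a b) = g (el (?fin F \<oplus>\<^bsub>A\<^esub> ?tail) b)" by simp
    also have "\<dots> = g (el (?fin F) b) + g (el ?tail b)"
      using linear_mapD(2)[OF g el_closed[OF fc b] el_closed[OF tc b]]
      by (simp only: el_add_left[OF fc tc b] complex_vs_simps)
    finally have "g (el a b) - (\<Sum>i\<in>F. ?\<phi> i * (a i * b i)) = g (el ?tail b)"
      using finite_part[OF F] by simp
    also have "norm \<dots> \<le> B * vnorm H (el ?tail b)" by (rule bound[OF el_closed[OF tc b]])
    also have "\<dots> \<le> B * (l1_norm I ?tail * l1_norm I b)"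
      using vnorm_el_le[OF tc b] B by (simp only: vnorm_A[OF tc] vnorm_A[OF b] mult_left_mono)
    finally show ?thesis using l1_norm_nonneg[of ?tail] by (simp add: mult_ac)
  qed
  have "((\<lambda>F. g (el a b) - (\<Sum>i\<in>F. ?\<phi> i * (a i * b i))) \<longlongrightarrow> 0) (finite_subsets_at_top I)"
    by (rule tendsto_0_le[OF l1_norm_tail_tendsto[OF a] eventually_finite_subsets_at_top_weakI[OF err]])
  from tendsto_diff[OF tendsto_const[of "g (el a b)"] this]
  show ?thesis by (simp add: has_sum_def)
qed

lemma multiplier_summable:
  assumes \<phi>: "\<And>i. i \<in> I \<Longrightarrow> cmod (\<phi> i) \<le> K" and "a \<in> carrier A" "b \<in> carrier A"
  shows "(\<lambda>i. \<phi> i * (a i * b i)) summable_on I"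
proof -
  have "(\<lambda>i. K * cmod (a i * b i)) summable_on I"
    using mult_carrier[OF assms(2,3)] by (intro summable_on_cmult_right) (simp add: carrier_A_iff)
  then have "(\<lambda>i. cmod (\<phi> i * (a i * b i))) summable_on I"
    by (rule abs_summable_on_comparison_test')
      (use \<phi> in \<open>simp add: norm_mult mult_right_mono\<close>)
  then show ?thesis by (rule abs_summable_summable)
qed

text \<open>
  The functional is bounded because of the multiplier bound for \<open>1 \<times> 1\<close> matrices.
\<close>

lemma multiplier_functional:
  assumes \<phi>: "\<And>i. i \<in> I \<Longrightarrow> cmod (\<phi> i) \<le> K" and K: "0 \<le> K"
  shows "\<exists>g. linear_map T complex_vs g \<and> (\<forall>t\<in>carrier T. cmod (g t) \<le> K * vnorm H t) \<and>
    (\<forall>a\<in>carrier A. \<forall>b\<in>carrier A. ((\<lambda>i. \<phi> i * (a i * b i)) has_sum g (el a b)) I)"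
proof -
  define \<beta> where "\<beta> a b = (\<Sum>\<^sub>\<infinity>i\<in>I. \<phi> i * (a i * b i))" for a b
  have \<beta>: "((\<lambda>i. \<phi> i * (a i * b i)) has_sum \<beta> a b) I" if "a \<in> carrier A" "b \<in> carrier A" for a b
    unfolding \<beta>_def by (rule has_sum_infsum[OF multiplier_summable[OF \<phi> that]])
  have \<beta>_eq: "\<beta> a b = s" if "((\<lambda>i. \<phi> i * (a i * b i)) has_sum s) I" for a b s
    unfolding \<beta>_def using that by (rule infsumI)
  have "\<exists>g. linear_map T complex_vs g \<and> (\<forall>a\<in>carrier A. \<forall>b\<in>carrier A. g (el a b) = \<beta> a b)"
  proof (rule bilinear_form_functional)
    fix x x' y assume c: "x \<in> carrier A" "x' \<in> carrier A" "y \<in> carrier A"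
    show "\<beta> (x \<oplus>\<^bsub>A\<^esub> x') y = \<beta> x y + \<beta> x' y"
      by (rule \<beta>_eq) (use has_sum_add[OF \<beta>[OF c(1,3)] \<beta>[OF c(2,3)]] in \<open>simp add: algebra_simps\<close>)
    show "\<beta> x (x' \<oplus>\<^bsub>A\<^esub> y) = \<beta> x x' + \<beta> x y"
      by (rule \<beta>_eq) (use has_sum_add[OF \<beta>[OF c(1,2)] \<beta>[OF c(1,3)]] in \<open>simp add: algebra_simps\<close>)
  next
    fix c x y assume xy: "x \<in> carrier A" "y \<in> carrier A"
    show "\<beta> (c \<odot>\<^bsub>A\<^esub> x) y = c * \<beta> x y"
      by (rule \<beta>_eq) (use has_sum_cmult_right[OF \<beta>[OF xy], of c] in \<open>simp add: mult_ac\<close>)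
    show "\<beta> x (c \<odot>\<^bsub>A\<^esub> y) = c * \<beta> x y"
      by (rule \<beta>_eq) (use has_sum_cmult_right[OF \<beta>[OF xy], of c] in \<open>simp add: mult_ac\<close>)
  qed
  then obtain g where g: "linear_map T complex_vs g"
    and el: "\<And>a b. a \<in> carrier A \<Longrightarrow> b \<in> carrier A \<Longrightarrow> g (el a b) = \<beta> a b" by blast
  have "cmod (g t) \<le> K * vnorm H t" if t: "t \<in> carrier T" for t
  proof -
    have "op_norm (amplify (mat 1 1 (\<lambda>_. g)) (mat 1 1 (\<lambda>_. t))) \<le> K * mnorm H (mat 1 1 (\<lambda>_. t))"
    proof (rule multiplier_bound[OF K, where N = 1 and P = "\<lambda>i. mat 1 1 (\<lambda>_. \<phi> i)"])
      show "op_norm (mat 1 1 (\<lambda>_. \<phi> i)) \<le> K" if "i \<in> I" for i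
        unfolding op_norm_1x1 by (rule \<phi>[OF that])
      show "mat 1 1 (\<lambda>_. t) \<in> mats H 1 1" using t by (simp add: mats_def)
    qed (use g el \<beta> in auto)
    then show ?thesis by (simp only: op_norm_amplify_1x1 vnorm_def)
  qed
  then show ?thesis using g el \<beta> by (intro exI[of _ g]) simp
qed

subsection \<open>The module tensor product and its dual\<close>

abbreviation "Hc \<equiv> completion H"
abbreviation "Bal \<equiv> balanced_subspace A A (monoid.mult A)"
abbreviation "M \<equiv> module_haagerup A A (monoid.mult A)"
abbreviation "D \<equiv> haagerup_dual A A (monoid.mult A)"
abbreviation "C \<equiv> cauchy_seqs H"
abbreviation "null \<equiv> null_seqs H"

definition generators :: "(nat \<Rightarrow> (('i \<Rightarrow> complex) \<times> ('i \<Rightarrow> complex) \<Rightarrow>\<^sub>0 complex) set) set set" where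
  "generators = {completion_embed H (el (\<lambda>i. a i * b i) c) \<ominus>\<^bsub>Hc\<^esub> completion_embed H (el a (\<lambda>i. b i * c i)) | a b c.
     a \<in> carrier A \<and> b \<in> carrier A \<and> c \<in> carrier A}"

lemma Bal_eq: "Bal = closed_linear_span Hc generators"
  by (simp add: balanced_subspace_def generators_def haagerup_def tensor_elem_def)

lemma M_eq: "M = quotient_op Hc Bal"
  by (simp add: module_haagerup_def haagerup_def)

lemma D_eq: "D = dual_op M"
  by (simp add: haagerup_dual_def)

lemma Hc_eq: "Hc = quotient_op C null"
  by (simp add: completion_def)

interpretation HS: entrywise_seminormed H by (rule entrywise_seminormed_H)

lemma matrix_seminormed_Hc: "matrix_seminormed Hc"
  by (rule HS.matrix_seminormed_completion)

interpretation Hc: matrix_seminormed Hc by (rule matrix_seminormed_Hc)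

lemma module_Hc: "module complex_vs Hc" by (rule Hc.module_V)

lemma seminormed_subspace_null: "seminormed_subspace C null"
  by (rule HS.seminormed_subspace_null)

interpretation null: seminormed_subspace C null by (rule seminormed_subspace_null)

lemma embed_linear: "linear_map T Hc (completion_embed H)"
  using HS.linear_map_completion_embed by simp

lemma generators_subset: "generators \<subseteq> carrier Hc"
proof -
  have "abelian_group Hc" using module_Hc by (rule module.axioms(2))
  then show ?thesis
    unfolding generators_def
    by (auto intro!: abelian_group.minus_closed linear_mapD(1)[OF embed_linear] el_closed mult_carrier)
qed

lemma seminormed_subspace_Bal: "seminormed_subspace Hc Bal"
proof -
  have "submodule Bal complex_vs Hc"
    unfolding Bal_eq
    by (rule Hc.closed_linear_span_submodule[OF generators_subset])
  then show ?thesis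
    by (intro seminormed_subspace.intro matrix_seminormed_Hc complex_subspace.intro[OF module_Hc]
        complex_subspace_axioms.intro)
qed

interpretation Bal: seminormed_subspace Hc Bal by (rule seminormed_subspace_Bal)

lemma matrix_seminormed_M: "matrix_seminormed M"
  unfolding M_eq by (rule Bal.matrix_seminormed_Q)

interpretation M: matrix_seminormed M by (rule matrix_seminormed_M)

definition cls :: "(('i \<Rightarrow> complex) \<times> ('i \<Rightarrow> complex) \<Rightarrow>\<^sub>0 complex) set \<Rightarrow> (nat \<Rightarrow> (('i \<Rightarrow> complex) \<times> ('i \<Rightarrow> complex) \<Rightarrow>\<^sub>0 complex) set) set set" where
  "cls t = Bal +>\<^bsub>Hc\<^esub> completion_embed H t"

lemma cls_linear: "linear_map T M cls"
  using linear_map_comp[OF embed_linear Bal.linear_map_coset_Q]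
  unfolding cls_def[abs_def] M_eq .

lemma vnorm_cls_le:
  assumes "t \<in> carrier T"
  shows "vnorm M (cls t) \<le> vnorm H t"
proof -
  have "vnorm M (cls t) \<le> vnorm Hc (completion_embed H t)"
    unfolding M_eq cls_def
    by (rule Bal.vnorm_coset_le[OF linear_mapD(1)[OF embed_linear assms]])
  also have "\<dots> \<le> vnorm H t"
    using HS.vnorm_completion_embed_le[ of t] assms by simp
  finally show ?thesis .
qed

lemma cls_balanced:
  assumes "a \<in> carrier A" "b \<in> carrier A" "c \<in> carrier A"
  shows "cls (el (\<lambda>i. a i * b i) c) = cls (el a (\<lambda>i. b i * c i))"
proof -
  have in_Hc: "completion_embed H (el (\<lambda>i. a i * b i) c) \<in> carrier Hc"
    "completion_embed H (el a (\<lambda>i. b i * c i)) \<in> carrier Hc"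
    using assms by (auto intro!: linear_mapD(1)[OF embed_linear] el_closed mult_carrier)
  have "completion_embed H (el (\<lambda>i. a i * b i) c) \<ominus>\<^bsub>Hc\<^esub> completion_embed H (el a (\<lambda>i. b i * c i)) \<in> generators"
    unfolding generators_def using assms by blast
  then have "completion_embed H (el (\<lambda>i. a i * b i) c) \<ominus>\<^bsub>Hc\<^esub> completion_embed H (el a (\<lambda>i. b i * c i)) \<in> Bal"
    unfolding Bal_eq
    using Hc.closed_linear_span_superset[OF generators_subset] by blast
  then show ?thesis
    unfolding cls_def
    using Bal.coset_eq_iff[OF in_Hc] by blast
qed

lemma carrier_D_iff: "f \<in> carrier D \<longleftrightarrow> linear_map M complex_vs f \<and> (\<forall>x. x \<notin> carrier M \<longrightarrow> f x = 0) \<and>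
    (\<exists>B. \<forall>x\<in>carrier M. cmod (f x) \<le> B * vnorm M x)"
  by (simp add: D_eq dual_op_def)

lemma D_bound:
  assumes "f \<in> carrier D"
  obtains B where "0 \<le> B" "\<And>x. x \<in> carrier M \<Longrightarrow> cmod (f x) \<le> B * vnorm M x"
proof -
  obtain B where B: "\<And>x. x \<in> carrier M \<Longrightarrow> cmod (f x) \<le> B * vnorm M x"
    using assms by (auto simp: carrier_D_iff)
  have "cmod (f x) \<le> \<bar>B\<bar> * vnorm M x" if "x \<in> carrier M" for x
    using B[OF that] M.vnorm_nonneg[OF that]
    by (meson abs_ge_self mult_right_mono order_trans)
  then show thesis by (intro that[of "\<bar>B\<bar>"]) auto
qed

lemma D_has_sum:
  assumes f: "f \<in> carrier D" and ab: "a \<in> carrier A" "b \<in> carrier A"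
  shows "((\<lambda>i. f (cls (el (\<delta> i) (\<delta> i))) * (a i * b i)) has_sum f (cls (el a b))) I"
proof -
  obtain B where B: "0 \<le> B" "\<And>x. x \<in> carrier M \<Longrightarrow> cmod (f x) \<le> B * vnorm M x"
    using D_bound[OF f] by blast
  have lin: "linear_map T complex_vs (\<lambda>t. f (cls t))"
    using f by (intro linear_map_comp[OF cls_linear]) (simp add: carrier_D_iff)
  show ?thesis
  proof (rule balanced_functional_has_sum[OF lin B(1) _ _ ab])
    show "cmod (f (cls t)) \<le> B * vnorm H t" if "t \<in> carrier T" for t
      using B(2)[OF linear_mapD(1)[OF cls_linear that]] mult_left_mono[OF vnorm_cls_le[OF that] B(1)]
      by linarith
  qed (simp add: cls_balanced)
qed

text \<open>
  The functionals restricted to the algebraic tensor product have the multiplier form, so the multiplier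
  bound applies there. Continuity extends it to Cauchy sequences, and lifting matrices of classes with
  almost the same norm carries it through the two quotients.
\<close>

lemma amplify_bound_M:
  assumes K: "0 \<le> K" and \<Phi>: "\<Phi> \<in> mats D N N"
    and le: "\<And>i. i \<in> I \<Longrightarrow> op_norm (map_mat (\<lambda>f. f (cls (el (\<delta> i) (\<delta> i)))) \<Phi>) \<le> K"
    and x: "x \<in> mats M p q"
  shows "op_norm (amplify \<Phi> x) \<le> K * mnorm M x"
proof -
  let ?\<Psi> = "map_mat (\<lambda>f t. f (cls t)) \<Phi>"
  let ?\<Phi>1 = "map_mat (\<lambda>f v. f (Bal +>\<^bsub>Hc\<^esub> v)) \<Phi>"
  let ?\<Phi>2 = "map_mat (\<lambda>f s. f (null +>\<^bsub>C\<^esub> s)) ?\<Phi>1"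
  note \<Phi>d = mats_dims[OF \<Phi>]
  have alg: "op_norm (amplify ?\<Psi> u) \<le> K * mnorm H u" if "u \<in> mats H p q" for u
  proof (rule multiplier_bound[OF K, where N = N and P = "\<lambda>i. map_mat (\<lambda>f. f (cls (el (\<delta> i) (\<delta> i)))) \<Phi>"])
    show "linear_map T complex_vs (?\<Psi> $$ (r, s))" if "r < N" "s < N" for r s
      using linear_map_comp[OF cls_linear, of complex_vs "\<Phi> $$ (r, s)"] mats_index[OF \<Phi> that] that \<Phi>d
      by (simp add: carrier_D_iff)
    show "((\<lambda>i. map_mat (\<lambda>f. f (cls (el (\<delta> i) (\<delta> i)))) \<Phi> $$ (r, s) * (a i * b i)) has_sum (?\<Psi> $$ (r, s)) (el a b)) I"
      if "r < N" "s < N" "a \<in> carrier A" "b \<in> carrier A" for r s a b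
      using D_has_sum[OF mats_index[OF \<Phi> that(1,2)] that(3,4)] that \<Phi>d by simp
  qed (use \<Phi>d le that in auto)
  have cauchy: "op_norm (amplify ?\<Phi>2 y) \<le> K * mnorm C y" if y: "y \<in> mats C p q" for y
  proof (rule HS.amplify_bound_C[OF K, where \<Psi> = ?\<Psi> and p = p and q = q])
    fix i j s assume ij: "i < dim_row ?\<Phi>2" "j < dim_col ?\<Phi>2" and s: "s \<in> carrier C"
    define f where "f = \<Phi> $$ (i, j)"
    have f: "f \<in> carrier D" unfolding f_def using ij \<Phi>d by (intro mats_index[OF \<Phi>]) auto
    obtain B where B: "0 \<le> B" "\<And>x. x \<in> carrier M \<Longrightarrow> cmod (f x) \<le> B * vnorm M x"
      using D_bound[OF f] by blast
    let ?f = "\<lambda>s. f (Bal +>\<^bsub>Hc\<^esub> (null +>\<^bsub>C\<^esub> s))"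
    have "linear_map C Hc (\<lambda>s. null +>\<^bsub>C\<^esub> s)"
      unfolding Hc_eq by (rule null.linear_map_coset_Q)
    from linear_map_comp[OF this Bal.linear_map_coset_Q]
    have CM: "linear_map C M (\<lambda>s. Bal +>\<^bsub>Hc\<^esub> (null +>\<^bsub>C\<^esub> s))" unfolding M_eq .
    have lin: "linear_map C complex_vs ?f"
      using f by (intro linear_map_comp[OF CM]) (simp add: carrier_D_iff)
    have "cmod (?f s) \<le> B * vnorm C s" if s: "s \<in> carrier C" for s
    proof -
      have v: "null +>\<^bsub>C\<^esub> s \<in> carrier Hc"
        unfolding Hc_eq by (rule linear_mapD(1)[OF null.linear_map_coset_Q s])
      have "vnorm M (Bal +>\<^bsub>Hc\<^esub> (null +>\<^bsub>C\<^esub> s)) \<le> vnorm Hc (null +>\<^bsub>C\<^esub> s)"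
        unfolding M_eq by (rule Bal.vnorm_coset_le[OF v])
      also have "\<dots> \<le> vnorm C s"
        unfolding Hc_eq by (rule null.vnorm_coset_le[OF s])
      finally have "B * vnorm M (Bal +>\<^bsub>Hc\<^esub> (null +>\<^bsub>C\<^esub> s)) \<le> B * vnorm C s"
        using B(1) by (rule mult_left_mono)
      then show ?thesis using B(2)[OF linear_mapD(1)[OF CM s]] by linarith
    qed
    from HS.bounded_functional_C_tendsto[OF B(1) lin this s]
    show "(\<lambda>k. (?\<Psi> $$ (i, j)) (s k)) \<longlonglongrightarrow> (?\<Phi>2 $$ (i, j)) s"
      using ij by (simp add: f_def cls_def completion_embed_def)
  qed (use alg y in auto)
  have completed: "op_norm (amplify ?\<Phi>1 y) \<le> K * mnorm Hc y" if y: "y \<in> mats Hc p q" for y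
    unfolding Hc_eq
    by (rule null.amplify_bound_Q[OF K y[unfolded Hc_eq]])
      (rule cauchy[unfolded Hc_eq])
  show ?thesis
    unfolding M_eq
    by (rule Bal.amplify_bound_Q[OF K x[unfolded M_eq] completed])
qed

section \<open>Identification of the dual\<close>

definition symbol :: "((nat \<Rightarrow> (('i \<Rightarrow> complex) \<times> ('i \<Rightarrow> complex) \<Rightarrow>\<^sub>0 complex) set) set set \<Rightarrow> complex) \<Rightarrow> 'i \<Rightarrow> complex" where
  "symbol f = (\<lambda>i. if i \<in> I then f (cls (el (\<delta> i) (\<delta> i))) else 0)"

lemma cls_delta:
  assumes "i \<in> I"
  shows "cls (el (\<delta> i) (\<delta> i)) \<in> carrier M" and "vnorm M (cls (el (\<delta> i) (\<delta> i))) \<le> 1"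
proof -
  note d = delta_carrier[OF assms]
  show "cls (el (\<delta> i) (\<delta> i)) \<in> carrier M"
    by (rule linear_mapD(1)[OF cls_linear el_closed[OF d d]])
  have "vnorm M (cls (el (\<delta> i) (\<delta> i))) \<le> vnorm H (el (\<delta> i) (\<delta> i))"
    by (rule vnorm_cls_le[OF el_closed[OF d d]])
  also have "\<dots> \<le> vnorm A (\<delta> i) * vnorm A (\<delta> i)" by (rule vnorm_el_le[OF d d])
  also have "\<dots> = 1" by (simp only: vnorm_A[OF d] l1_norm_delta[OF assms] mult_1)
  finally show "vnorm M (cls (el (\<delta> i) (\<delta> i))) \<le> 1" .
qed

lemma symbol_linf:
  assumes "f \<in> carrier D"
  shows "symbol f \<in> carrier (linf I)"
proof -
  obtain B where B: "0 \<le> B" "\<And>x. x \<in> carrier M \<Longrightarrow> cmod (f x) \<le> B * vnorm M x"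
    using D_bound[OF assms] by blast
  show ?thesis
  proof (rule linf_carrierI)
    show "cmod (symbol f i) \<le> B" if "i \<in> I" for i
      using B(2)[OF cls_delta(1)[OF that]] mult_left_mono[OF cls_delta(2)[OF that] B(1)] that
      by (simp add: symbol_def)
  qed (simp add: symbol_def)
qed

lemma D_simps [simp]:
  "add D = (\<lambda>f g x. f x + g x)" "smult D = (\<lambda>c f x. c * f x)"
  by (simp_all add: D_eq dual_op_def)

lemma symbol_linear: "linear_map D (min_linf I) symbol"
proof (rule linear_mapI)
  show "symbol f \<in> carrier (min_linf I)" if "f \<in> carrier D" for f
    using symbol_linf[OF that] by (simp add: min_linf_def min_op_def)
qed (auto simp: min_linf_def min_op_def symbol_def)

lemma map_symbol_mats: "\<Phi> \<in> mats D m n \<Longrightarrow> map_mat symbol \<Phi> \<in> mats (linf I) m n"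
  by (rule map_mat_mats) (auto intro: symbol_linf)

lemma eval_map_symbol:
  "i \<in> I \<Longrightarrow> map_mat (\<lambda>\<phi>. \<phi> i) (map_mat symbol \<Phi>) = map_mat (\<lambda>f. f (cls (el (\<delta> i) (\<delta> i)))) \<Phi>"
  by (rule eq_matI) (auto simp: symbol_def)

lemma amplify_bound_symbol:
  assumes \<Phi>: "\<Phi> \<in> mats D n n" and x: "x \<in> mats M p q"
  shows "op_norm (amplify \<Phi> x) \<le> sup_norm I (map_mat symbol \<Phi>) * mnorm M x"
proof (rule amplify_bound_M[OF sup_norm_nonneg[OF map_symbol_mats[OF \<Phi>]] \<Phi> _ x])
  show "op_norm (map_mat (\<lambda>f. f (cls (el (\<delta> i) (\<delta> i)))) \<Phi>) \<le> sup_norm I (map_mat symbol \<Phi>)" if "i \<in> I" for i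
    using op_norm_le_sup_norm[OF map_symbol_mats[OF \<Phi>] that] by (simp add: eval_map_symbol[OF that])
qed

text \<open>
  The upper bound is the multiplier bound. The classes of \<open>\<delta>\<^sub>i \<otimes> \<delta>\<^sub>i\<close> have norm at most 1, and the
  amplification at such a class is the matrix of symbols at \<open>i\<close>.
\<close>

lemma mnorm_D:
  assumes \<Phi>: "\<Phi> \<in> mats D n n"
  shows "mnorm D \<Phi> = sup_norm I (map_mat symbol \<Phi>)"
proof -
  let ?S = "{op_norm (amplify \<Phi> x) | x p. x \<in> mats M p p \<and> mnorm M x \<le> 1}"
  let ?K = "sup_norm I (map_mat symbol \<Phi>)"
  note K = sup_norm_nonneg[OF map_symbol_mats[OF \<Phi>]]
  have upper: "r \<le> ?K" if r_mem: "r \<in> ?S" for r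
  proof -
    obtain x p where x: "r = op_norm (amplify \<Phi> x)" "x \<in> mats M p p" "mnorm M x \<le> 1" using r_mem by blast
    have "r \<le> ?K * mnorm M x" unfolding x(1) by (rule amplify_bound_symbol[OF \<Phi> x(2)])
    also have "\<dots> \<le> ?K" using x(3) K by (simp add: mult_left_le)
    finally show ?thesis .
  qed
  have unit: "op_norm (amplify \<Phi> (mat 1 1 (\<lambda>_. v))) \<in> ?S" if "v \<in> carrier M" "vnorm M v \<le> 1" for v
    using that M.singleton_mats unfolding vnorm_def by blast
  have zero: "op_norm (amplify \<Phi> (mat 1 1 (\<lambda>_. \<zero>\<^bsub>M\<^esub>))) \<in> ?S"
    by (rule unit) (simp_all add: M.vnorm_zero)
  have delta: "op_norm (map_mat (\<lambda>\<phi>. \<phi> i) (map_mat symbol \<Phi>)) \<in> ?S" if "i \<in> I" for i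
  proof -
    have "amplify \<Phi> (mat 1 1 (\<lambda>_. cls (el (\<delta> i) (\<delta> i)))) = map_mat (\<lambda>\<phi>. \<phi> i) (map_mat symbol \<Phi>)"
      unfolding eval_map_symbol[OF that] by (rule eq_matI) (auto simp: amplify_index)
    then show ?thesis using unit[OF cls_delta[OF that]] by simp
  qed
  have "Sup ?S = ?K"
    by (rule Sup_eq_sup_norm[OF zero op_norm_nonneg upper delta])
  then show ?thesis by (simp add: D_eq dual_op_def)
qed

text \<open>
  A functional with symbol 0 has norm 0, by the multiplier bound with \<open>K = 0\<close>.
\<close>

lemma symbol_inj: "inj_on symbol (carrier D)"
proof (rule inj_onI)
  fix f g assume f: "f \<in> carrier D" and g: "g \<in> carrier D" and eq: "symbol f = symbol g"
  define d where "d x = f x - g x" for x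
  obtain B where B: "0 \<le> B" "\<And>x. x \<in> carrier M \<Longrightarrow> cmod (f x) \<le> B * vnorm M x" using D_bound[OF f] by blast
  obtain B' where B': "0 \<le> B'" "\<And>x. x \<in> carrier M \<Longrightarrow> cmod (g x) \<le> B' * vnorm M x" using D_bound[OF g] by blast
  have lin: "linear_map M complex_vs f" "linear_map M complex_vs g" using f g by (auto simp: carrier_D_iff)
  have d: "d \<in> carrier D"
    unfolding carrier_D_iff
  proof (intro conjI exI ballI)
    show "linear_map M complex_vs d"
      by (rule linear_mapI) (simp_all add: d_def linear_mapD[OF lin(1)] linear_mapD[OF lin(2)] algebra_simps)
    show "\<forall>x. x \<notin> carrier M \<longrightarrow> d x = 0" using f g by (simp add: d_def carrier_D_iff)
    show "cmod (d x) \<le> (B + B') * vnorm M x" if "x \<in> carrier M" for x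
      using norm_triangle_ineq4[of "f x" "g x"] B(2)[OF that] B'(2)[OF that]
      by (simp add: d_def distrib_right)
  qed
  have "f x = g x" if x: "x \<in> carrier M" for x
  proof -
    have "op_norm (amplify (mat 1 1 (\<lambda>_. d)) (mat 1 1 (\<lambda>_. x))) \<le> 0 * mnorm M (mat 1 1 (\<lambda>_. x))"
    proof (rule amplify_bound_M)
      show "mat 1 1 (\<lambda>_. d) \<in> mats D 1 1" using d by (simp add: mats_def)
      show "mat 1 1 (\<lambda>_. x) \<in> mats M 1 1" using x by (simp add: mats_def)
      show "op_norm (map_mat (\<lambda>f. f (cls (el (\<delta> i) (\<delta> i)))) (mat 1 1 (\<lambda>_. d))) \<le> 0" if "i \<in> I" for i
      proof -
        have "d (cls (el (\<delta> i) (\<delta> i))) = 0"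
          using fun_cong[OF eq, of i] that by (simp add: symbol_def d_def)
        then have "map_mat (\<lambda>f. f (cls (el (\<delta> i) (\<delta> i)))) (mat 1 1 (\<lambda>_. d)) = mat 1 1 (\<lambda>_. 0)"
          by (intro eq_matI) auto
        then show ?thesis by (simp only: op_norm_1x1 norm_zero)
      qed
    qed simp
    then have "cmod (d x) \<le> 0" by (simp only: op_norm_amplify_1x1 mult_zero_left)
    then show ?thesis by (simp add: d_def)
  qed
  then show "f = g"
    using f g by (metis carrier_D_iff ext)
qed

text \<open>
  The multiplier functional of \<open>\<phi>\<close> extends to the completion, and it vanishes on the balanced subspace because
  \<open>(a b) c = a (b c)\<close> pointwise.
\<close>

lemma symbol_surj:
  assumes \<phi>: "\<phi> \<in> carrier (linf I)"
  shows "\<exists>f\<in>carrier D. symbol f = \<phi>"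
proof -
  let ?K = "linf_norm I \<phi>"
  have K: "0 \<le> ?K" by (rule linf_norm_nonneg[OF \<phi>])
  have "\<exists>g. linear_map T complex_vs g \<and> (\<forall>t\<in>carrier T. cmod (g t) \<le> ?K * vnorm H t) \<and>
    (\<forall>a\<in>carrier A. \<forall>b\<in>carrier A. ((\<lambda>i. \<phi> i * (a i * b i)) has_sum g (el a b)) I)"
    by (rule multiplier_functional[OF linf_bound[OF \<phi>] K])
  then obtain g where g: "linear_map T complex_vs g"
    and bound: "\<And>t. t \<in> carrier T \<Longrightarrow> cmod (g t) \<le> ?K * vnorm H t"
    and sum: "\<And>a b. a \<in> carrier A \<Longrightarrow> b \<in> carrier A \<Longrightarrow> ((\<lambda>i. \<phi> i * (a i * b i)) has_sum g (el a b)) I"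
    by blast
  obtain h where h: "linear_map Hc complex_vs h"
    and h_embed: "\<And>t. t \<in> carrier T \<Longrightarrow> h (completion_embed H t) = g t"
    and h_bound: "\<And>S. S \<in> carrier Hc \<Longrightarrow> cmod (h S) \<le> ?K * vnorm Hc S"
    using HS.completion_functional[OF K, of g] g bound by auto
  have balanced: "g (el (\<lambda>i. a i * b i) c) = g (el a (\<lambda>i. b i * c i))"
    if "a \<in> carrier A" "b \<in> carrier A" "c \<in> carrier A" for a b c
    using sum[OF mult_carrier[OF that(1,2)] that(3)] sum[OF that(1) mult_carrier[OF that(2,3)]]
    by (simp add: mult.assoc has_sum_unique)
  have gen0: "h s = 0" if s_mem: "s \<in> generators" for s
  proof -
    obtain a b c where abc: "a \<in> carrier A" "b \<in> carrier A" "c \<in> carrier A"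
      and s: "s = completion_embed H (el (\<lambda>i. a i * b i) c) \<ominus>\<^bsub>Hc\<^esub> completion_embed H (el a (\<lambda>i. b i * c i))"
      using s_mem unfolding generators_def by blast
    note el1 = el_closed[OF mult_carrier[OF abc(1,2)] abc(3)] and el2 = el_closed[OF abc(1) mult_carrier[OF abc(2,3)]]
    show ?thesis
      unfolding s linear_functional_diff[OF module_Hc h linear_mapD(1)[OF embed_linear el1] linear_mapD(1)[OF embed_linear el2]]
      by (simp only: h_embed[OF el1] h_embed[OF el2] balanced[OF abc] diff_self)
  qed
  have h0: "h s = 0" if "s \<in> Bal" for s
    by (rule Hc.bounded_functional_zero_on_closed_span[OF h h_bound
          generators_subset gen0 that[unfolded Bal_eq]])
  define f where "f S = (if S \<in> carrier M then quotient_functional h S else 0)" for S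
  have q_lin: "linear_map M complex_vs (quotient_functional h)"
    using Bal.linear_map_quotient_functional[OF h h0] by (simp add: M_eq quotient_op_def)
  have q_bound: "cmod (quotient_functional h S) \<le> ?K * vnorm M S" if "S \<in> carrier M" for S
    using Bal.quotient_functional_bound[OF K h h0 h_bound] that unfolding M_eq by blast
  have f: "f \<in> carrier D"
    unfolding carrier_D_iff
  proof (intro conjI exI ballI)
    show "linear_map M complex_vs f"
      by (rule linear_mapI) (simp_all add: f_def linear_mapD[OF q_lin])
    show "cmod (f S) \<le> ?K * vnorm M S" if "S \<in> carrier M" for S
      using q_bound[OF that] that by (simp add: f_def)
  qed (simp add: f_def)
  have "symbol f i = \<phi> i" for i
  proof (cases "i \<in> I")
    case True
    note d = delta_carrier[OF True]
    note el = el_closed[OF d d]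
    have "f (cls (el (\<delta> i) (\<delta> i))) = h (completion_embed H (el (\<delta> i) (\<delta> i)))"
      using cls_delta(1)[OF True] Bal.quotient_functional_coset[OF h h0 linear_mapD(1)[OF embed_linear el]]
      by (simp add: f_def cls_def)
    also have "\<dots> = g (el (\<delta> i) (\<delta> i))" by (rule h_embed[OF el])
    also have "\<dots> = \<phi> i"
    proof (rule has_sum_unique[OF sum[OF d d]])
      show "((\<lambda>j. \<phi> j * (\<delta> i j * \<delta> i j)) has_sum \<phi> i) I"
        by (rule has_sum_finite_neutralI[of "{i}"]) (use True in \<open>auto simp: \<delta>_def\<close>)
    qed
    finally show ?thesis using True by (simp add: symbol_def)
  next
    case False
    then show ?thesis using \<phi> by (simp add: symbol_def carrier_linf_iff)
  qed
  then show ?thesis using f by auto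
qed

lemma haagerup_dual_iso: "completely_isometrically_isomorphic D (min_linf I)"
  unfolding completely_isometrically_isomorphic_def
proof (intro exI conjI allI ballI)
  show "linear_map D (min_linf I) symbol" by (rule symbol_linear)
  have carrier: "carrier (min_linf I) = carrier (linf I)" by (simp add: min_linf_def min_op_def)
  show "bij_betw symbol (carrier D) (carrier (min_linf I))"
    unfolding bij_betw_def carrier using symbol_inj symbol_linf symbol_surj by fast
  show "mnorm (min_linf I) (map_mat symbol \<Phi>) = mnorm D \<Phi>" if "\<Phi> \<in> mats D n n" for n \<Phi>
    using mnorm_min_linf[OF map_symbol_mats[OF that]] mnorm_D[OF that] by simp
qed

end

theorem proposition4p1:
  fixes I :: "'i set" and \<mu> :: "('i \<Rightarrow> complex) mat \<Rightarrow> real"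
  assumes "operator_space (ol1 I \<mu>)"
    and "\<forall>f\<in>carrier (ol1 I \<mu>). vnorm (ol1 I \<mu>) f = l1_norm I f"
  shows "completely_isometrically_isomorphic
           (haagerup_dual (ol1 I \<mu>) (ol1 I \<mu>) (monoid.mult (ol1 I \<mu>)))
           (min_linf I)"
proof -
  interpret ol1_space I \<mu>
    using assms(2) by (intro ol1_space.intro assms(1)) blast
  show ?thesis by (rule haagerup_dual_iso)
qed

end
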